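(* Let $L^\star$ be a $*$-closed $\sigma$-algebra. Then $T^\star$ is a $\sigma$-algebra with respect to the map $A\mapsto\sigma(A,P_0,P_1)$, $A\in T^0(\mathbf{g},P_0,P_1)$. In particular, for every admissible $\mathbf{g}=(g_0,g_1)$, all projections $P_j\in L^0(\mathbf{g}_j)$, and every $A\in T^0(\mathbf{g},P_0,P_1)$ the following statements are equivalent: (a) $A$ is elliptic in $T^\star$. (b) $\sigma_\ell(A,P_0,P_1):E_\ell(g_0,P_0)\to E_\ell(g_1,P_1)$ is an isomorphism for $\ell=1,\ldots,n$.
   Context: Setting. With every "datum" $g$ there is associated a scale of Hilbert spaces $H^s(g)$, $s\in\mathbb{N}_0=\{0,1,2,\dots\}$, with continuous inclusions $H^{s+1}(g)\subset H^s(g)$. $\mathbf{G}$ is a set of "admissible" pairs $\mathbf{g}=(g_0,g_1)$ of data; for such a pair write $\mathbf{g}^{(-1)}=(g_1,g_0)$, $\mathbf{g}_0=(g_0,g_0)$, $\mathbf{g}_1=(g_1,g_1)$; these are also admissible, and if $(g_0,g_1),(g_1,g_2)$ are admissible, so is $(g_0,g_2)$. For each admissible $\mathbf{g}$ and each integer $\mu\le 0$, $L^\mu(\mathbf{g})$ is a vector space of linear operators $A:H^0(g_0)\to H^0(g_1)$ inducing continuous operators $A:H^s(g_0)\to H^{s-\mu}(g_1)$ for all $s\in\mathbb{N}_0$. It is assumed that $L^\mu(\mathbf{g})\subset L^\nu(\mathbf{g})$ for $\mu\le\nu$, that composition maps $L^\mu((g_1,g_2))\times L^\nu((g_0,g_1))$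 into $L^{\mu+\nu}((g_0,g_2))$, and that the identity $1$ belongs to $L^0((g,g))$ for admissible $(g,g)$. $L^\star$ is the union of all $L^\mu(\mathbf{g})$, and $L^{-\infty}(\mathbf{g})=\bigcap_{\mu\le0}L^\mu(\mathbf{g})$ (smoothing operators). Ellipticity in $L^\star$: $A\in L^0(\mathbf{g})$ is elliptic if there is $B\in L^0(\mathbf{g}^{(-1)})$ with $BA-1\in L^{-\infty}(\mathbf{g}_0)$ and $AB-1\in L^{-\infty}(\mathbf{g}_1)$. $L^\star$ is $*$-closed if for every admissible $\mathbf{g}$ and $A\in L^0(\mathbf{g})$ there is $A^*\in L^0(\mathbf{g}^{(-1)})$ such that $A^*:H^0(g_1)\to H^0(g_0)$ is the Hilbert space adjoint of $A:H^0(g_0)\to H^0(g_1)$. $L^\star$ is a $\sigma$-algebra if there is a (linear) map $A\mapsto\sigma(A)=(\sigma_1(A),\ldots,\sigma_n(A))$ assigning to each $A\in L^0(\mathbf{g})$, $\mathbf{g}=(g_0,g_1)$ admissible, an $n$-tuple of bundle morphisms $\sigma_\ell(A):E_\ell(g_0)\to E_\ell(g_1)$ between (finite or infinite dimensional) Hilbert space bundles such that: (1) $\sigma_\ell(BA)=\sigma_\ell(B)\sigma_\ell(A)$ for all $\ell$ whenever $A\in L^0((g_0,g_1))$ and $B\in L^0((g_1,g_2))$; (2) $\sigma(R)=0$ for every smoothing operator $R$; (3) $A$ is elliptic if and only if $\sigma(A)$ is invertible, i.e. all $\sigma_\ell(A)$ are bundle isomorphisms. If $L^\star$ is $*$-closed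 one additionally requires: (4) $\sigma_\ell(A^* )=\sigma_\ell(A)^*:E_\ell(g_1)\to E_\ell(g_0)$ for all $\ell$, where $\sigma_\ell(A)^*$ is the fibrewise adjoint. Toeplitz subalgebras: for projections $P_j\in L^0(\mathbf{g}_j)$, $P_j^2=P_j$ ($j=0,1$), put $T^\mu(\mathbf{g},P_0,P_1)=\{A\in L^\mu(\mathbf{g}) : (1-P_1)A=0,\ A(1-P_0)=0\}$, $T^{-\infty}(\mathbf{g},P_0,P_1)=\bigcap_{\mu\le0}T^\mu(\mathbf{g},P_0,P_1)$; $T^\star$ is the union of all $T^\mu(\mathbf{g},P_0,P_1)$. $A\in T^0(\mathbf{g},P_0,P_1)$ is elliptic (in $T^\star$) if there is $B\in T^0(\mathbf{g}^{(-1)},P_1,P_0)$ with $BA-P_0\in T^{-\infty}(\mathbf{g}_0,P_0,P_0)$ and $AB-P_1\in T^{-\infty}(\mathbf{g}_1,P_1,P_1)$. Principal symbols in $T^\star$: since $P_j$ is a projection, $\sigma_\ell(P_j)$ is a projection in $E_\ell(g_j)$ and its range $E_\ell(g_j,P_j):=\sigma_\ell(P_j)(E_\ell(g_j))$ is a subbundle of $E_\ell(g_j)$. For $A\in T^0(\mathbf{g},P_0,P_1)$, $\sigma_\ell(A,P_0,P_1):E_\ell(g_0,P_0)\to E_\ell(g_1,P_1)$ is the restriction of $\sigma_\ell(A)$, and $\sigma(A,P_0,P_1)=(\sigma_1(A,P_0,P_1),\ldots,\sigma_n(A,P_0,P_1))$. That $T^\star$ is a $\sigma$-algebra means that (1)-(3)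 hold for this symbol map and for ellipticity in $T^\star$: it is multiplicative under composition ($T^0((g_1,g_2),P_1,P_2)\times T^0((g_0,g_1),P_0,P_1)\to T^0((g_0,g_2),P_0,P_2)$), vanishes on $T^{-\infty}$, and $A$ is elliptic iff all $\sigma_\ell(A,P_0,P_1)$ are isomorphisms. *)

theory Defs
  imports "HOL-Analysis.Analysis" "HOL-Algebra.Algebraic_Closure_Type"
begin

section \<open>Complex Hilbert spaces and bounded operators\<close>

text \<open>
  Hilbert spaces are carrier based, because families of them indexed by terms occur throughout.
  The ring component of a module record has multiplicative fields; they play no role here.
\<close>

record 'v hilbert = "(complex, 'v) module" +
  cinner :: "'v \<Rightarrow> 'v \<Rightarrow> complex"

definition hnorm :: "'v hilbert \<Rightarrow> 'v \<Rightarrow> real" where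
  "hnorm H x = sqrt (Re (cinner H x x))"

text \<open>The value outside the carrier only serves to make this a distance in the sense of
  \<^locale>\<open>Metric_space\<close>, which demands symmetry everywhere.\<close>

definition hdist :: "'v hilbert \<Rightarrow> 'v \<Rightarrow> 'v \<Rightarrow> real" where
  "hdist H x y =
     (if x \<in> carrier H \<and> y \<in> carrier H then hnorm H (x \<ominus>\<^bsub>H\<^esub> y) else 0)"

locale hilbert_space = Module.module "ring_of_type_algebra :: complex ring" H
  for H :: "'v hilbert" (structure) +
  assumes cinner_add_left:
      "\<lbrakk>x \<in> carrier H; y \<in> carrier H; z \<in> carrier H\<rbrakk> \<Longrightarrow>
        cinner H (x \<oplus> y) z = cinner H x z + cinner H y z"
    and cinner_scale_left:
      "\<lbrakk>x \<in> carrier H; y \<in> carrier H\<rbrakk> \<Longrightarrow> cinner H (c \<odot> x) y = c * cinner H x y"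
    and cinner_commute:
      "\<lbrakk>x \<in> carrier H; y \<in> carrier H\<rbrakk> \<Longrightarrow> cinner H x y = cnj (cinner H y x)"
    and cinner_ge_zero: "x \<in> carrier H \<Longrightarrow> 0 \<le> Re (cinner H x x)"
    and cinner_eq_zero: "\<lbrakk>x \<in> carrier H; cinner H x x = 0\<rbrakk> \<Longrightarrow> x = \<zero>"
    and complete: "Metric_space.mcomplete (carrier H) (hdist H)"

text \<open>
  Operators are extensional functions (undefined off the carrier of their domain), so that
  equality of operators is equality in HOL.
\<close>

definition linear_ops :: "'v hilbert \<Rightarrow> 'w hilbert \<Rightarrow> ('v \<Rightarrow> 'w) set" where
  "linear_ops H K = {A \<in> carrier H \<rightarrow>\<^sub>E carrier K.
     (\<forall>x\<in>carrier H. \<forall>y\<in>carrier H. A (x \<oplus>\<^bsub>H\<^esub> y) = A x \<oplus>\<^bsub>K\<^esub> A y) \<and>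
     (\<forall>c. \<forall>x\<in>carrier H. A (c \<odot>\<^bsub>H\<^esub> x) = c \<odot>\<^bsub>K\<^esub> A x)}"

definition bounded_ops :: "'v hilbert \<Rightarrow> 'w hilbert \<Rightarrow> ('v \<Rightarrow> 'w) set" where
  "bounded_ops H K =
     {A \<in> linear_ops H K. \<exists>C. \<forall>x\<in>carrier H. hnorm K (A x) \<le> C * hnorm H x}"

definition op_id :: "'v hilbert \<Rightarrow> 'v \<Rightarrow> 'v" where
  "op_id H = (\<lambda>x\<in>carrier H. x)"

definition op_zero :: "'v hilbert \<Rightarrow> 'w hilbert \<Rightarrow> 'v \<Rightarrow> 'w" where
  "op_zero H K = (\<lambda>x\<in>carrier H. \<zero>\<^bsub>K\<^esub>)"

definition op_add :: "'v hilbert \<Rightarrow> 'w hilbert \<Rightarrow> ('v \<Rightarrow> 'w) \<Rightarrow> ('v \<Rightarrow> 'w) \<Rightarrow> 'v \<Rightarrow> 'w" where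
  "op_add H K A B = (\<lambda>x\<in>carrier H. A x \<oplus>\<^bsub>K\<^esub> B x)"

definition op_diff :: "'v hilbert \<Rightarrow> 'w hilbert \<Rightarrow> ('v \<Rightarrow> 'w) \<Rightarrow> ('v \<Rightarrow> 'w) \<Rightarrow> 'v \<Rightarrow> 'w" where
  "op_diff H K A B = (\<lambda>x\<in>carrier H. A x \<ominus>\<^bsub>K\<^esub> B x)"

definition op_scale :: "'v hilbert \<Rightarrow> 'w hilbert \<Rightarrow> complex \<Rightarrow> ('v \<Rightarrow> 'w) \<Rightarrow> 'v \<Rightarrow> 'w" where
  "op_scale H K c A = (\<lambda>x\<in>carrier H. c \<odot>\<^bsub>K\<^esub> A x)"

definition op_comp :: "'u hilbert \<Rightarrow> ('v \<Rightarrow> 'w) \<Rightarrow> ('u \<Rightarrow> 'v) \<Rightarrow> 'u \<Rightarrow> 'w" where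
  "op_comp H B A = compose (carrier H) B A"

definition op_inv :: "'v hilbert \<Rightarrow> 'w hilbert \<Rightarrow> ('v \<Rightarrow> 'w) \<Rightarrow> 'w \<Rightarrow> 'v" where
  "op_inv H K A = restrict (inv_into (carrier H) A) (carrier K)"

definition toplinear_iso :: "'v hilbert \<Rightarrow> 'w hilbert \<Rightarrow> ('v \<Rightarrow> 'w) \<Rightarrow> bool" where
  "toplinear_iso H K A \<longleftrightarrow>
     A \<in> bounded_ops H K \<and> bij_betw A (carrier H) (carrier K) \<and> op_inv H K A \<in> bounded_ops K H"

definition is_adjoint :: "'v hilbert \<Rightarrow> 'w hilbert \<Rightarrow> ('v \<Rightarrow> 'w) \<Rightarrow> ('w \<Rightarrow> 'v) \<Rightarrow> bool" where
  "is_adjoint H K A B \<longleftrightarrow> A \<in> bounded_ops H K \<and> B \<in> bounded_ops K H \<and>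
     (\<forall>x\<in>carrier H. \<forall>y\<in>carrier K. cinner K (A x) y = cinner H x (B y))"

text \<open>Continuity on \<open>U\<close> of a family of bounded operators, with respect to the operator norm.\<close>

definition norm_continuous_on ::
  "'x topology \<Rightarrow> 'x set \<Rightarrow> 'v hilbert \<Rightarrow> 'w hilbert \<Rightarrow> ('x \<Rightarrow> 'v \<Rightarrow> 'w) \<Rightarrow> bool" where
  "norm_continuous_on M U H K T \<longleftrightarrow>
     (\<forall>x\<in>U. T x \<in> bounded_ops H K) \<and>
     (\<forall>x\<in>U. \<forall>e>0. \<exists>W. openin M W \<and> x \<in> W \<and>
        (\<forall>y\<in>W \<inter> U. \<forall>v\<in>carrier H. hnorm K (T y v \<ominus>\<^bsub>K\<^esub> T x v) \<le> e * hnorm H v))"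


section \<open>Hilbert space bundles\<close>

text \<open>
  A bundle is given by its fibres over the points of the base together with an atlas of local
  trivialisations \<open>(U, F, \<phi>)\<close>, where \<open>\<phi> x\<close> maps the fibre over \<open>x \<in> U\<close> onto the
  model Hilbert space \<open>F\<close>.  As usual for bundles whose fibres may have infinite dimension,
  changes of trivialisation and local representatives of morphisms are continuous in the
  operator norm.  The model space lives in the same type as the fibres; this is no loss,
  since a model space may always be replaced by a fibre.
\<close>

type_synonym ('x, 'e) chart = "'x set \<times> 'e hilbert \<times> ('x \<Rightarrow> 'e \<Rightarrow> 'e)"

record ('x, 'e) hbundle =
  base :: "'x topology"
  fibre :: "'x \<Rightarrow> 'e hilbert"
  atlas :: "('x, 'e) chart set"

definition local_rep ::
  "('x, 'e) hbundle \<Rightarrow> ('x, 'e) hbundle \<Rightarrow> ('x, 'e) chart \<Rightarrow> ('x, 'e) chart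
    \<Rightarrow> ('x \<Rightarrow> 'e \<Rightarrow> 'e) \<Rightarrow> 'x \<Rightarrow> 'e \<Rightarrow> 'e" where
  "local_rep E E' = (\<lambda>(U, F, \<phi>) (V, K, \<psi>) a x.
     \<lambda>v\<in>carrier F. \<psi> x (a x (op_inv (fibre E x) F (\<phi> x) v)))"

definition continuous_in_charts ::
  "('x, 'e) hbundle \<Rightarrow> ('x, 'e) hbundle \<Rightarrow> ('x, 'e) chart \<Rightarrow> ('x, 'e) chart
    \<Rightarrow> ('x \<Rightarrow> 'e \<Rightarrow> 'e) \<Rightarrow> bool" where
  "continuous_in_charts E E' = (\<lambda>(U, F, \<phi>) (V, K, \<psi>) a.
     norm_continuous_on (base E) (U \<inter> V) F K (local_rep E E' (U, F, \<phi>) (V, K, \<psi>) a))"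

definition bundle_id :: "('x, 'e) hbundle \<Rightarrow> 'x \<Rightarrow> 'e \<Rightarrow> 'e" where
  "bundle_id E = (\<lambda>x\<in>topspace (base E). op_id (fibre E x))"

text \<open>The maximal atlas: all local trivialisations compatible with the given atlas.\<close>

definition bundle_chart :: "('x, 'e) hbundle \<Rightarrow> ('x, 'e) chart \<Rightarrow> bool" where
  "bundle_chart E = (\<lambda>(U, F, \<phi>).
     openin (base E) U \<and> hilbert_space F \<and>
     (\<forall>x\<in>U. toplinear_iso (fibre E x) F (\<phi> x)) \<and>
     (\<forall>c\<in>atlas E. continuous_in_charts E E (U, F, \<phi>) c (bundle_id E) \<and>
                    continuous_in_charts E E c (U, F, \<phi>) (bundle_id E)))"

text \<open>The last assumption says that the inner products of the fibres form a continuous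
  Hermitian metric.\<close>

locale hilbert_bundle =
  fixes E :: "('x, 'e) hbundle"
  assumes fibre_hilbert: "x \<in> topspace (base E) \<Longrightarrow> hilbert_space (fibre E x)"
    and atlas_charts: "c \<in> atlas E \<Longrightarrow> bundle_chart E c"
    and atlas_covers: "x \<in> topspace (base E) \<Longrightarrow> \<exists>(U, F, \<phi>)\<in>atlas E. x \<in> U"
    and metric_continuous:
      "\<lbrakk>(U, F, \<phi>) \<in> atlas E; x \<in> U; e > 0\<rbrakk> \<Longrightarrow>
        \<exists>W. openin (base E) W \<and> x \<in> W \<and> (\<forall>y\<in>W \<inter> U. \<forall>u\<in>carrier F. \<forall>v\<in>carrier F.
          cmod (cinner (fibre E y) (op_inv (fibre E y) F (\<phi> y) u) (op_inv (fibre E y) F (\<phi> y) v) -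
                cinner (fibre E x) (op_inv (fibre E x) F (\<phi> x) u) (op_inv (fibre E x) F (\<phi> x) v))
            \<le> e * hnorm F u * hnorm F v)"

text \<open>Morphisms cover the identity of a common base space.\<close>

definition bundle_morphisms ::
  "('x, 'e) hbundle \<Rightarrow> ('x, 'e) hbundle \<Rightarrow> ('x \<Rightarrow> 'e \<Rightarrow> 'e) set" where
  "bundle_morphisms E E' =
     {a \<in> \<Pi>\<^sub>E x\<in>topspace (base E). bounded_ops (fibre E x) (fibre E' x).
        base E = base E' \<and> (\<forall>c\<in>atlas E. \<forall>c'\<in>atlas E'. continuous_in_charts E E' c c' a)}"

definition mor_zero :: "('x, 'e) hbundle \<Rightarrow> ('x, 'e) hbundle \<Rightarrow> 'x \<Rightarrow> 'e \<Rightarrow> 'e" where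
  "mor_zero E E' = (\<lambda>x\<in>topspace (base E). op_zero (fibre E x) (fibre E' x))"

definition mor_add :: "('x, 'e) hbundle \<Rightarrow> ('x, 'e) hbundle
    \<Rightarrow> ('x \<Rightarrow> 'e \<Rightarrow> 'e) \<Rightarrow> ('x \<Rightarrow> 'e \<Rightarrow> 'e) \<Rightarrow> 'x \<Rightarrow> 'e \<Rightarrow> 'e" where
  "mor_add E E' a b = (\<lambda>x\<in>topspace (base E). op_add (fibre E x) (fibre E' x) (a x) (b x))"

definition mor_scale :: "('x, 'e) hbundle \<Rightarrow> ('x, 'e) hbundle
    \<Rightarrow> complex \<Rightarrow> ('x \<Rightarrow> 'e \<Rightarrow> 'e) \<Rightarrow> 'x \<Rightarrow> 'e \<Rightarrow> 'e" where
  "mor_scale E E' c a = (\<lambda>x\<in>topspace (base E). op_scale (fibre E x) (fibre E' x) c (a x))"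

definition mor_comp :: "('x, 'e) hbundle
    \<Rightarrow> ('x \<Rightarrow> 'e \<Rightarrow> 'e) \<Rightarrow> ('x \<Rightarrow> 'e \<Rightarrow> 'e) \<Rightarrow> 'x \<Rightarrow> 'e \<Rightarrow> 'e" where
  "mor_comp E b a = (\<lambda>x\<in>topspace (base E). op_comp (fibre E x) (b x) (a x))"

definition bundle_iso :: "('x, 'e) hbundle \<Rightarrow> ('x, 'e) hbundle \<Rightarrow> ('x \<Rightarrow> 'e \<Rightarrow> 'e) \<Rightarrow> bool" where
  "bundle_iso E E' a \<longleftrightarrow> a \<in> bundle_morphisms E E' \<and>
     (\<exists>b\<in>bundle_morphisms E' E. mor_comp E b a = bundle_id E \<and> mor_comp E' a b = bundle_id E')"

definition fibrewise_adjoint :: "('x, 'e) hbundle \<Rightarrow> ('x, 'e) hbundle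
    \<Rightarrow> ('x \<Rightarrow> 'e \<Rightarrow> 'e) \<Rightarrow> ('x \<Rightarrow> 'e \<Rightarrow> 'e) \<Rightarrow> bool" where
  "fibrewise_adjoint E E' a b \<longleftrightarrow>
     (\<forall>x\<in>topspace (base E). is_adjoint (fibre E x) (fibre E' x) (a x) (b x))"

text \<open>
  The range of a projection \<open>p\<close>, with fibres \<open>p x (E x)\<close> and the inner products of \<open>E\<close>.  Its
  trivialisations are, as for any subbundle, the restrictions of those trivialisations
  of \<open>E\<close> which map its fibres onto a fixed closed subspace \<open>C\<close> of the model space.
\<close>

definition range_space :: "'v hilbert \<Rightarrow> ('v \<Rightarrow> 'v) \<Rightarrow> 'v hilbert" where
  "range_space H p = H\<lparr>carrier := p ` carrier H\<rparr>"

definition range_bundle :: "('x, 'e) hbundle \<Rightarrow> ('x \<Rightarrow> 'e \<Rightarrow> 'e) \<Rightarrow> ('x, 'e) hbundle" where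
  "range_bundle E p =
     \<lparr>base = base E,
      fibre = (\<lambda>x. range_space (fibre E x) (p x)),
      atlas = {(U, F\<lparr>carrier := C\<rparr>, \<lambda>x. restrict (\<phi> x) (p x ` carrier (fibre E x))) | U F \<phi> C.
        bundle_chart E (U, F, \<phi>) \<and> C \<subseteq> carrier F \<and> hilbert_space (F\<lparr>carrier := C\<rparr>) \<and>
        (\<forall>x\<in>U. \<phi> x ` (p x ` carrier (fibre E x)) = C)}\<rparr>"

definition mor_restrict :: "('x, 'e) hbundle \<Rightarrow> ('x \<Rightarrow> 'e \<Rightarrow> 'e) \<Rightarrow> 'x \<Rightarrow> 'e \<Rightarrow> 'e" where
  "mor_restrict E a = (\<lambda>x\<in>topspace (base E). restrict (a x) (carrier (fibre E x)))"


section \<open>The operator classes $L^\mu$\<close>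

locale operator_algebra =
  fixes H :: "nat \<Rightarrow> 'g \<Rightarrow> 'v hilbert"
    and G :: "('g \<times> 'g) set"
    and L :: "int \<Rightarrow> 'g \<times> 'g \<Rightarrow> ('v \<Rightarrow> 'v) set"
  assumes hilbert: "hilbert_space (H s g)"
    and inclusion: "carrier (H (Suc s) g) \<subseteq> carrier (H s g)"
    and inclusion_continuous:
      "(\<lambda>x\<in>carrier (H (Suc s) g). x) \<in> bounded_ops (H (Suc s) g) (H s g)"
    and admissible_inverse: "(g0, g1) \<in> G \<Longrightarrow> (g1, g0) \<in> G"
    and admissible_left: "(g0, g1) \<in> G \<Longrightarrow> (g0, g0) \<in> G"
    and admissible_right: "(g0, g1) \<in> G \<Longrightarrow> (g1, g1) \<in> G"
    and admissible_trans: "\<lbrakk>(g0, g1) \<in> G; (g1, g2) \<in> G\<rbrakk> \<Longrightarrow> (g0, g2) \<in> G"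
    and L_linear: "\<lbrakk>(g0, g1) \<in> G; \<mu> \<le> 0; A \<in> L \<mu> (g0, g1)\<rbrakk> \<Longrightarrow> A \<in> linear_ops (H 0 g0) (H 0 g1)"
    and L_continuous: "\<lbrakk>(g0, g1) \<in> G; \<mu> \<le> 0; A \<in> L \<mu> (g0, g1)\<rbrakk> \<Longrightarrow>
        restrict A (carrier (H s g0)) \<in> bounded_ops (H s g0) (H (nat (int s - \<mu>)) g1)"
    and L_zero: "\<lbrakk>(g0, g1) \<in> G; \<mu> \<le> 0\<rbrakk> \<Longrightarrow> op_zero (H 0 g0) (H 0 g1) \<in> L \<mu> (g0, g1)"
    and L_add: "\<lbrakk>(g0, g1) \<in> G; \<mu> \<le> 0; A \<in> L \<mu> (g0, g1); B \<in> L \<mu> (g0, g1)\<rbrakk> \<Longrightarrow>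
        op_add (H 0 g0) (H 0 g1) A B \<in> L \<mu> (g0, g1)"
    and L_scale: "\<lbrakk>(g0, g1) \<in> G; \<mu> \<le> 0; A \<in> L \<mu> (g0, g1)\<rbrakk> \<Longrightarrow>
        op_scale (H 0 g0) (H 0 g1) c A \<in> L \<mu> (g0, g1)"
    and L_mono: "\<lbrakk>(g0, g1) \<in> G; \<mu> \<le> \<nu>; \<nu> \<le> 0\<rbrakk> \<Longrightarrow> L \<mu> (g0, g1) \<subseteq> L \<nu> (g0, g1)"
    and L_comp: "\<lbrakk>(g0, g1) \<in> G; (g1, g2) \<in> G; \<mu> \<le> 0; \<nu> \<le> 0;
          B \<in> L \<mu> (g1, g2); A \<in> L \<nu> (g0, g1)\<rbrakk> \<Longrightarrow>
        op_comp (H 0 g0) B A \<in> L (\<mu> + \<nu>) (g0, g2)"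
    and L_id: "(g, g) \<in> G \<Longrightarrow> op_id (H 0 g) \<in> L 0 (g, g)"

definition smoothing :: "(int \<Rightarrow> 'd \<Rightarrow> ('v \<Rightarrow> 'v) set) \<Rightarrow> 'd \<Rightarrow> ('v \<Rightarrow> 'v) set" where
  "smoothing L g = (\<Inter>\<mu>\<in>{..0}. L \<mu> g)"

definition elliptic :: "(nat \<Rightarrow> 'g \<Rightarrow> 'v hilbert) \<Rightarrow> (int \<Rightarrow> 'g \<times> 'g \<Rightarrow> ('v \<Rightarrow> 'v) set)
    \<Rightarrow> 'g \<times> 'g \<Rightarrow> ('v \<Rightarrow> 'v) \<Rightarrow> bool" where
  "elliptic H L = (\<lambda>(g0, g1) A. A \<in> L 0 (g0, g1) \<and> (\<exists>B\<in>L 0 (g1, g0).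
     op_diff (H 0 g0) (H 0 g0) (op_comp (H 0 g0) B A) (op_id (H 0 g0)) \<in> smoothing L (g0, g0) \<and>
     op_diff (H 0 g1) (H 0 g1) (op_comp (H 0 g1) A B) (op_id (H 0 g1)) \<in> smoothing L (g1, g1)))"

definition star_closed :: "(nat \<Rightarrow> 'g \<Rightarrow> 'v hilbert) \<Rightarrow> ('g \<times> 'g) set
    \<Rightarrow> (int \<Rightarrow> 'g \<times> 'g \<Rightarrow> ('v \<Rightarrow> 'v) set) \<Rightarrow> bool" where
  "star_closed H G L \<longleftrightarrow>
     (\<forall>(g0, g1)\<in>G. \<forall>A\<in>L 0 (g0, g1). \<exists>B\<in>L 0 (g1, g0). is_adjoint (H 0 g0) (H 0 g1) A B)"

text \<open>
  The notion of a \<open>\<sigma>\<close>-algebra is applied both to $L^\star$ and to $T^\star$; in the latter case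
  a datum is a pair \<open>(g, P)\<close> of an original datum and a projection.  Hence it is stated for an
  arbitrary type of data: \<open>H0 d\<close> is the Hilbert space on which the operators act, \<open>D\<close> the set
  of admissible pairs, and \<open>ell\<close> the notion of ellipticity that belongs to the operator classes.
\<close>

locale sigma_algebra_symbol =
  fixes H0 :: "'d \<Rightarrow> 'v hilbert"
    and D :: "('d \<times> 'd) set"
    and L :: "int \<Rightarrow> 'd \<times> 'd \<Rightarrow> ('v \<Rightarrow> 'v) set"
    and ell :: "'d \<times> 'd \<Rightarrow> ('v \<Rightarrow> 'v) \<Rightarrow> bool"
    and n :: nat
    and E :: "nat \<Rightarrow> 'd \<Rightarrow> ('x, 'e) hbundle"
    and \<sigma> :: "nat \<Rightarrow> 'd \<times> 'd \<Rightarrow> ('v \<Rightarrow> 'v) \<Rightarrow> 'x \<Rightarrow> 'e \<Rightarrow> 'e"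
  assumes symbol_bundle: "\<lbrakk>(d, d) \<in> D; l \<in> {1..n}\<rbrakk> \<Longrightarrow> hilbert_bundle (E l d)"
    and symbol_morphism: "\<lbrakk>(d0, d1) \<in> D; l \<in> {1..n}; A \<in> L 0 (d0, d1)\<rbrakk> \<Longrightarrow>
        \<sigma> l (d0, d1) A \<in> bundle_morphisms (E l d0) (E l d1)"
    and symbol_add:
      "\<lbrakk>(d0, d1) \<in> D; l \<in> {1..n}; A \<in> L 0 (d0, d1); B \<in> L 0 (d0, d1)\<rbrakk> \<Longrightarrow>
        \<sigma> l (d0, d1) (op_add (H0 d0) (H0 d1) A B) =
          mor_add (E l d0) (E l d1) (\<sigma> l (d0, d1) A) (\<sigma> l (d0, d1) B)"
    and symbol_scale:
      "\<lbrakk>(d0, d1) \<in> D; l \<in> {1..n}; A \<in> L 0 (d0, d1)\<rbrakk> \<Longrightarrow>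
        \<sigma> l (d0, d1) (op_scale (H0 d0) (H0 d1) c A) =
          mor_scale (E l d0) (E l d1) c (\<sigma> l (d0, d1) A)"
    and symbol_comp:
      "\<lbrakk>(d0, d1) \<in> D; (d1, d2) \<in> D; l \<in> {1..n}; A \<in> L 0 (d0, d1); B \<in> L 0 (d1, d2)\<rbrakk> \<Longrightarrow>
        \<sigma> l (d0, d2) (op_comp (H0 d0) B A) =
          mor_comp (E l d0) (\<sigma> l (d1, d2) B) (\<sigma> l (d0, d1) A)"
    and symbol_smoothing:
      "\<lbrakk>(d0, d1) \<in> D; l \<in> {1..n}; R \<in> smoothing L (d0, d1)\<rbrakk> \<Longrightarrow>
        \<sigma> l (d0, d1) R = mor_zero (E l d0) (E l d1)"
    and symbol_elliptic:
      "\<lbrakk>(d0, d1) \<in> D; A \<in> L 0 (d0, d1)\<rbrakk> \<Longrightarrow>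
        ell (d0, d1) A \<longleftrightarrow> (\<forall>l\<in>{1..n}. bundle_iso (E l d0) (E l d1) (\<sigma> l (d0, d1) A))"

locale star_closed_sigma_algebra =
  operator_algebra H G L +
  sigma_algebra_symbol "H 0" G L "elliptic H L" n E \<sigma>
  for H :: "nat \<Rightarrow> 'g \<Rightarrow> 'v hilbert"
    and G :: "('g \<times> 'g) set"
    and L :: "int \<Rightarrow> 'g \<times> 'g \<Rightarrow> ('v \<Rightarrow> 'v) set"
    and n :: nat
    and E :: "nat \<Rightarrow> 'g \<Rightarrow> ('x, 'e) hbundle"
    and \<sigma> :: "nat \<Rightarrow> 'g \<times> 'g \<Rightarrow> ('v \<Rightarrow> 'v) \<Rightarrow> 'x \<Rightarrow> 'e \<Rightarrow> 'e" +
  assumes star_closed: "star_closed H G L"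
    and symbol_adjoint:
      "\<lbrakk>(g0, g1) \<in> G; l \<in> {1..n}; A \<in> L 0 (g0, g1); B \<in> L 0 (g1, g0);
          is_adjoint (H 0 g0) (H 0 g1) A B\<rbrakk> \<Longrightarrow>
        fibrewise_adjoint (E l g0) (E l g1) (\<sigma> l (g0, g1) A) (\<sigma> l (g1, g0) B)"


section \<open>Toeplitz subalgebras\<close>

definition projections :: "(nat \<Rightarrow> 'g \<Rightarrow> 'v hilbert)
    \<Rightarrow> (int \<Rightarrow> 'g \<times> 'g \<Rightarrow> ('v \<Rightarrow> 'v) set) \<Rightarrow> 'g \<Rightarrow> ('v \<Rightarrow> 'v) set" where
  "projections H L g = {P \<in> L 0 (g, g). op_comp (H 0 g) P P = P}"

definition toeplitz :: "(nat \<Rightarrow> 'g \<Rightarrow> 'v hilbert) \<Rightarrow> (int \<Rightarrow> 'g \<times> 'g \<Rightarrow> ('v \<Rightarrow> 'v) set)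
    \<Rightarrow> int \<Rightarrow> 'g \<times> 'g \<Rightarrow> ('v \<Rightarrow> 'v) \<Rightarrow> ('v \<Rightarrow> 'v) \<Rightarrow> ('v \<Rightarrow> 'v) set" where
  "toeplitz H L \<mu> = (\<lambda>(g0, g1) P0 P1. {A \<in> L \<mu> (g0, g1).
     op_comp (H 0 g0) (op_diff (H 0 g1) (H 0 g1) (op_id (H 0 g1)) P1) A
       = op_zero (H 0 g0) (H 0 g1) \<and>
     op_comp (H 0 g0) A (op_diff (H 0 g0) (H 0 g0) (op_id (H 0 g0)) P0)
       = op_zero (H 0 g0) (H 0 g1)})"

definition toeplitz_smoothing :: "(nat \<Rightarrow> 'g \<Rightarrow> 'v hilbert)
    \<Rightarrow> (int \<Rightarrow> 'g \<times> 'g \<Rightarrow> ('v \<Rightarrow> 'v) set)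
    \<Rightarrow> 'g \<times> 'g \<Rightarrow> ('v \<Rightarrow> 'v) \<Rightarrow> ('v \<Rightarrow> 'v) \<Rightarrow> ('v \<Rightarrow> 'v) set" where
  "toeplitz_smoothing H L g P0 P1 = (\<Inter>\<mu>\<in>{..0}. toeplitz H L \<mu> g P0 P1)"

definition toeplitz_elliptic :: "(nat \<Rightarrow> 'g \<Rightarrow> 'v hilbert)
    \<Rightarrow> (int \<Rightarrow> 'g \<times> 'g \<Rightarrow> ('v \<Rightarrow> 'v) set)
    \<Rightarrow> 'g \<times> 'g \<Rightarrow> ('v \<Rightarrow> 'v) \<Rightarrow> ('v \<Rightarrow> 'v) \<Rightarrow> ('v \<Rightarrow> 'v) \<Rightarrow> bool" where
  "toeplitz_elliptic H L = (\<lambda>(g0, g1) P0 P1 A. A \<in> toeplitz H L 0 (g0, g1) P0 P1 \<and>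
     (\<exists>B\<in>toeplitz H L 0 (g1, g0) P1 P0.
        op_diff (H 0 g0) (H 0 g0) (op_comp (H 0 g0) B A) P0
          \<in> toeplitz_smoothing H L (g0, g0) P0 P0 \<and>
        op_diff (H 0 g1) (H 0 g1) (op_comp (H 0 g1) A B) P1
          \<in> toeplitz_smoothing H L (g1, g1) P1 P1))"

definition toeplitz_bundle :: "(nat \<Rightarrow> 'g \<Rightarrow> ('x, 'e) hbundle)
    \<Rightarrow> (nat \<Rightarrow> 'g \<times> 'g \<Rightarrow> ('v \<Rightarrow> 'v) \<Rightarrow> 'x \<Rightarrow> 'e \<Rightarrow> 'e)
    \<Rightarrow> nat \<Rightarrow> 'g \<Rightarrow> ('v \<Rightarrow> 'v) \<Rightarrow> ('x, 'e) hbundle" where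
  "toeplitz_bundle E \<sigma> l g P = range_bundle (E l g) (\<sigma> l (g, g) P)"

text \<open>The codomain of the restricted morphism enters only through \<^const>\<open>bundle_morphisms\<close>,
  whence \<open>P1\<close> is not an argument.\<close>

definition toeplitz_symbol :: "(nat \<Rightarrow> 'g \<Rightarrow> ('x, 'e) hbundle)
    \<Rightarrow> (nat \<Rightarrow> 'g \<times> 'g \<Rightarrow> ('v \<Rightarrow> 'v) \<Rightarrow> 'x \<Rightarrow> 'e \<Rightarrow> 'e)
    \<Rightarrow> nat \<Rightarrow> 'g \<times> 'g \<Rightarrow> ('v \<Rightarrow> 'v) \<Rightarrow> ('v \<Rightarrow> 'v) \<Rightarrow> 'x \<Rightarrow> 'e \<Rightarrow> 'e" where
  "toeplitz_symbol E \<sigma> l g P0 A =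
     mor_restrict (toeplitz_bundle E \<sigma> l (fst g) P0) (\<sigma> l g A)"

text \<open>$T^\star$ in the form required by \<^locale>\<open>sigma_algebra_symbol\<close>, with data \<open>(g, P)\<close>.\<close>

definition toeplitz_pairs :: "(nat \<Rightarrow> 'g \<Rightarrow> 'v hilbert) \<Rightarrow> ('g \<times> 'g) set
    \<Rightarrow> (int \<Rightarrow> 'g \<times> 'g \<Rightarrow> ('v \<Rightarrow> 'v) set)
    \<Rightarrow> (('g \<times> ('v \<Rightarrow> 'v)) \<times> ('g \<times> ('v \<Rightarrow> 'v))) set" where
  "toeplitz_pairs H G L = {((g0, P0), (g1, P1)) | g0 P0 g1 P1.
     (g0, g1) \<in> G \<and> P0 \<in> projections H L g0 \<and> P1 \<in> projections H L g1}"

definition toeplitz_sigma_algebra :: "(nat \<Rightarrow> 'g \<Rightarrow> 'v hilbert) \<Rightarrow> ('g \<times> 'g) set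
    \<Rightarrow> (int \<Rightarrow> 'g \<times> 'g \<Rightarrow> ('v \<Rightarrow> 'v) set) \<Rightarrow> nat \<Rightarrow> (nat \<Rightarrow> 'g \<Rightarrow> ('x, 'e) hbundle)
    \<Rightarrow> (nat \<Rightarrow> 'g \<times> 'g \<Rightarrow> ('v \<Rightarrow> 'v) \<Rightarrow> 'x \<Rightarrow> 'e \<Rightarrow> 'e) \<Rightarrow> bool" where
  "toeplitz_sigma_algebra H G L n E \<sigma> \<longleftrightarrow>
     sigma_algebra_symbol (\<lambda>(g, P). H 0 g) (toeplitz_pairs H G L)
       (\<lambda>\<mu> ((g0, P0), (g1, P1)). toeplitz H L \<mu> (g0, g1) P0 P1)
       (\<lambda>((g0, P0), (g1, P1)). toeplitz_elliptic H L (g0, g1) P0 P1)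
       n
       (\<lambda>l (g, P). toeplitz_bundle E \<sigma> l g P)
       (\<lambda>l ((g0, P0), (g1, P1)). toeplitz_symbol E \<sigma> l (g0, g1) P0)"

end

theory Submission
  imports Defs
begin

text \<open>
  Suppose the restricted symbol of \<open>A\<close> is invertible.  Write \<open>a = \<sigma>(A)\<close> and \<open>p\<^sub>j = \<sigma>(P\<^sub>j)\<close>.  Since \<open>a\<close>
  is bounded below on the range of \<open>p\<^sub>0\<close>, the symbol of
  \<open>D = A\<^sup>*A + (1 - P\<^sub>0)\<^sup>*(1 - P\<^sub>0)\<close> is positive definite, so \<open>D\<close> is elliptic in \<open>L\<^sup>\<star>\<close>.  If \<open>D'\<close> is a parametrix
  of \<open>D\<close>, then \<open>D P\<^sub>0 = A\<^sup>*A\<close> shows that \<open>P\<^sub>0 D' A\<^sup>* P\<^sub>1\<close> is a left parametrix of \<open>A\<close> in \<open>T\<^sup>\<star>\<close>.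
  In the same way \<open>A A\<^sup>* + (1 - P\<^sub>1)(1 - P\<^sub>1)\<^sup>*\<close> gives a right parametrix.  No adjoints of smoothing
  operators are taken, because these need not be smoothing.

  That \<open>p\<^sub>j(E)\<close> is a subbundle follows by perturbation: if \<open>q\<close> is a norm-continuous family of
  projections, then \<open>1 - q\<^sub>x + q\<^bsub>x\<^sub>0\<^esub> q\<^sub>x\<close> is close to the identity for \<open>x\<close> near \<open>x\<^sub>0\<close>, and it maps the range of
  \<open>q\<^sub>x\<close> onto that of \<open>q\<^bsub>x\<^sub>0\<^esub>\<close>.
\<close>

section \<open>Hilbert spaces\<close>

text \<open>The projections may be oblique. The adjoint of \<open>A\<close> is therefore a Toeplitz
  operator for the adjoint projections, not for \<open>P1\<close> and \<open>P0\<close>. This is why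
  parametrices are cut off by \<open>P0\<close> and \<open>P1\<close>, and why the estimate behind
  the right parametrix compares the adjoint symbol of \<open>A\<close> with the adjoint symbol of
  \<open>P1\<close>. That estimate is dual to surjectivity of the symbol onto the range of
  \<open>P1\<close>, while the one on the left expresses injectivity. The summand built from
  \<open>1 - P0\<close> controls exactly the directions that \<open>A\<close> kills, and composition
  with \<open>P0\<close> erases it again. Invertibility of a symbol is a fibrewise matter, because
  inversion preserves norm continuity; so every constant in the estimates may depend on the base
  point. Positive definiteness yields invertibility through Banach's fixed point theorem after
  rescaling. Charts that straighten a projection belong to the maximal atlas and need not lie in the
  given atlas. Continuity of morphisms and of the metric must therefore first be carried over from
  the atlas to all bundle charts.\<close>

context hilbert_space
begin

lemma carrier_closed:
  "\<zero> \<in> carrier H"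
  "x \<in> carrier H \<Longrightarrow> y \<in> carrier H \<Longrightarrow> x \<oplus> y \<in> carrier H"
  "x \<in> carrier H \<Longrightarrow> y \<in> carrier H \<Longrightarrow> x \<ominus> y \<in> carrier H"
  by simp_all

lemma diff_add_cancel: "x \<in> carrier H \<Longrightarrow> y \<in> carrier H \<Longrightarrow> x \<ominus> y \<oplus> y = x"
  by (simp add: a_minus_def M.a_assoc M.l_neg)

text \<open>The scalar ring has all complex numbers as its carrier, so the membership conditions on
  scalars in the module laws are discharged here once and for all.\<close>

lemma scale_closed: "x \<in> carrier H \<Longrightarrow> c \<odot> x \<in> carrier H"
  by (simp add: ring_of_type_algebra_def)

lemma scale_add_right:
  "x \<in> carrier H \<Longrightarrow> y \<in> carrier H \<Longrightarrow> c \<odot> (x \<oplus> y) = c \<odot> x \<oplus> c \<odot> y"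
  using smult_r_distr[of c x y] by (simp add: ring_of_type_algebra_def)

lemma cinner_add_right:
  assumes "x \<in> carrier H" "y \<in> carrier H" "z \<in> carrier H"
  shows "cinner H x (y \<oplus> z) = cinner H x y + cinner H x z"
  using assms cinner_commute[of x "y \<oplus> z"] cinner_commute[of x y] cinner_commute[of x z]
  by (simp add: cinner_add_left)

lemma cinner_scale_right:
  assumes "x \<in> carrier H" "y \<in> carrier H"
  shows "cinner H x (c \<odot> y) = cnj c * cinner H x y"
  using assms cinner_commute[of x "c \<odot> y"] cinner_commute[of x y]
  by (simp add: cinner_scale_left scale_closed)

lemma cinner_zero_left: "x \<in> carrier H \<Longrightarrow> cinner H \<zero> x = 0"
  using cinner_add_left[of \<zero> \<zero> x] by simp

lemma cinner_zero_right: "x \<in> carrier H \<Longrightarrow> cinner H x \<zero> = 0"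
  using cinner_add_right[of x \<zero> \<zero>] by simp

lemma cinner_diff_left:
  assumes "x \<in> carrier H" "y \<in> carrier H" "z \<in> carrier H"
  shows "cinner H (x \<ominus> y) z = cinner H x z - cinner H y z"
proof -
  have "cinner H (x \<ominus> y \<oplus> y) z = cinner H (x \<ominus> y) z + cinner H y z"
    using assms by (simp add: cinner_add_left)
  moreover have "x \<ominus> y \<oplus> y = x" using assms by (simp add: diff_add_cancel)
  ultimately show ?thesis by simp
qed

lemma cinner_diff_right:
  assumes "x \<in> carrier H" "y \<in> carrier H" "z \<in> carrier H"
  shows "cinner H x (y \<ominus> z) = cinner H x y - cinner H x z"
  using assms cinner_commute[of x "y \<ominus> z"] cinner_commute[of x y] cinner_commute[of x z]
  by (simp add: cinner_diff_left)

lemma cinner_self: "x \<in> carrier H \<Longrightarrow> cinner H x x = complex_of_real ((hnorm H x)\<^sup>2)"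
  using cinner_commute[of x x] cinner_ge_zero[of x]
  by (simp add: hnorm_def complex_eq_iff)

lemma diff_self: "x \<in> carrier H \<Longrightarrow> x \<ominus> x = \<zero>"
  by (simp add: a_minus_def M.r_neg)

lemma diff_eq_zero: "x \<in> carrier H \<Longrightarrow> y \<in> carrier H \<Longrightarrow> x \<ominus> y = \<zero> \<longleftrightarrow> x = y"
  using diff_add_cancel[of x y] diff_self by auto

text \<open>Linear identities are proved by pairing both sides with an arbitrary vector.\<close>

lemma eq_by_cinner:
  assumes "x \<in> carrier H" "y \<in> carrier H"
    and "\<And>z. z \<in> carrier H \<Longrightarrow> cinner H x z = cinner H y z"
  shows "x = y"
proof -
  have "cinner H (x \<ominus> y) (x \<ominus> y) = 0"
    using assms by (simp add: cinner_diff_left)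
  then have "x \<ominus> y = \<zero>" using assms cinner_eq_zero by simp
  then show ?thesis using assms diff_eq_zero by simp
qed

lemma hnorm_ge_zero: "x \<in> carrier H \<Longrightarrow> 0 \<le> hnorm H x"
  using cinner_ge_zero by (simp add: hnorm_def)

lemma hnorm_eq_zero: "x \<in> carrier H \<Longrightarrow> hnorm H x = 0 \<Longrightarrow> x = \<zero>"
  using cinner_self[of x] cinner_eq_zero by simp

lemma hnorm_zero: "hnorm H \<zero> = 0"
  using cinner_zero_left[of \<zero>] by (simp add: hnorm_def)

lemma Cauchy_Schwarz:
  assumes x: "x \<in> carrier H" and y: "y \<in> carrier H"
  shows "cmod (cinner H x y) \<le> hnorm H x * hnorm H y"
proof (cases "hnorm H y = 0")
  case True
  then show ?thesis using hnorm_eq_zero[OF y] cinner_zero_right[OF x] by simp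
next
  case False
  then have pos: "hnorm H y > 0" using hnorm_ge_zero[OF y] by simp
  define b where "b = hnorm H y"
  define s where "s = cinner H x y"
  \<comment> \<open>\<open>z\<close> is \<open>b\<^sup>2\<close> times the component of
    \<open>x\<close> orthogonal to \<open>y\<close>; scaling by \<open>b\<^sup>2\<close> avoids a
    division. The inequality is \<open>0 \<le> Re (cinner H z z)\<close>.\<close>
  define z where "z = complex_of_real (b\<^sup>2) \<odot> x \<ominus> s \<odot> y"
  have yx: "cinner H y x = cnj s" using cinner_commute[OF y x] s_def by simp
  have yy: "cinner H y y = complex_of_real (b\<^sup>2)" and xx: "cinner H x x = complex_of_real ((hnorm H x)\<^sup>2)"
    using x y cinner_self b_def by auto
  have "cinner H z z = complex_of_real (b\<^sup>2) * (complex_of_real (b\<^sup>2 * (hnorm H x)\<^sup>2) - s * cnj s)"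
    using x y unfolding z_def
    by (simp add: cinner_diff_left cinner_diff_right cinner_scale_left cinner_scale_right
        scale_closed xx yy yx s_def[symmetric] algebra_simps power2_eq_square)
  also have "\<dots> = complex_of_real (b\<^sup>2 * ((hnorm H x * b)\<^sup>2 - (cmod s)\<^sup>2))"
    by (simp add: complex_norm_square[symmetric] power_mult_distrib mult.commute)
  finally have "Re (cinner H z z) = b\<^sup>2 * ((hnorm H x * b)\<^sup>2 - (cmod s)\<^sup>2)" by simp
  moreover have "0 \<le> Re (cinner H z z)"
    using x y cinner_ge_zero[of z] unfolding z_def by (simp add: scale_closed)
  ultimately have "(cmod s)\<^sup>2 \<le> (hnorm H x * b)\<^sup>2"
    using pos b_def by (simp add: zero_le_mult_iff)
  then show ?thesis
    using power2_le_imp_le hnorm_ge_zero[OF x] pos unfolding s_def b_def by simp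
qed

lemma hnorm_triangle:
  assumes x: "x \<in> carrier H" and y: "y \<in> carrier H"
  shows "hnorm H (x \<oplus> y) \<le> hnorm H x + hnorm H y"
proof -
  have "complex_of_real ((hnorm H (x \<oplus> y))\<^sup>2) = cinner H x x + cinner H x y + (cinner H y x + cinner H y y)"
    using x y cinner_self[of "x \<oplus> y"] by (simp add: cinner_add_left cinner_add_right add_ac)
  then have "(hnorm H (x \<oplus> y))\<^sup>2 = Re (cinner H x x + cinner H x y + (cinner H y x + cinner H y y))"
    by (metis Re_complex_of_real)
  also have "\<dots> \<le> (hnorm H x)\<^sup>2 + (hnorm H y)\<^sup>2 + 2 * (hnorm H x * hnorm H y)"
    using Cauchy_Schwarz[OF x y] Cauchy_Schwarz[OF y x] complex_Re_le_cmod[of "cinner H x y"]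
      complex_Re_le_cmod[of "cinner H y x"] x y by (simp add: cinner_self mult.commute)
  also have "\<dots> = (hnorm H x + hnorm H y)\<^sup>2" by (simp add: power2_eq_square algebra_simps)
  finally show ?thesis using power2_le_imp_le hnorm_ge_zero x y by simp
qed

lemma hnorm_minus_commute:
  assumes x: "x \<in> carrier H" and y: "y \<in> carrier H"
  shows "hnorm H (x \<ominus> y) = hnorm H (y \<ominus> x)"
  unfolding hnorm_def using x y by (simp add: cinner_diff_left cinner_diff_right)

lemma hnorm_triangle_diff:
  assumes "x \<in> carrier H" "y \<in> carrier H" "z \<in> carrier H"
  shows "hnorm H (x \<ominus> z) \<le> hnorm H (x \<ominus> y) + hnorm H (y \<ominus> z)"
proof -
  have "x \<ominus> z = (x \<ominus> y) \<oplus> (y \<ominus> z)"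
    using assms by (intro eq_by_cinner) (simp_all add: cinner_diff_left cinner_add_left)
  then show ?thesis using hnorm_triangle[of "x \<ominus> y" "y \<ominus> z"] assms by simp
qed

lemma diff_zero: "x \<in> carrier H \<Longrightarrow> x \<ominus> \<zero> = x"
  by (intro eq_by_cinner) (simp_all add: cinner_diff_left cinner_zero_left)

lemma hnorm_diff_le:
  assumes "x \<in> carrier H" "y \<in> carrier H"
  shows "hnorm H (x \<ominus> y) \<le> hnorm H x + hnorm H y"
  using hnorm_triangle_diff[of x \<zero> y] hnorm_minus_commute[of \<zero> y] diff_zero assms by simp

lemma hnorm_le_diff:
  assumes "x \<in> carrier H" "y \<in> carrier H"
  shows "hnorm H x \<le> hnorm H (x \<ominus> y) + hnorm H y"
  using hnorm_triangle_diff[of x y \<zero>] diff_zero assms by simp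

lemma metric: "Metric_space (carrier H) (hdist H)"
proof
  show "0 \<le> hdist H x y" for x y by (simp add: hdist_def hnorm_ge_zero)
  show "hdist H x y = hdist H y x" for x y by (simp add: hdist_def hnorm_minus_commute)
  show "hdist H x y = 0 \<longleftrightarrow> x = y" if "x \<in> carrier H" "y \<in> carrier H" for x y
    using that hnorm_eq_zero[of "x \<ominus> y"] hnorm_zero diff_eq_zero[of x y]
    by (auto simp: hdist_def)
  show "hdist H x z \<le> hdist H x y + hdist H y z"
    if "x \<in> carrier H" "y \<in> carrier H" "z \<in> carrier H" for x y z
    using that hnorm_triangle_diff by (simp add: hdist_def)
qed

text \<open>Linear operators, the classes \<open>L\<close> and the symbol maps are specified on sums
  and scalar multiples; this reduces differences to those two operations.\<close>

lemma uminus_scale: "x \<in> carrier H \<Longrightarrow> y \<in> carrier H \<Longrightarrow> x \<ominus> y = x \<oplus> (- 1) \<odot> y"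
  by (intro eq_by_cinner)
    (simp_all add: cinner_diff_left cinner_add_left cinner_scale_left scale_closed)

end

section \<open>Bounded operators\<close>

lemmas hilbert_closed = hilbert_space.carrier_closed hilbert_space.scale_closed

lemmas cinner_linear =
  hilbert_space.cinner_add_left hilbert_space.cinner_add_right
  hilbert_space.cinner_diff_left hilbert_space.cinner_diff_right
  hilbert_space.cinner_scale_left hilbert_space.cinner_scale_right
  hilbert_space.cinner_zero_left hilbert_space.cinner_zero_right

lemma linear_opsD:
  assumes "A \<in> linear_ops H K"
  shows linear_ops_closed: "x \<in> carrier H \<Longrightarrow> A x \<in> carrier K"
    and linear_ops_add: "x \<in> carrier H \<Longrightarrow> y \<in> carrier H \<Longrightarrow>
      A (x \<oplus>\<^bsub>H\<^esub> y) = A x \<oplus>\<^bsub>K\<^esub> A y"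
    and linear_ops_scale: "x \<in> carrier H \<Longrightarrow> A (c \<odot>\<^bsub>H\<^esub> x) = c \<odot>\<^bsub>K\<^esub> A x"
    and linear_ops_extensional: "A \<in> extensional (carrier H)"
  using assms by (auto simp: linear_ops_def PiE_def)

lemma linear_opsI:
  assumes "\<And>x. x \<in> carrier H \<Longrightarrow> A x \<in> carrier K"
    and "\<And>x y. x \<in> carrier H \<Longrightarrow> y \<in> carrier H \<Longrightarrow> A (x \<oplus>\<^bsub>H\<^esub> y) = A x \<oplus>\<^bsub>K\<^esub> A y"
    and "\<And>c x. x \<in> carrier H \<Longrightarrow> A (c \<odot>\<^bsub>H\<^esub> x) = c \<odot>\<^bsub>K\<^esub> A x"
    and "A \<in> extensional (carrier H)"
  shows "A \<in> linear_ops H K"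
  using assms by (auto simp: linear_ops_def PiE_def)

lemma linear_ops_eqI:
  assumes "A \<in> linear_ops H K" "B \<in> linear_ops H K'" "\<And>x. x \<in> carrier H \<Longrightarrow> A x = B x"
  shows "A = B"
  using extensionalityI[OF linear_ops_extensional[OF assms(1)] linear_ops_extensional[OF assms(2)]]
    assms(3) by blast

lemma linear_ops_diff:
  assumes "hilbert_space H" "hilbert_space K" "A \<in> linear_ops H K" "x \<in> carrier H" "y \<in> carrier H"
  shows "A (x \<ominus>\<^bsub>H\<^esub> y) = A x \<ominus>\<^bsub>K\<^esub> A y"
  using assms linear_ops_closed[OF assms(3)]
  by (simp add: hilbert_space.uminus_scale linear_ops_add[OF assms(3)] linear_ops_scale[OF assms(3)] hilbert_closed)

lemma linear_ops_zero:
  assumes "hilbert_space H" "hilbert_space K" "A \<in> linear_ops H K"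
  shows "A \<zero>\<^bsub>H\<^esub> = \<zero>\<^bsub>K\<^esub>"
  using linear_ops_diff[OF assms, of "\<zero>\<^bsub>H\<^esub>" "\<zero>\<^bsub>H\<^esub>"] assms linear_ops_closed[OF assms(3)]
  by (simp add: hilbert_space.diff_self hilbert_closed)

lemma bounded_ops_linear: "A \<in> bounded_ops H K \<Longrightarrow> A \<in> linear_ops H K"
  by (simp add: bounded_ops_def)

lemma bounded_opsI:
  "A \<in> linear_ops H K \<Longrightarrow> (\<And>x. x \<in> carrier H \<Longrightarrow> hnorm K (A x) \<le> C * hnorm H x) \<Longrightarrow>
    A \<in> bounded_ops H K"
  by (auto simp: bounded_ops_def)

lemma bounded_opsE:
  assumes "hilbert_space H" "A \<in> bounded_ops H K"
  obtains C where "C > 0" "\<And>x. x \<in> carrier H \<Longrightarrow> hnorm K (A x) \<le> C * hnorm H x"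
proof -
  obtain C where C: "\<And>x. x \<in> carrier H \<Longrightarrow> hnorm K (A x) \<le> C * hnorm H x"
    using assms(2) by (auto simp: bounded_ops_def)
  \<comment> \<open>A bound in \<open>bounded_ops\<close> may be any real number, even a negative
    one on the zero space. The maximum with \<open>1\<close> makes it positive, so that later steps
    can divide by it.\<close>
  show thesis
  proof (rule that[of "max C 1"])
    fix x assume x: "x \<in> carrier H"
    have "C * hnorm H x \<le> max C 1 * hnorm H x"
      using hilbert_space.hnorm_ge_zero[OF assms(1) x] by (intro mult_right_mono) auto
    then show "hnorm K (A x) \<le> max C 1 * hnorm H x" using C[OF x] by linarith
  qed simp
qed

section \<open>Pointwise values, compositions and differences of operators\<close>

lemma op_id_apply: "x \<in> carrier H \<Longrightarrow> op_id H x = x"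
  by (simp add: op_id_def)

lemma op_diff_apply: "x \<in> carrier H \<Longrightarrow> op_diff H K A B x = A x \<ominus>\<^bsub>K\<^esub> B x"
  by (simp add: op_diff_def)

lemma op_add_apply: "x \<in> carrier H \<Longrightarrow> op_add H K A B x = A x \<oplus>\<^bsub>K\<^esub> B x"
  by (simp add: op_add_def)

lemma op_comp_apply: "x \<in> carrier H \<Longrightarrow> op_comp H B A x = B (A x)"
  by (simp add: op_comp_def compose_def)

lemma op_zero_apply: "x \<in> carrier H \<Longrightarrow> op_zero H K x = \<zero>\<^bsub>K\<^esub>"
  by (simp add: op_zero_def)

lemma op_scale_apply: "x \<in> carrier H \<Longrightarrow> op_scale H K c A x = c \<odot>\<^bsub>K\<^esub> A x"
  by (simp add: op_scale_def)

lemmas op_apply = op_id_apply op_diff_apply op_add_apply op_comp_apply op_zero_apply op_scale_apply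

lemma op_id_bounded: "hilbert_space H \<Longrightarrow> op_id H \<in> bounded_ops H H"
  by (intro bounded_opsI[where C=1] linear_opsI) (auto simp: op_id_def hilbert_closed)

lemma op_comp_linear:
  assumes "A \<in> linear_ops H K" "B \<in> linear_ops K J" "hilbert_space H"
  shows "op_comp H B A \<in> linear_ops H J"
  by (rule linear_opsI)
    (use assms in \<open>simp_all add: op_comp_def compose_def hilbert_closed
      linear_opsD[OF assms(1)] linear_opsD[OF assms(2)]\<close>)

lemma op_comp_bounded:
  assumes "A \<in> bounded_ops H K" "B \<in> bounded_ops K J" "hilbert_space H" "hilbert_space K"
  shows "op_comp H B A \<in> bounded_ops H J"
proof -
  obtain a where a: "a > 0" "\<And>x. x \<in> carrier H \<Longrightarrow> hnorm K (A x) \<le> a * hnorm H x"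
    using bounded_opsE assms by blast
  obtain b where b: "b > 0" "\<And>x. x \<in> carrier K \<Longrightarrow> hnorm J (B x) \<le> b * hnorm K x"
    using bounded_opsE assms by blast
  show ?thesis
  proof (rule bounded_opsI[where C="b * a"])
    show "op_comp H B A \<in> linear_ops H J"
      by (rule op_comp_linear[OF bounded_ops_linear[OF assms(1)] bounded_ops_linear[OF assms(2)] assms(3)])
    fix x assume x: "x \<in> carrier H"
    then have "hnorm J (B (A x)) \<le> b * hnorm K (A x)"
      using b(2) linear_ops_closed[OF bounded_ops_linear[OF assms(1)]] by blast
    also have "\<dots> \<le> b * (a * hnorm H x)" using a(2)[OF x] b(1) by simp
    finally show "hnorm J (op_comp H B A x) \<le> b * a * hnorm H x" using x by (simp add: op_apply)
  qed
qed

lemma op_diff_linear: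
  assumes "A \<in> linear_ops H K" "B \<in> linear_ops H K" "hilbert_space H" "hilbert_space K"
  shows "op_diff H K A B \<in> linear_ops H K"
proof (rule linear_opsI)
  note [simp] = op_apply hilbert_closed linear_opsD[OF assms(1)] linear_opsD[OF assms(2)] cinner_linear
  show "op_diff H K A B x \<in> carrier K" if "x \<in> carrier H" for x
    using assms that by simp
  show "op_diff H K A B (x \<oplus>\<^bsub>H\<^esub> y) = op_diff H K A B x \<oplus>\<^bsub>K\<^esub> op_diff H K A B y"
    if "x \<in> carrier H" "y \<in> carrier H" for x y
    using assms that by (intro hilbert_space.eq_by_cinner[of K]) simp_all
  show "op_diff H K A B (c \<odot>\<^bsub>H\<^esub> x) = c \<odot>\<^bsub>K\<^esub> op_diff H K A B x"
    if "x \<in> carrier H" for x c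
    using assms that by (intro hilbert_space.eq_by_cinner[of K]) (simp_all add: algebra_simps)
qed (simp add: op_diff_def)

lemma op_diff_bounded:
  assumes A: "A \<in> bounded_ops H K" and B: "B \<in> bounded_ops H K"
    and H: "hilbert_space H" and K: "hilbert_space K"
  shows "op_diff H K A B \<in> bounded_ops H K"
proof -
  obtain a where a: "\<And>x. x \<in> carrier H \<Longrightarrow> hnorm K (A x) \<le> a * hnorm H x"
    using bounded_opsE[OF H A] by blast
  obtain b where b: "\<And>x. x \<in> carrier H \<Longrightarrow> hnorm K (B x) \<le> b * hnorm H x"
    using bounded_opsE[OF H B] by blast
  show ?thesis
  proof (rule bounded_opsI[where C="a + b"])
    show "op_diff H K A B \<in> linear_ops H K"
      by (rule op_diff_linear[OF bounded_ops_linear[OF A] bounded_ops_linear[OF B] H K])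
    fix x assume x: "x \<in> carrier H"
    then have "hnorm K (A x \<ominus>\<^bsub>K\<^esub> B x) \<le> hnorm K (A x) + hnorm K (B x)"
      using linear_ops_closed[OF bounded_ops_linear[OF A]] linear_ops_closed[OF bounded_ops_linear[OF B]]
      by (intro hilbert_space.hnorm_diff_le[OF K])
    then show "hnorm K (op_diff H K A B x) \<le> (a + b) * hnorm H x"
      using a[OF x] b[OF x] x by (simp add: op_apply algebra_simps)
  qed
qed

text \<open>A fixed point of \<open>x \<mapsto> (x - T x) + y\<close> is exactly a solution of
  \<open>T x = y\<close>, and this map contracts by the factor \<open>k\<close> because
  \<open>T\<close> is linear. Completeness of \<open>H\<close> enters through Banach's fixed point
  theorem.\<close>

lemma contraction_surj:
  assumes H: "hilbert_space H" and T: "T \<in> linear_ops H H" and k: "k < 1"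
    and near: "\<And>x. x \<in> carrier H \<Longrightarrow> hnorm H (x \<ominus>\<^bsub>H\<^esub> T x) \<le> k * hnorm H x"
    and y: "y \<in> carrier H"
  obtains x where "x \<in> carrier H" "T x = y"
proof -
  interpret hilbert_space H by fact
  note Tc = linear_ops_closed[OF T]
  let ?f = "\<lambda>x. (x \<ominus>\<^bsub>H\<^esub> T x) \<oplus>\<^bsub>H\<^esub> y"
  obtain x where x: "x \<in> carrier H" "?f x = x"
  proof (rule Metric_space.Banach_fixedpoint_thm[OF metric complete, of ?f k])
    show "carrier H \<noteq> {}" using zero_closed by blast
    show "?f \<in> carrier H \<rightarrow> carrier H" using y Tc by auto
    fix u v assume u: "u \<in> carrier H" and v: "v \<in> carrier H"
    have "?f u \<ominus>\<^bsub>H\<^esub> ?f v = (u \<ominus>\<^bsub>H\<^esub> v) \<ominus>\<^bsub>H\<^esub> T (u \<ominus>\<^bsub>H\<^esub> v)"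
      using u v y Tc H
      by (intro eq_by_cinner) (simp_all add: cinner_linear linear_ops_diff[OF H H T])
    then show "hdist H (?f u) (?f v) \<le> k * hdist H u v"
      using near[of "u \<ominus>\<^bsub>H\<^esub> v"] u v y Tc by (simp add: hdist_def)
  qed (use k in auto)
  have "T x = y"
  proof (rule eq_by_cinner)
    fix z assume z: "z \<in> carrier H"
    have "cinner H (?f x) z = cinner H x z" using x(2) by (simp only:)
    then show "cinner H (T x) z = cinner H y z"
      using x(1) z y Tc H by (simp add: cinner_linear)
  qed (use x y Tc in auto)
  then show thesis using x that by blast
qed

lemma op_inv_apply:
  assumes "bij_betw A (carrier H) (carrier K)"
  shows op_inv_closed: "y \<in> carrier K \<Longrightarrow> op_inv H K A y \<in> carrier H"
    and op_inv_right: "y \<in> carrier K \<Longrightarrow> A (op_inv H K A y) = y"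
    and op_inv_left: "x \<in> carrier H \<Longrightarrow> op_inv H K A (A x) = x"
  using assms bij_betw_inv_into_right[OF assms] bij_betw_inv_into_left[OF assms]
    bij_betwE[OF bij_betw_inv_into[OF assms]] bij_betwE[OF assms]
  by (auto simp: op_inv_def)

lemma op_inv_linear:
  assumes A: "A \<in> linear_ops H K" and bij: "bij_betw A (carrier H) (carrier K)"
    and H: "hilbert_space H" and K: "hilbert_space K"
  shows "op_inv H K A \<in> linear_ops K H"
proof (rule linear_opsI)
  note i = op_inv_closed[OF bij] op_inv_right[OF bij] op_inv_left[OF bij]
  show "op_inv H K A (x \<oplus>\<^bsub>K\<^esub> y) = op_inv H K A x \<oplus>\<^bsub>H\<^esub> op_inv H K A y"
    if "x \<in> carrier K" "y \<in> carrier K" for x y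
    using i(3)[of "op_inv H K A x \<oplus>\<^bsub>H\<^esub> op_inv H K A y"] that H i
    by (simp add: linear_ops_add[OF A] hilbert_closed)
  show "op_inv H K A (c \<odot>\<^bsub>K\<^esub> x) = c \<odot>\<^bsub>H\<^esub> op_inv H K A x"
    if "x \<in> carrier K" for x c
    using i(3)[of "c \<odot>\<^bsub>H\<^esub> op_inv H K A x"] that H i
    by (simp add: linear_ops_scale[OF A] hilbert_closed)
qed (simp_all add: op_inv_closed[OF bij], simp add: op_inv_def)

text \<open>The lower bound does double duty: it makes \<open>A\<close> injective and bounds the
  inverse by \<open>1 / c\<close>, so no open mapping theorem is involved.\<close>

lemma toplinear_isoI:
  assumes A: "A \<in> bounded_ops H K" and H: "hilbert_space H" and K: "hilbert_space K"
    and c: "c > 0" "\<And>x. x \<in> carrier H \<Longrightarrow> c * hnorm H x \<le> hnorm K (A x)"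
    and surj: "\<And>y. y \<in> carrier K \<Longrightarrow> \<exists>x\<in>carrier H. A x = y"
  shows "toplinear_iso H K A"
proof -
  note lin = bounded_ops_linear[OF A]
  have "inj_on A (carrier H)"
  proof
    fix x y assume xy: "x \<in> carrier H" "y \<in> carrier H" "A x = A y"
    then have "A (x \<ominus>\<^bsub>H\<^esub> y) = \<zero>\<^bsub>K\<^esub>"
      using linear_ops_diff[OF H K lin, of x y] linear_ops_closed[OF lin, of y] K
      by (simp add: hilbert_space.diff_self)
    then have "c * hnorm H (x \<ominus>\<^bsub>H\<^esub> y) \<le> 0"
      using c(2)[of "x \<ominus>\<^bsub>H\<^esub> y"] xy H K by (simp add: hilbert_closed hilbert_space.hnorm_zero)
    then have "hnorm H (x \<ominus>\<^bsub>H\<^esub> y) = 0"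
      using c(1) hilbert_space.hnorm_ge_zero[OF H, of "x \<ominus>\<^bsub>H\<^esub> y"] xy H
      by (simp add: mult_le_0_iff hilbert_closed)
    then show "x = y"
      using H xy hilbert_space.hnorm_eq_zero[OF H, of "x \<ominus>\<^bsub>H\<^esub> y"]
      by (simp add: hilbert_closed hilbert_space.diff_eq_zero)
  qed
  then have bij: "bij_betw A (carrier H) (carrier K)"
    using surj linear_ops_closed[OF lin] by (auto simp: bij_betw_def)
  moreover have "op_inv H K A \<in> bounded_ops K H"
  proof (rule bounded_opsI[where C="1 / c"])
    show "op_inv H K A \<in> linear_ops K H" by (rule op_inv_linear[OF lin bij H K])
    show "hnorm H (op_inv H K A y) \<le> 1 / c * hnorm K y" if "y \<in> carrier K" for y
      using c(2)[of "op_inv H K A y"] c(1) that op_inv_closed[OF bij] op_inv_right[OF bij]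
      by (simp add: field_simps)
  qed
  ultimately show ?thesis using A by (simp add: toplinear_iso_def)
qed

lemma toplinear_isoD:
  assumes "toplinear_iso H K A"
  shows toplinear_iso_bounded: "A \<in> bounded_ops H K"
    and toplinear_iso_inv_bounded: "op_inv H K A \<in> bounded_ops K H"
    and toplinear_iso_bij: "bij_betw A (carrier H) (carrier K)"
  using assms by (auto simp: toplinear_iso_def)

lemma toplinear_iso_lower_bound:
  assumes "toplinear_iso H K A" "hilbert_space H" "hilbert_space K"
  obtains c where "c > 0" "\<And>x. x \<in> carrier H \<Longrightarrow> c * hnorm H x \<le> hnorm K (A x)"
proof -
  obtain C where C: "C > 0" "\<And>y. y \<in> carrier K \<Longrightarrow> hnorm H (op_inv H K A y) \<le> C * hnorm K y"
    using bounded_opsE[OF assms(3) toplinear_iso_inv_bounded[OF assms(1)]] by blast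
  show thesis
  proof (rule that[of "1 / C"])
    fix x assume x: "x \<in> carrier H"
    have "A x \<in> carrier K" using x toplinear_iso_bij[OF assms(1)] bij_betwE by metis
    from C(2)[OF this] show "1 / C * hnorm H x \<le> hnorm K (A x)"
      using x C(1) op_inv_left[OF toplinear_iso_bij[OF assms(1)] x] by (simp add: field_simps)
  qed (use C in simp)
qed

text \<open>The triangle inequality gives the lower bound \<open>1 - k\<close>, and
  \<open>contraction_surj\<close> gives surjectivity.\<close>

lemma near_identity_iso:
  assumes H: "hilbert_space H" and T: "T \<in> bounded_ops H H" and k: "k < 1"
    and near: "\<And>x. x \<in> carrier H \<Longrightarrow> hnorm H (x \<ominus>\<^bsub>H\<^esub> T x) \<le> k * hnorm H x"
  shows "toplinear_iso H H T"
proof (rule toplinear_isoI[OF T H H, of "1 - k"])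
  fix x assume x: "x \<in> carrier H"
  have "T x \<in> carrier H" using linear_ops_closed[OF bounded_ops_linear[OF T] x] .
  then show "(1 - k) * hnorm H x \<le> hnorm H (T x)"
    using near[OF x] hilbert_space.hnorm_le_diff[OF H x, of "T x"] by (simp add: algebra_simps)
next
  fix y assume "y \<in> carrier H"
  then show "\<exists>x\<in>carrier H. T x = y"
    using contraction_surj[OF H bounded_ops_linear[OF T] k near] by metis
qed (use k in simp)

text \<open>This is the Lax-Milgram argument. The lower bound comes from Cauchy-Schwarz; for
  surjectivity a small positive multiple of \<open>S\<close> is shown to differ from the identity by
  a contraction.\<close>

lemma coercive_iso:
  assumes H: "hilbert_space H" and S: "S \<in> bounded_ops H H" and c: "c > 0"
    and coercive: "\<And>x. x \<in> carrier H \<Longrightarrow> c * (hnorm H x)\<^sup>2 \<le> Re (cinner H (S x) x)"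
  shows "toplinear_iso H H S"
proof -
  interpret hilbert_space H by fact
  note lin = bounded_ops_linear[OF S]
  note Sc = linear_ops_closed[OF lin]
  obtain M0 where M0: "M0 > 0" "\<And>x. x \<in> carrier H \<Longrightarrow> hnorm H (S x) \<le> M0 * hnorm H x"
    using bounded_opsE[OF H S] by blast
  \<comment> \<open>The maximum with \<open>c\<close> guarantees \<open>c \<le> M\<close> even on
    the zero space, so that \<open>q\<close> below is nonnegative and has a square root.\<close>
  define M where "M = max M0 c"
  have M: "M > 0" "c \<le> M" "hnorm H (S x) \<le> M * hnorm H x" if "x \<in> carrier H" for x
  proof -
    have "M0 * hnorm H x \<le> M * hnorm H x"
      using hnorm_ge_zero[OF that] by (intro mult_right_mono) (auto simp: M_def)
    then show "hnorm H (S x) \<le> M * hnorm H x" using M0(2)[OF that] by linarith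
  qed (use M0(1) in \<open>auto simp: M_def\<close>)
  have Mpos: "M > 0" "c \<le> M" using M0(1) by (auto simp: M_def)
  \<comment> \<open>Expanding the square gives norm squared of \<open>x - t S x\<close> at most
    \<open>1 - 2 t c + t\<^sup>2 M\<^sup>2\<close> times that of \<open>x\<close>. This quadratic in
    \<open>t\<close> is minimal at \<open>t = c / M\<^sup>2\<close>, with minimum
    \<open>q\<close>.\<close>
  define t where "t = c / M\<^sup>2"
  define q where "q = 1 - c\<^sup>2 / M\<^sup>2"
  have t: "t > 0" using c Mpos by (simp add: t_def)
  have tm: "t * M\<^sup>2 = c" using Mpos by (simp add: t_def)
  have q: "0 \<le> q" "q < 1" using c Mpos by (auto simp: q_def power_mono)
  have qt: "1 - 2 * t * c + t\<^sup>2 * M\<^sup>2 = q"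
    using Mpos by (simp add: q_def t_def field_simps power2_eq_square)
  define T where "T = op_scale H H (complex_of_real t) S"
  have Tx: "T x = complex_of_real t \<odot>\<^bsub>H\<^esub> S x" if "x \<in> carrier H" for x
    using that by (simp add: T_def op_apply)
  have Tlin: "T \<in> linear_ops H H"
  proof (rule linear_opsI)
    show "T (b \<odot>\<^bsub>H\<^esub> x) = b \<odot>\<^bsub>H\<^esub> T x" if "x \<in> carrier H" for b x
      using that Sc H
      by (intro eq_by_cinner) (simp_all add: Tx linear_ops_scale[OF lin] cinner_linear scale_closed)
    qed (use Sc in \<open>simp_all add: Tx scale_closed linear_ops_add[OF lin] scale_add_right\<close>,
      simp add: T_def op_scale_def)
  have near: "hnorm H (x \<ominus>\<^bsub>H\<^esub> T x) \<le> sqrt q * hnorm H x" if x: "x \<in> carrier H" for x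
  proof -
    have "complex_of_real ((hnorm H (x \<ominus>\<^bsub>H\<^esub> T x))\<^sup>2) = cinner H x x - t * cinner H x (S x)
        - t * cinner H (S x) x + t\<^sup>2 * cinner H (S x) (S x)"
      using x Sc H cinner_self[of "x \<ominus>\<^bsub>H\<^esub> T x"]
      by (simp add: Tx cinner_linear hilbert_closed algebra_simps power2_eq_square)
    moreover have "Re (cinner H x (S x)) = Re (cinner H (S x) x)"
      using cinner_commute[of x "S x"] x Sc by simp
    moreover have "Re (cinner H x x) = (hnorm H x)\<^sup>2" "Re (cinner H (S x) (S x)) = (hnorm H (S x))\<^sup>2"
      using cinner_self x Sc by simp_all
    ultimately have "(hnorm H (x \<ominus>\<^bsub>H\<^esub> T x))\<^sup>2 =
        (hnorm H x)\<^sup>2 - 2 * t * Re (cinner H (S x) x) + t\<^sup>2 * (hnorm H (S x))\<^sup>2"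
      by (simp add: complex_eq_iff)
    also have "\<dots> \<le> (hnorm H x)\<^sup>2 - 2 * t * (c * (hnorm H x)\<^sup>2) + t\<^sup>2 * (M * hnorm H x)\<^sup>2"
      using coercive[OF x] M(3)[OF x] t hnorm_ge_zero Sc x
      by (intro add_mono diff_mono mult_left_mono power_mono) auto
    also have "\<dots> = (1 - 2 * t * c + t\<^sup>2 * M\<^sup>2) * (hnorm H x)\<^sup>2"
      by (simp add: algebra_simps power_mult_distrib)
    also have "\<dots> = (sqrt q * hnorm H x)\<^sup>2" using q qt by (simp add: power_mult_distrib)
    finally show ?thesis
      by (rule power2_le_imp_le) (use q hnorm_ge_zero[OF x] in simp)
  qed
  show ?thesis
  proof (rule toplinear_isoI[OF S H H c])
    fix x assume x: "x \<in> carrier H"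
    have "c * (hnorm H x)\<^sup>2 \<le> cmod (cinner H (S x) x)"
      using coercive[OF x] complex_Re_le_cmod[of "cinner H (S x) x"] by linarith
    also have "\<dots> \<le> hnorm H (S x) * hnorm H x" using Cauchy_Schwarz x Sc by simp
    finally have "(c * hnorm H x) * hnorm H x \<le> hnorm H (S x) * hnorm H x"
      by (simp add: power2_eq_square mult.assoc)
    then show "c * hnorm H x \<le> hnorm H (S x)"
      using hnorm_ge_zero[OF x] hnorm_ge_zero[OF Sc[OF x]]
      by (cases "hnorm H x = 0") (auto simp: mult_le_cancel_right)
  next
    fix y assume y: "y \<in> carrier H"
    obtain x where x: "x \<in> carrier H" "T x = y"
      using contraction_surj[OF H Tlin _ near y] q by (metis real_sqrt_lt_1_iff)
    \<comment> \<open>\<open>T\<close> is \<open>S\<close> multiplied by \<open>t\<close>, so the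
      preimage under \<open>S\<close> is the preimage under \<open>T\<close> scaled by
      \<open>t\<close>.\<close>
    then have "S (complex_of_real t \<odot>\<^bsub>H\<^esub> x) = y" using Tx by (simp add: linear_ops_scale[OF lin])
    then show "\<exists>x\<in>carrier H. S x = y" using x scale_closed by blast
  qed
qed

section \<open>Subspaces and norm-continuous families of operators\<close>

lemma bounded_ops_closed: "A \<in> bounded_ops H K \<Longrightarrow> x \<in> carrier H \<Longrightarrow> A x \<in> carrier K"
  using linear_ops_closed[OF bounded_ops_linear] .

lemmas bounded_ops_diff = linear_ops_diff[OF _ _ bounded_ops_linear]

lemma hnorm_restrict_carrier [simp]: "hnorm (H\<lparr>carrier := C\<rparr>) = hnorm H"
  by (simp add: hnorm_def fun_eq_iff)

text \<open>Negation in a substructure is defined relative to the smaller carrier, so the two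
  differences do not agree by definition. They agree because adding \<open>y\<close> to either gives
  \<open>x\<close>. Only the group structure of \<open>C\<close> is assumed, so that the lemma can
  serve before \<open>C\<close> is known to be complete.\<close>

lemma subgroup_diff:
  assumes H: "hilbert_space H" and C: "abelian_group (H\<lparr>carrier := C\<rparr>)" and sub: "C \<subseteq> carrier H"
    and x: "x \<in> C" and y: "y \<in> C"
  shows "x \<ominus>\<^bsub>H\<lparr>carrier := C\<rparr>\<^esub> y = x \<ominus>\<^bsub>H\<^esub> y"
proof -
  interpret H: hilbert_space H by fact
  interpret C: abelian_group "H\<lparr>carrier := C\<rparr>" by fact
  let ?d = "x \<ominus>\<^bsub>H\<lparr>carrier := C\<rparr>\<^esub> y"
  have d: "?d \<in> C" using C.minus_closed[of x y] x y by simp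
  have "?d \<oplus>\<^bsub>H\<lparr>carrier := C\<rparr>\<^esub> y = x"
    using x y C.a_assoc[of x "\<ominus>\<^bsub>H\<lparr>carrier := C\<rparr>\<^esub> y" y] C.a_inv_closed[of y] C.l_neg[of y] C.r_zero[of x]
    by (simp add: a_minus_def del: C.add.inv_closed)
  then have "?d \<oplus>\<^bsub>H\<^esub> y = (x \<ominus>\<^bsub>H\<^esub> y) \<oplus>\<^bsub>H\<^esub> y"
    using H.diff_add_cancel[OF subsetD[OF sub x] subsetD[OF sub y]] by simp
  then show ?thesis using d x y sub by (simp add: subset_iff)
qed

lemma subspace_diff:
  assumes "hilbert_space H" "hilbert_space (H\<lparr>carrier := C\<rparr>)" "C \<subseteq> carrier H" "x \<in> C" "y \<in> C"
  shows "x \<ominus>\<^bsub>H\<lparr>carrier := C\<rparr>\<^esub> y = x \<ominus>\<^bsub>H\<^esub> y"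
proof -
  interpret C: hilbert_space "H\<lparr>carrier := C\<rparr>" by fact
  show ?thesis using subgroup_diff[OF assms(1) C.M.abelian_group_axioms assms(3-5)] .
qed

text \<open>The range of an idempotent is its set of fixed points. Boundedness makes that set
  closed, and a closed subspace inherits completeness.\<close>

lemma hilbert_space_range:
  assumes H: "hilbert_space H" and P: "P \<in> bounded_ops H H"
    and idem: "\<And>x. x \<in> carrier H \<Longrightarrow> P (P x) = P x"
  shows "hilbert_space (range_space H P)"
proof -
  interpret hilbert_space H by fact
  note lin = bounded_ops_linear[OF P]
  note Pc = bounded_ops_closed[OF P]
  define C where "C = P ` carrier H"
  have C: "x \<in> C \<longleftrightarrow> x \<in> carrier H \<and> P x = x" for x
    unfolding C_def using idem Pc by (auto simp: image_iff) metis
  have zC: "\<zero>\<^bsub>H\<^esub> \<in> C" using linear_ops_zero[OF H H lin] carrier_closed(1) by (simp add: C)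
  have aC: "x \<oplus>\<^bsub>H\<^esub> y \<in> C" if "x \<in> C" "y \<in> C" for x y
    using that linear_ops_add[OF lin, of x y] by (simp add: C)
  have sC: "c \<odot>\<^bsub>H\<^esub> x \<in> C" if "x \<in> C" for c x
    using that linear_ops_scale[OF lin, of x c] scale_closed by (simp add: C)
  let ?R = "H\<lparr>carrier := C\<rparr>"
  have neg: "(- 1) \<odot>\<^bsub>H\<^esub> x \<oplus>\<^bsub>H\<^esub> x = \<zero>\<^bsub>H\<^esub>" if "x \<in> carrier H" for x
    using that by (intro eq_by_cinner)
      (simp_all add: scale_closed cinner_add_left cinner_scale_left cinner_zero_left)
  have ab: "abelian_group ?R"
  proof (rule abelian_groupI)
    show "\<exists>y\<in>carrier ?R. y \<oplus>\<^bsub>?R\<^esub> x = \<zero>\<^bsub>?R\<^esub>" if "x \<in> carrier ?R" for x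
      using that sC neg C by (intro bexI[of _ "(- 1) \<odot>\<^bsub>H\<^esub> x"]) auto
  qed (use aC zC C in \<open>auto simp: M.a_ac\<close>)
  note diff = subgroup_diff[OF H ab]
  have sub: "C \<subseteq> carrier H" using C by auto
  have dist: "hdist ?R x y = hdist H x y" if "x \<in> C" "y \<in> C" for x y
    using that diff[OF sub that] sub by (auto simp: hdist_def)
  interpret HM: Metric_space "carrier H" "hdist H" by (rule metric)
  interpret RM: Metric_space C "hdist ?R"
  proof
    show "hdist ?R x z \<le> hdist ?R x y + hdist ?R y z" if "x \<in> C" "y \<in> C" "z \<in> C" for x y z
      using that sub HM.triangle[of x y z] by (auto simp: dist)
    show "hdist ?R x y = 0 \<longleftrightarrow> x = y" if "x \<in> C" "y \<in> C" for x y
      using dist[OF that] HM.zero[OF subsetD[OF sub that(1)] subsetD[OF sub that(2)]] by simp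
    show "0 \<le> hdist ?R x y" for x y
    proof (cases "x \<in> C \<and> y \<in> C")
      case True
      then show ?thesis by (simp add: dist)
    qed (auto simp: hdist_def)
    show "hdist ?R x y = hdist ?R y x" for x y
      using dist[of x y] dist[of y x] HM.commute[of x y]
      by (cases "x \<in> C \<and> y \<in> C") (auto simp: hdist_def)
  qed
  obtain c where c: "c > 0" "\<And>x. x \<in> carrier H \<Longrightarrow> hnorm H (P x) \<le> c * hnorm H x"
    using bounded_opsE[OF H P] by blast
  have "RM.mcomplete"
    unfolding RM.mcomplete_def
  proof (intro allI impI)
    fix s :: "nat \<Rightarrow> 'a" assume s: "RM.MCauchy s"
    then have sC: "s i \<in> C" for i by (auto simp: RM.MCauchy_def)
    then have sH: "s i \<in> carrier H" for i using sub by auto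
    have "HM.MCauchy s"
      using s sC sub by (auto simp: RM.MCauchy_def HM.MCauchy_def dist)
    then obtain l where l: "limitin HM.mtopology s l sequentially"
      using complete by (auto simp: HM.mcomplete_def)
    then have lH: "l \<in> carrier H"
      and lim: "\<And>e. e > 0 \<Longrightarrow> \<exists>N. \<forall>n\<ge>N. s n \<in> carrier H \<and> hdist H (s n) l < e"
      by (auto simp: HM.limit_metric_sequentially)
    have "hnorm H (l \<ominus>\<^bsub>H\<^esub> P l) \<le> 0 + e" if e: "e > 0" for e
    proof -
      \<comment> \<open>Since \<open>P\<close> fixes \<open>s i\<close>, one has
        \<open>l - P l = (l - s i) + P (s i - l)\<close>, whose norm is at most \<open>c + 1\<close>
        times the distance from \<open>s i\<close> to \<open>l\<close>.\<close>
      from lim[of "e / (c + 1)"] e c obtain i where "hdist H (s i) l < e / (c + 1)" by auto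
      then have i: "hnorm H (s i \<ominus>\<^bsub>H\<^esub> l) < e / (c + 1)" using sH lH by (simp add: hdist_def)
      have "hnorm H (l \<ominus>\<^bsub>H\<^esub> P l) \<le> hnorm H (l \<ominus>\<^bsub>H\<^esub> s i) + hnorm H (s i \<ominus>\<^bsub>H\<^esub> P l)"
        using hnorm_triangle_diff sH lH Pc by blast
      also have "s i \<ominus>\<^bsub>H\<^esub> P l = P (s i \<ominus>\<^bsub>H\<^esub> l)"
        using bounded_ops_diff[OF H H P sH[of i] lH] sC[of i] C by simp
      also have "hnorm H (P (s i \<ominus>\<^bsub>H\<^esub> l)) \<le> c * hnorm H (s i \<ominus>\<^bsub>H\<^esub> l)"
        using c(2)[of "s i \<ominus>\<^bsub>H\<^esub> l"] sH lH by simp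
      finally have "hnorm H (l \<ominus>\<^bsub>H\<^esub> P l) \<le> (c + 1) * hnorm H (s i \<ominus>\<^bsub>H\<^esub> l)"
        using hnorm_minus_commute[OF lH sH[of i]] by (simp add: algebra_simps)
      also have "\<dots> \<le> e" using i c(1) by (simp add: field_simps)
      finally show ?thesis by simp
    qed
    then have "hnorm H (l \<ominus>\<^bsub>H\<^esub> P l) \<le> 0" by (rule field_le_epsilon)
    then have "l \<ominus>\<^bsub>H\<^esub> P l = \<zero>\<^bsub>H\<^esub>"
      using hnorm_eq_zero hnorm_ge_zero lH Pc by (simp add: order_antisym)
    then have lC: "l \<in> C" using diff_eq_zero lH Pc C by auto
    have "limitin RM.mtopology s l sequentially"
      unfolding RM.limit_metric_sequentially using lim lC sC by (fastforce simp: dist)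
    then show "\<exists>x. limitin RM.mtopology s x sequentially" by blast
  qed
  then have "Metric_space.mcomplete (carrier ?R) (hdist ?R)" by simp
  moreover have "Module.module (ring_of_type_algebra :: complex ring) ?R"
  proof (rule moduleI)
    show "cring (ring_of_type_algebra :: complex ring)" by (rule R.cring_axioms)
  qed (use ab sC C smult_l_distr smult_r_distr smult_assoc1 in auto)
  ultimately have "hilbert_space ?R"
  proof (intro hilbert_space.intro hilbert_space_axioms.intro)
    show "x = \<zero>\<^bsub>?R\<^esub>" if "x \<in> carrier ?R" "cinner ?R x x = 0" for x
      using that cinner_eq_zero[of x] sub by auto
    show "cinner ?R x y = cnj (cinner ?R y x)" if "x \<in> carrier ?R" "y \<in> carrier ?R" for x y
      using that cinner_commute[of x y] sub by auto
  qed (use C in \<open>simp_all add: cinner_add_left cinner_scale_left cinner_ge_zero\<close>)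
  then show ?thesis by (simp add: range_space_def C_def)
qed

lemma linear_ops_restrict:
  assumes "A \<in> linear_ops H K" "C \<subseteq> carrier H" "A ` C \<subseteq> D" "hilbert_space (H\<lparr>carrier := C\<rparr>)"
  shows "restrict A C \<in> linear_ops (H\<lparr>carrier := C\<rparr>) (K\<lparr>carrier := D\<rparr>)"
proof -
  interpret C: hilbert_space "H\<lparr>carrier := C\<rparr>" by fact
  have cl: "x \<oplus>\<^bsub>H\<^esub> y \<in> C" "c \<odot>\<^bsub>H\<^esub> x \<in> C" if "x \<in> C" "y \<in> C" for x y c
    using that C.carrier_closed(2)[of x y] C.scale_closed[of x c] by simp_all
  show ?thesis
  proof (rule linear_opsI)
    fix x y assume xy: "x \<in> carrier (H\<lparr>carrier := C\<rparr>)" "y \<in> carrier (H\<lparr>carrier := C\<rparr>)"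
    then have "x \<in> carrier H" "y \<in> carrier H" using assms(2) by auto
    from linear_ops_add[OF assms(1) this] show "restrict A C (x \<oplus>\<^bsub>H\<lparr>carrier := C\<rparr>\<^esub> y) =
        restrict A C x \<oplus>\<^bsub>K\<lparr>carrier := D\<rparr>\<^esub> restrict A C y"
      using cl xy by simp
  next
    fix c x assume "x \<in> carrier (H\<lparr>carrier := C\<rparr>)"
    then show "restrict A C (c \<odot>\<^bsub>H\<lparr>carrier := C\<rparr>\<^esub> x) = c \<odot>\<^bsub>K\<lparr>carrier := D\<rparr>\<^esub> restrict A C x"
      using cl(2)[of x x c] linear_ops_scale[OF assms(1), of x c] assms(2) by auto
  qed (use assms in auto)
qed

lemma bounded_ops_restrict:
  assumes A: "A \<in> bounded_ops H K" and sub: "C \<subseteq> carrier H" and im: "A ` C \<subseteq> D"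
    and C: "hilbert_space (H\<lparr>carrier := C\<rparr>)"
  shows "restrict A C \<in> bounded_ops (H\<lparr>carrier := C\<rparr>) (K\<lparr>carrier := D\<rparr>)"
proof -
  obtain c where c: "\<And>x. x \<in> carrier H \<Longrightarrow> hnorm K (A x) \<le> c * hnorm H x"
    using A by (auto simp: bounded_ops_def)
  show ?thesis
    by (rule bounded_opsI[OF linear_ops_restrict[OF bounded_ops_linear[OF A] sub im C], of c])
      (use c sub in auto)
qed

text \<open>\<open>op_inv\<close> chooses preimages in the carrier it is given. Injectivity of
  \<open>A\<close> on the whole space forces the choice in \<open>C\<close> to agree with the choice
  in \<open>carrier H\<close>.\<close>

lemma op_inv_restrict:
  assumes bij: "bij_betw A (carrier H) (carrier K)" and sub: "C \<subseteq> carrier H" and im: "A ` C = D"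
  shows "op_inv (H\<lparr>carrier := C\<rparr>) (K\<lparr>carrier := D\<rparr>) (restrict A C) = restrict (op_inv H K A) D"
    and "op_inv H K A ` D = C" and "bij_betw (restrict A C) C D"
proof -
  have inj: "inj_on A (carrier H)" using bij by (simp add: bij_betw_def)
  have DK: "D \<subseteq> carrier K" using bij sub im by (auto simp: bij_betw_def)
  have injC: "inj_on (restrict A C) C" using inj sub by (auto simp: inj_on_def)
  show bC: "bij_betw (restrict A C) C D" using injC im by (auto simp: bij_betw_def)
  have inv: "inv_into C (restrict A C) y = op_inv H K A y" if y: "y \<in> D" for y
  proof -
    obtain x where x: "x \<in> C" "y = A x" using y im by auto
    have "inv_into C (restrict A C) y = x" using inv_into_f_f[OF injC x(1)] x by simp
    moreover have "op_inv H K A y = x" using op_inv_left[OF bij, of x] x sub by auto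
    ultimately show ?thesis by simp
  qed
  then show "op_inv (H\<lparr>carrier := C\<rparr>) (K\<lparr>carrier := D\<rparr>) (restrict A C) = restrict (op_inv H K A) D"
    by (auto simp: op_inv_def[of "H\<lparr>carrier := C\<rparr>"] restrict_def)
  show "op_inv H K A ` D = C"
    using op_inv_left[OF bij] sub im by (force simp: image_iff subset_iff)
qed

lemma toplinear_iso_restrict:
  assumes A: "toplinear_iso H K A" and sub: "C \<subseteq> carrier H" and im: "A ` C = D"
    and C: "hilbert_space (H\<lparr>carrier := C\<rparr>)" and D: "hilbert_space (K\<lparr>carrier := D\<rparr>)"
  shows "toplinear_iso (H\<lparr>carrier := C\<rparr>) (K\<lparr>carrier := D\<rparr>) (restrict A C)"
proof -
  note bij = toplinear_iso_bij[OF A]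
  note r = op_inv_restrict[OF bij sub im]
  have DK: "D \<subseteq> carrier K" using bij sub im by (auto simp: bij_betw_def)
  show ?thesis
    unfolding toplinear_iso_def r(1)
    using bounded_ops_restrict[OF toplinear_iso_bounded[OF A] sub _ C, of D]
      bounded_ops_restrict[OF toplinear_iso_inv_bounded[OF A] DK _ D, of C] r(2,3) im
    by auto
qed

section \<open>Calculus of norm-continuous operator families\<close>

lemma norm_continuous_on_bounded: "norm_continuous_on M U H K T \<Longrightarrow> x \<in> U \<Longrightarrow> T x \<in> bounded_ops H K"
  by (simp add: norm_continuous_on_def)

lemma norm_continuous_onE:
  assumes "norm_continuous_on M U H K T" "x \<in> U" "e > 0"
  obtains W where "openin M W" "x \<in> W"
    "\<And>y v. y \<in> W \<Longrightarrow> y \<in> U \<Longrightarrow> v \<in> carrier H \<Longrightarrow> hnorm K (T y v \<ominus>\<^bsub>K\<^esub> T x v) \<le> e * hnorm H v"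
proof -
  obtain W where "openin M W" "x \<in> W"
    "\<forall>y\<in>W \<inter> U. \<forall>v\<in>carrier H. hnorm K (T y v \<ominus>\<^bsub>K\<^esub> T x v) \<le> e * hnorm H v"
    using assms unfolding norm_continuous_on_def by blast
  then show thesis using that by blast
qed

lemma norm_continuous_onI:
  assumes "\<And>x. x \<in> U \<Longrightarrow> T x \<in> bounded_ops H K"
    and "\<And>x e. x \<in> U \<Longrightarrow> e > 0 \<Longrightarrow> \<exists>W. openin M W \<and> x \<in> W \<and>
      (\<forall>y\<in>W \<inter> U. \<forall>v\<in>carrier H. hnorm K (T y v \<ominus>\<^bsub>K\<^esub> T x v) \<le> e * hnorm H v)"
  shows "norm_continuous_on M U H K T"
  using assms by (simp add: norm_continuous_on_def)

lemma norm_continuous_on_subset: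
  assumes "norm_continuous_on M U H K T" "V \<subseteq> U"
  shows "norm_continuous_on M V H K T"
proof (rule norm_continuous_onI)
  fix x assume "x \<in> V"
  then have x: "x \<in> U" using assms(2) by blast
  show "T x \<in> bounded_ops H K" using norm_continuous_on_bounded[OF assms(1) x] .
  fix e :: real assume e: "e > 0"
  obtain W where W: "openin M W" "x \<in> W"
    "\<And>y v. y \<in> W \<Longrightarrow> y \<in> U \<Longrightarrow> v \<in> carrier H \<Longrightarrow> hnorm K (T y v \<ominus>\<^bsub>K\<^esub> T x v) \<le> e * hnorm H v"
    using norm_continuous_onE[OF assms(1) x e] by blast
  then show "\<exists>W. openin M W \<and> x \<in> W \<and>
      (\<forall>y\<in>W \<inter> V. \<forall>v\<in>carrier H. hnorm K (T y v \<ominus>\<^bsub>K\<^esub> T x v) \<le> e * hnorm H v)"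
    using assms(2) by (intro exI[of _ W]) auto
qed

lemma norm_continuous_on_cong:
  assumes "norm_continuous_on M U H K T" "\<And>x. x \<in> U \<Longrightarrow> T x = S x"
  shows "norm_continuous_on M U H K S"
  using assms unfolding norm_continuous_on_def by simp

text \<open>Changing to charts of the atlas is possible only near a given point, with charts that
  depend on the point; this lemma glues the resulting local statements.\<close>

lemma norm_continuous_on_local:
  assumes "\<And>x. x \<in> U \<Longrightarrow> \<exists>V. openin M V \<and> x \<in> V \<and> norm_continuous_on M (V \<inter> U) H K T"
  shows "norm_continuous_on M U H K T"
proof (rule norm_continuous_onI)
  fix x assume x: "x \<in> U"
  then obtain V where V: "openin M V" "x \<in> V" "norm_continuous_on M (V \<inter> U) H K T"
    using assms by blast
  show "T x \<in> bounded_ops H K" using norm_continuous_on_bounded[OF V(3)] V(2) x by blast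
  fix e :: real assume "e > 0"
  then obtain W where W: "openin M W" "x \<in> W"
    "\<And>y v. y \<in> W \<Longrightarrow> y \<in> V \<inter> U \<Longrightarrow> v \<in> carrier H \<Longrightarrow> hnorm K (T y v \<ominus>\<^bsub>K\<^esub> T x v) \<le> e * hnorm H v"
    using norm_continuous_onE[OF V(3), of x e] V(2) x by blast
  then show "\<exists>W. openin M W \<and> x \<in> W \<and>
      (\<forall>y\<in>W \<inter> U. \<forall>v\<in>carrier H. hnorm K (T y v \<ominus>\<^bsub>K\<^esub> T x v) \<le> e * hnorm H v)"
    using V by (intro exI[of _ "W \<inter> V"]) auto
qed

lemma norm_continuous_on_const:
  assumes "A \<in> bounded_ops H K" "hilbert_space H" "hilbert_space K" "U \<subseteq> topspace M"
  shows "norm_continuous_on M U H K (\<lambda>x. A)"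
proof (rule norm_continuous_onI)
  fix x and e :: real assume "x \<in> U" "e > 0"
  then show "\<exists>W. openin M W \<and> x \<in> W \<and>
      (\<forall>y\<in>W \<inter> U. \<forall>v\<in>carrier H. hnorm K (A v \<ominus>\<^bsub>K\<^esub> A v) \<le> e * hnorm H v)"
    using assms(4) bounded_ops_closed[OF assms(1)] hilbert_space.hnorm_ge_zero[OF assms(2)]
    by (intro exI[of _ "topspace M"])
      (auto simp: hilbert_space.diff_self[OF assms(3)] hilbert_space.hnorm_zero[OF assms(3)])
qed (use assms in simp)

lemma norm_continuous_on_comp:
  assumes S: "norm_continuous_on M U H K S" and T: "norm_continuous_on M U K J T"
    and H: "hilbert_space H" and K: "hilbert_space K" and J: "hilbert_space J"
  shows "norm_continuous_on M U H J (\<lambda>x. op_comp H (T x) (S x))"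
proof (rule norm_continuous_onI)
  note Sb = norm_continuous_on_bounded[OF S] and Tb = norm_continuous_on_bounded[OF T]
  fix x assume x: "x \<in> U"
  show "op_comp H (T x) (S x) \<in> bounded_ops H J"
    using op_comp_bounded[OF Sb[OF x] Tb[OF x] H K] .
  fix e :: real assume e: "e > 0"
  obtain s where s: "s > 0" "\<And>v. v \<in> carrier H \<Longrightarrow> hnorm K (S x v) \<le> s * hnorm H v"
    using bounded_opsE[OF H Sb[OF x]] by blast
  obtain t where t: "t > 0" "\<And>v. v \<in> carrier K \<Longrightarrow> hnorm J (T x v) \<le> t * hnorm K v"
    using bounded_opsE[OF K Tb[OF x]] by blast
  \<comment> \<open>Write \<open>T y S y - T x S x = T y (S y - S x) + (T y - T x) S x\<close>. With
    \<open>d \<le> 1\<close> the norm of \<open>T y\<close> is at most \<open>1 + t\<close>, so the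
    two terms contribute \<open>d * (1 + t)\<close> and \<open>d * s\<close>.\<close>
  define d where "d = min 1 (e / (1 + t + s))"
  have d: "d > 0" "d \<le> 1" "d * (1 + t + s) \<le> e"
  proof -
    have "d * (1 + t + s) \<le> e / (1 + t + s) * (1 + t + s)"
      using s(1) t(1) by (intro mult_right_mono) (auto simp: d_def)
    then show "d * (1 + t + s) \<le> e" using s(1) t(1) by simp
  qed (use e s(1) t(1) in \<open>auto simp: d_def\<close>)
  obtain V where V: "openin M V" "x \<in> V"
    "\<And>y v. y \<in> V \<Longrightarrow> y \<in> U \<Longrightarrow> v \<in> carrier H \<Longrightarrow> hnorm K (S y v \<ominus>\<^bsub>K\<^esub> S x v) \<le> d * hnorm H v"
    using norm_continuous_onE[OF S x d(1)] by blast
  obtain W where W: "openin M W" "x \<in> W"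
    "\<And>y v. y \<in> W \<Longrightarrow> y \<in> U \<Longrightarrow> v \<in> carrier K \<Longrightarrow> hnorm J (T y v \<ominus>\<^bsub>J\<^esub> T x v) \<le> d * hnorm K v"
    using norm_continuous_onE[OF T x d(1)] by blast
  have "hnorm J (op_comp H (T y) (S y) v \<ominus>\<^bsub>J\<^esub> op_comp H (T x) (S x) v) \<le> e * hnorm H v"
    if y: "y \<in> V" "y \<in> W" "y \<in> U" and v: "v \<in> carrier H" for y v
  proof -
    have Sv: "S y v \<in> carrier K" "S x v \<in> carrier K"
      using bounded_ops_closed[OF Sb v] x y by auto
    define w where "w = S y v \<ominus>\<^bsub>K\<^esub> S x v"
    have w: "w \<in> carrier K" using Sv K by (simp add: w_def hilbert_closed)
    have wd: "hnorm K w \<le> d * hnorm H v" unfolding w_def using V(3) y v by blast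
    note Tc = bounded_ops_closed[OF Tb[OF x]] bounded_ops_closed[OF Tb[OF y(3)]]
    have "hnorm J (T y w) \<le> hnorm J (T y w \<ominus>\<^bsub>J\<^esub> T x w) + hnorm J (T x w)"
      using hilbert_space.hnorm_le_diff[OF J] Tc w by blast
    also have "\<dots> \<le> d * hnorm K w + t * hnorm K w"
      using W(3)[OF y(2,3) w] t(2)[OF w] by linarith
    also have "\<dots> = (d + t) * hnorm K w" by (simp add: algebra_simps)
    also have "\<dots> \<le> (1 + t) * hnorm K w"
      using d hilbert_space.hnorm_ge_zero[OF K w] by (intro mult_right_mono) auto
    also have "\<dots> \<le> (1 + t) * (d * hnorm H v)" using wd t(1) by (intro mult_left_mono) auto
    finally have 1: "hnorm J (T y w) \<le> (1 + t) * (d * hnorm H v)" .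
    have "hnorm J (T y (S x v) \<ominus>\<^bsub>J\<^esub> T x (S x v)) \<le> d * hnorm K (S x v)"
      using W(3) y Sv by blast
    also have "\<dots> \<le> d * (s * hnorm H v)" using s(2)[OF v] d by simp
    finally have 2: "hnorm J (T y (S x v) \<ominus>\<^bsub>J\<^esub> T x (S x v)) \<le> d * (s * hnorm H v)" .
    have "T y (S y v) \<ominus>\<^bsub>J\<^esub> T x (S x v) = T y w \<oplus>\<^bsub>J\<^esub> (T y (S x v) \<ominus>\<^bsub>J\<^esub> T x (S x v))"
      unfolding w_def bounded_ops_diff[OF K J Tb[OF y(3)] Sv]
      using Tc Sv J
      by (intro hilbert_space.eq_by_cinner[OF J]) (simp_all add: cinner_linear hilbert_closed)
    then have "hnorm J (T y (S y v) \<ominus>\<^bsub>J\<^esub> T x (S x v)) \<le>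
        hnorm J (T y w) + hnorm J (T y (S x v) \<ominus>\<^bsub>J\<^esub> T x (S x v))"
      using hilbert_space.hnorm_triangle[OF J, of "T y w" "T y (S x v) \<ominus>\<^bsub>J\<^esub> T x (S x v)"] Tc Sv w J
      by (simp add: hilbert_closed)
    also have "\<dots> \<le> (d * (1 + t + s)) * hnorm H v" using 1 2 by (simp add: algebra_simps)
    also have "\<dots> \<le> e * hnorm H v"
      using d hilbert_space.hnorm_ge_zero[OF H v] by (intro mult_right_mono) auto
    finally show ?thesis using v by (simp add: op_apply)
  qed
  then show "\<exists>W. openin M W \<and> x \<in> W \<and> (\<forall>y\<in>W \<inter> U. \<forall>v\<in>carrier H.
      hnorm J (op_comp H (T y) (S y) v \<ominus>\<^bsub>J\<^esub> op_comp H (T x) (S x) v) \<le> e * hnorm H v)"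
    using V W by (intro exI[of _ "V \<inter> W"]) auto
qed

lemma norm_continuous_on_diff:
  assumes S: "norm_continuous_on M U H K S" and T: "norm_continuous_on M U H K T"
    and H: "hilbert_space H" and K: "hilbert_space K"
  shows "norm_continuous_on M U H K (\<lambda>x. op_diff H K (S x) (T x))"
proof (rule norm_continuous_onI)
  note Sb = norm_continuous_on_bounded[OF S] and Tb = norm_continuous_on_bounded[OF T]
  fix x assume x: "x \<in> U"
  show "op_diff H K (S x) (T x) \<in> bounded_ops H K"
    using op_diff_bounded[OF Sb[OF x] Tb[OF x] H K] .
  fix e :: real assume e: "e > 0"
  then have d: "e / 2 > 0" by simp
  obtain V where V: "openin M V" "x \<in> V"
    "\<And>y v. y \<in> V \<Longrightarrow> y \<in> U \<Longrightarrow> v \<in> carrier H \<Longrightarrow> hnorm K (S y v \<ominus>\<^bsub>K\<^esub> S x v) \<le> e / 2 * hnorm H v"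
    using norm_continuous_onE[OF S x d] by blast
  obtain W where W: "openin M W" "x \<in> W"
    "\<And>y v. y \<in> W \<Longrightarrow> y \<in> U \<Longrightarrow> v \<in> carrier H \<Longrightarrow> hnorm K (T y v \<ominus>\<^bsub>K\<^esub> T x v) \<le> e / 2 * hnorm H v"
    using norm_continuous_onE[OF T x d] by blast
  have "hnorm K (op_diff H K (S y) (T y) v \<ominus>\<^bsub>K\<^esub> op_diff H K (S x) (T x) v) \<le> e * hnorm H v"
    if y: "y \<in> V" "y \<in> W" "y \<in> U" and v: "v \<in> carrier H" for y v
  proof -
    note c = bounded_ops_closed[OF Sb[OF x] v] bounded_ops_closed[OF Sb[OF y(3)] v]
      bounded_ops_closed[OF Tb[OF x] v] bounded_ops_closed[OF Tb[OF y(3)] v]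
    have "(S y v \<ominus>\<^bsub>K\<^esub> T y v) \<ominus>\<^bsub>K\<^esub> (S x v \<ominus>\<^bsub>K\<^esub> T x v) =
        (S y v \<ominus>\<^bsub>K\<^esub> S x v) \<ominus>\<^bsub>K\<^esub> (T y v \<ominus>\<^bsub>K\<^esub> T x v)"
      using c K by (intro hilbert_space.eq_by_cinner[OF K]) (simp_all add: cinner_linear hilbert_closed)
    then have "hnorm K ((S y v \<ominus>\<^bsub>K\<^esub> T y v) \<ominus>\<^bsub>K\<^esub> (S x v \<ominus>\<^bsub>K\<^esub> T x v)) \<le>
        hnorm K (S y v \<ominus>\<^bsub>K\<^esub> S x v) + hnorm K (T y v \<ominus>\<^bsub>K\<^esub> T x v)"
      using hilbert_space.hnorm_diff_le[OF K, of "S y v \<ominus>\<^bsub>K\<^esub> S x v" "T y v \<ominus>\<^bsub>K\<^esub> T x v"] c K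
      by (simp add: hilbert_closed)
    also have "\<dots> \<le> e * hnorm H v" using V(3)[OF y(1,3) v] W(3)[OF y(2,3) v] by simp
    finally show ?thesis using v by (simp add: op_apply)
  qed
  then show "\<exists>W. openin M W \<and> x \<in> W \<and> (\<forall>y\<in>W \<inter> U. \<forall>v\<in>carrier H.
      hnorm K (op_diff H K (S y) (T y) v \<ominus>\<^bsub>K\<^esub> op_diff H K (S x) (T x) v) \<le> e * hnorm H v)"
    using V W by (intro exI[of _ "V \<inter> W"]) auto
qed

text \<open>The difference of the inverses at \<open>y\<close> and \<open>x\<close> is the inverse
  at \<open>y\<close>, times \<open>T x - T y\<close>, times the inverse at \<open>x\<close>. A
  lower bound for \<open>T x\<close> persists, halved, for nearby \<open>T y\<close>, so the first
  factor stays bounded.\<close>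

lemma norm_continuous_on_inverse:
  assumes T: "norm_continuous_on M U H K T" and iso: "\<And>x. x \<in> U \<Longrightarrow> toplinear_iso H K (T x)"
    and H: "hilbert_space H" and K: "hilbert_space K"
  shows "norm_continuous_on M U K H (\<lambda>x. op_inv H K (T x))"
proof (rule norm_continuous_onI)
  note Tb = norm_continuous_on_bounded[OF T]
  fix x assume x: "x \<in> U"
  show "op_inv H K (T x) \<in> bounded_ops K H" using toplinear_iso_inv_bounded[OF iso[OF x]] .
  fix e :: real assume e: "e > 0"
  obtain c where c: "c > 0" "\<And>v. v \<in> carrier H \<Longrightarrow> c * hnorm H v \<le> hnorm K (T x v)"
    using toplinear_iso_lower_bound[OF iso[OF x] H K] by blast
  \<comment> \<open>The bound \<open>c / 2\<close> preserves the lower bound \<open>c / 2\<close>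
    for \<open>T y\<close>. The bound \<open>e * c\<^sup>2 / 2\<close> makes the product of
    \<open>2 / c\<close>, \<open>d\<close> and \<open>1 / c\<close> at most
    \<open>e\<close>.\<close>
  define d where "d = min (c / 2) (e * c\<^sup>2 / 2)"
  have d: "d > 0" "d \<le> c / 2" "d \<le> e * c\<^sup>2 / 2" using c(1) e by (auto simp: d_def)
  obtain V where V: "openin M V" "x \<in> V"
    "\<And>y v. y \<in> V \<Longrightarrow> y \<in> U \<Longrightarrow> v \<in> carrier H \<Longrightarrow> hnorm K (T y v \<ominus>\<^bsub>K\<^esub> T x v) \<le> d * hnorm H v"
    using norm_continuous_onE[OF T x d(1)] by blast
  have "hnorm H (op_inv H K (T y) w \<ominus>\<^bsub>H\<^esub> op_inv H K (T x) w) \<le> e * hnorm K w"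
    if y: "y \<in> V" "y \<in> U" and w: "w \<in> carrier K" for y w
  proof -
    note bx = toplinear_iso_bij[OF iso[OF x]] and bij_y = toplinear_iso_bij[OF iso[OF y(2)]]
    note Tc = bounded_ops_closed[OF Tb[OF x]] bounded_ops_closed[OF Tb[OF y(2)]]
    have lower: "c / 2 * hnorm H v \<le> hnorm K (T y v)" if v: "v \<in> carrier H" for v
    proof -
      have "c * hnorm H v \<le> hnorm K (T x v)" using c v by simp
      also have "\<dots> \<le> hnorm K (T x v \<ominus>\<^bsub>K\<^esub> T y v) + hnorm K (T y v)"
        using hilbert_space.hnorm_le_diff[OF K] Tc v by blast
      also have "\<dots> \<le> d * hnorm H v + hnorm K (T y v)"
        using V(3)[OF y v] hilbert_space.hnorm_minus_commute[OF K, of "T x v" "T y v"] Tc v by simp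
      also have "\<dots> \<le> c / 2 * hnorm H v + hnorm K (T y v)"
        using mult_right_mono[OF d(2) hilbert_space.hnorm_ge_zero[OF H v]] by simp
      finally show ?thesis by simp
    qed
    define u where "u = op_inv H K (T y) w"
    define u' where "u' = op_inv H K (T x) w"
    have u: "u \<in> carrier H" "u' \<in> carrier H" "T y u = w" "T x u' = w"
      using op_inv_closed[OF bx w] op_inv_closed[OF bij_y w] op_inv_right[OF bx w] op_inv_right[OF bij_y w]
      by (simp_all add: u_def u'_def)
    have "c / 2 * hnorm H (u \<ominus>\<^bsub>H\<^esub> u') \<le> hnorm K (T y (u \<ominus>\<^bsub>H\<^esub> u'))"
      using lower u H by (simp add: hilbert_closed)
    also have "T y (u \<ominus>\<^bsub>H\<^esub> u') = T x u' \<ominus>\<^bsub>K\<^esub> T y u'"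
      using bounded_ops_diff[OF H K Tb[OF y(2)] u(1,2)] u by simp
    also have "hnorm K \<dots> \<le> d * hnorm H u'"
      using V(3)[OF y u(2)] hilbert_space.hnorm_minus_commute[OF K Tc(1)[OF u(2)] Tc(2)[OF u(2)]]
      by simp
    also have "\<dots> \<le> (e * c\<^sup>2 / 2) * hnorm H u'"
      by (rule mult_right_mono[OF d(3) hilbert_space.hnorm_ge_zero[OF H u(2)]])
    also have "\<dots> = c / 2 * (e * (c * hnorm H u'))" by (simp add: power2_eq_square)
    finally have "hnorm H (u \<ominus>\<^bsub>H\<^esub> u') \<le> e * (c * hnorm H u')" using c(1) by simp
    also have "\<dots> \<le> e * hnorm K w" using c(2)[OF u(2)] u(4) e by simp
    finally show ?thesis by (simp add: u_def u'_def)
  qed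
  then show "\<exists>W. openin M W \<and> x \<in> W \<and> (\<forall>y\<in>W \<inter> U. \<forall>w\<in>carrier K.
      hnorm H (op_inv H K (T y) w \<ominus>\<^bsub>H\<^esub> op_inv H K (T x) w) \<le> e * hnorm K w)"
    using V by (intro exI[of _ V]) auto
qed

lemma norm_continuous_on_restrict:
  assumes T: "norm_continuous_on M U H K T" and im: "\<And>x. x \<in> U \<Longrightarrow> T x ` C \<subseteq> D"
    and K: "hilbert_space K" and subC: "C \<subseteq> carrier H" and subD: "D \<subseteq> carrier K"
    and C: "hilbert_space (H\<lparr>carrier := C\<rparr>)" and D: "hilbert_space (K\<lparr>carrier := D\<rparr>)"
  shows "norm_continuous_on M U (H\<lparr>carrier := C\<rparr>) (K\<lparr>carrier := D\<rparr>) (\<lambda>x. restrict (T x) C)"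
proof (rule norm_continuous_onI)
  fix x assume x: "x \<in> U"
  show "restrict (T x) C \<in> bounded_ops (H\<lparr>carrier := C\<rparr>) (K\<lparr>carrier := D\<rparr>)"
    using bounded_ops_restrict[OF norm_continuous_on_bounded[OF T x] subC im[OF x] C] .
  fix e :: real assume e: "e > 0"
  obtain W where W: "openin M W" "x \<in> W"
    "\<And>y v. y \<in> W \<Longrightarrow> y \<in> U \<Longrightarrow> v \<in> carrier H \<Longrightarrow> hnorm K (T y v \<ominus>\<^bsub>K\<^esub> T x v) \<le> e * hnorm H v"
    using norm_continuous_onE[OF T x e] by blast
  have "hnorm K (T y v \<ominus>\<^bsub>K\<lparr>carrier := D\<rparr>\<^esub> T x v) \<le> e * hnorm H v"
    if "y \<in> W" "y \<in> U" "v \<in> C" for y v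
  proof -
    have "T y v \<in> D" "T x v \<in> D" using im x that by blast+
    from subspace_diff[OF K D subD this] show ?thesis using W(3) that subC by auto
  qed
  then show "\<exists>W. openin M W \<and> x \<in> W \<and> (\<forall>y\<in>W \<inter> U. \<forall>v\<in>carrier (H\<lparr>carrier := C\<rparr>).
      hnorm (K\<lparr>carrier := D\<rparr>) (restrict (T y) C v \<ominus>\<^bsub>K\<lparr>carrier := D\<rparr>\<^esub> restrict (T x) C v) \<le>
        e * hnorm (H\<lparr>carrier := C\<rparr>) v)"
    using W by (intro exI[of _ W]) auto
qed

section \<open>Hilbert space bundles\<close>

lemma toplinear_isoI_inverse:
  assumes A: "A \<in> bounded_ops H K" and B: "B \<in> bounded_ops K H"
    and BA: "\<And>x. x \<in> carrier H \<Longrightarrow> B (A x) = x" and AB: "\<And>y. y \<in> carrier K \<Longrightarrow> A (B y) = y"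
  shows "toplinear_iso H K A" and "op_inv H K A = B"
proof -
  have bij: "bij_betw A (carrier H) (carrier K)"
    by (rule bij_betw_byWitness[where f'=B])
      (use BA AB bounded_ops_closed[OF A] bounded_ops_closed[OF B] in auto)
  show inv: "op_inv H K A = B"
  proof (rule extensionalityI)
    show "op_inv H K A \<in> extensional (carrier K)" by (simp add: op_inv_def)
    show "B \<in> extensional (carrier K)" by (rule linear_ops_extensional[OF bounded_ops_linear[OF B]])
    show "op_inv H K A y = B y" if "y \<in> carrier K" for y
      using op_inv_left[OF bij bounded_ops_closed[OF B that]] AB[OF that] by simp
  qed
  show "toplinear_iso H K A" using A B bij inv by (simp add: toplinear_iso_def)
qed

lemma toplinear_iso_comp:
  assumes A: "toplinear_iso H K A" and B: "toplinear_iso K J B"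
    and H: "hilbert_space H" and K: "hilbert_space K" and J: "hilbert_space J"
  shows "toplinear_iso H J (op_comp H B A)"
    and "op_inv H J (op_comp H B A) = op_comp J (op_inv H K A) (op_inv K J B)"
proof -
  note a = op_inv_closed[OF toplinear_iso_bij[OF A]] op_inv_left[OF toplinear_iso_bij[OF A]]
    op_inv_right[OF toplinear_iso_bij[OF A]]
  note b = op_inv_closed[OF toplinear_iso_bij[OF B]] op_inv_left[OF toplinear_iso_bij[OF B]]
    op_inv_right[OF toplinear_iso_bij[OF B]]
  note c = op_comp_bounded[OF toplinear_iso_bounded[OF A] toplinear_iso_bounded[OF B] H K]
    op_comp_bounded[OF toplinear_iso_inv_bounded[OF B] toplinear_iso_inv_bounded[OF A] J K]
  have 1: "op_comp J (op_inv H K A) (op_inv K J B) (op_comp H B A x) = x" if "x \<in> carrier H" for x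
    using that a b bounded_ops_closed[OF toplinear_iso_bounded[OF A] that]
      bounded_ops_closed[OF toplinear_iso_bounded[OF B]] by (simp add: op_apply)
  have 2: "op_comp H B A (op_comp J (op_inv H K A) (op_inv K J B) y) = y" if "y \<in> carrier J" for y
    using that a b by (simp add: op_apply)
  show "toplinear_iso H J (op_comp H B A)"
    and "op_inv H J (op_comp H B A) = op_comp J (op_inv H K A) (op_inv K J B)"
    using toplinear_isoI_inverse[OF c] 1 2 by auto
qed

section \<open>Charts, local representatives and morphisms\<close>

lemma bundle_chartD:
  assumes "bundle_chart E (U, F, \<phi>)"
  shows chart_open: "openin (base E) U"
    and chart_model: "hilbert_space F"
    and chart_iso: "x \<in> U \<Longrightarrow> toplinear_iso (fibre E x) F (\<phi> x)"
    and chart_domain: "x \<in> U \<Longrightarrow> x \<in> topspace (base E)"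
    and chart_compatible: "c \<in> atlas E \<Longrightarrow> continuous_in_charts E E (U, F, \<phi>) c (bundle_id E)"
      "c \<in> atlas E \<Longrightarrow> continuous_in_charts E E c (U, F, \<phi>) (bundle_id E)"
  using assms openin_subset[of "base E" U] by (auto simp: bundle_chart_def)

lemma chart_apply:
  assumes "bundle_chart E (U, F, \<phi>)" "x \<in> U"
  shows chart_closed: "v \<in> carrier (fibre E x) \<Longrightarrow> \<phi> x v \<in> carrier F"
    and chart_inv_closed: "w \<in> carrier F \<Longrightarrow> op_inv (fibre E x) F (\<phi> x) w \<in> carrier (fibre E x)"
    and chart_left: "v \<in> carrier (fibre E x) \<Longrightarrow> op_inv (fibre E x) F (\<phi> x) (\<phi> x v) = v"
    and chart_right: "w \<in> carrier F \<Longrightarrow> \<phi> x (op_inv (fibre E x) F (\<phi> x) w) = w"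
proof -
  note iso = chart_iso[OF assms]
  note bij = toplinear_iso_bij[OF iso]
  show "v \<in> carrier (fibre E x) \<Longrightarrow> \<phi> x v \<in> carrier F"
    by (rule bounded_ops_closed[OF toplinear_iso_bounded[OF iso]])
  show "w \<in> carrier F \<Longrightarrow> op_inv (fibre E x) F (\<phi> x) w \<in> carrier (fibre E x)"
    by (rule op_inv_closed[OF bij])
  show "v \<in> carrier (fibre E x) \<Longrightarrow> op_inv (fibre E x) F (\<phi> x) (\<phi> x v) = v"
    by (rule op_inv_left[OF bij])
  show "w \<in> carrier F \<Longrightarrow> \<phi> x (op_inv (fibre E x) F (\<phi> x) w) = w"
    by (rule op_inv_right[OF bij])
qed

lemma continuous_in_charts_iff:
  "continuous_in_charts E E' (U, F, \<phi>) (V, K, \<psi>) a \<longleftrightarrow>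
    norm_continuous_on (base E) (U \<inter> V) F K (local_rep E E' (U, F, \<phi>) (V, K, \<psi>) a)"
  by (simp add: continuous_in_charts_def)

lemma local_rep_apply:
  "v \<in> carrier F \<Longrightarrow> local_rep E E' (U, F, \<phi>) (V, K, \<psi>) a x v =
    \<psi> x (a x (op_inv (fibre E x) F (\<phi> x) v))"
  by (simp add: local_rep_def)

lemma local_rep_comp:
  "local_rep E E' (U, F, \<phi>) (V, K, \<psi>) a x =
    op_comp F (\<psi> x) (op_comp F (a x) (op_inv (fibre E x) F (\<phi> x)))"
  by (auto simp: local_rep_def op_comp_def compose_def)

lemma local_rep_bounded:
  assumes "bundle_chart E (U, F, \<phi>)" "bundle_chart E' (V, K, \<psi>)" "x \<in> U" "x \<in> V"
    and "a x \<in> bounded_ops (fibre E x) (fibre E' x)"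
    and "hilbert_space (fibre E x)" "hilbert_space (fibre E' x)"
  shows "local_rep E E' (U, F, \<phi>) (V, K, \<psi>) a x \<in> bounded_ops F K"
  unfolding local_rep_comp
  using op_comp_bounded[OF op_comp_bounded[OF
    toplinear_iso_inv_bounded[OF chart_iso[OF assms(1,3)]] assms(5) chart_model[OF assms(1)] assms(6)]
      toplinear_iso_bounded[OF chart_iso[OF assms(2,4)]] chart_model[OF assms(1)] assms(7)] .

lemma local_rep_extensional: "local_rep E E' (U, F, \<phi>) (V, K, \<psi>) a x \<in> extensional (carrier F)"
  by (simp add: local_rep_def)

lemma op_comp_extensional: "op_comp F B A \<in> extensional (carrier F)"
  by (simp add: op_comp_def compose_def)

lemma bundle_id_apply:
  "x \<in> topspace (base E) \<Longrightarrow> v \<in> carrier (fibre E x) \<Longrightarrow> bundle_id E x v = v"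
  by (simp add: bundle_id_def op_id_def)

lemma bundle_morphismsD:
  assumes "a \<in> bundle_morphisms E E'"
  shows bundle_morphisms_bounded: "x \<in> topspace (base E) \<Longrightarrow> a x \<in> bounded_ops (fibre E x) (fibre E' x)"
    and bundle_morphisms_base: "base E = base E'"
    and bundle_morphisms_continuous:
      "c \<in> atlas E \<Longrightarrow> c' \<in> atlas E' \<Longrightarrow> continuous_in_charts E E' c c' a"
  using assms by (auto simp: bundle_morphisms_def PiE_def)

lemma bundle_morphisms_closed:
  assumes "a \<in> bundle_morphisms E E'" "x \<in> topspace (base E)" "v \<in> carrier (fibre E x)"
  shows "a x v \<in> carrier (fibre E' x)"
  using bounded_ops_closed[OF bundle_morphisms_bounded[OF assms(1,2)] assms(3)] .

text \<open>Continuity of the identity in two atlas charts is precisely their compatibility, which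
  is part of being a \<open>bundle_chart\<close>.\<close>

lemma bundle_id_morphism:
  assumes "hilbert_bundle E"
  shows "bundle_id E \<in> bundle_morphisms E E"
proof -
  interpret hilbert_bundle E by fact
  have "continuous_in_charts E E c c' (bundle_id E)" if "c \<in> atlas E" "c' \<in> atlas E" for c c'
    using chart_compatible(1)[of E "fst c" "fst (snd c)" "snd (snd c)" c'] atlas_charts that by simp
  then show ?thesis
    by (auto simp: bundle_morphisms_def bundle_id_def intro!: op_id_bounded fibre_hilbert)
qed

text \<open>Near each point the local representative factors as a transition into an atlas chart of
  \<open>E\<close>, the representative of \<open>a\<close> in atlas charts, and a transition out of
  an atlas chart of \<open>E'\<close>. The extension to all bundle charts is needed because the
  charts of a range bundle are restrictions of such charts.\<close>

lemma morphism_continuous_in_bundle_charts: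
  assumes E: "hilbert_bundle E" and E': "hilbert_bundle E'" and a: "a \<in> bundle_morphisms E E'"
    and c: "bundle_chart E (U, F, \<phi>)" and c': "bundle_chart E' (V, K, \<psi>)"
  shows "continuous_in_charts E E' (U, F, \<phi>) (V, K, \<psi>) a"
  unfolding continuous_in_charts_iff
proof (rule norm_continuous_on_local)
  interpret E: hilbert_bundle E by fact
  interpret E': hilbert_bundle E' by fact
  note base = bundle_morphisms_base[OF a]
  fix x assume x: "x \<in> U \<inter> V"
  then have "x \<in> topspace (base E)" using chart_domain[OF c] by blast
  then obtain U1 F1 \<phi>1 where c1: "(U1, F1, \<phi>1) \<in> atlas E" "x \<in> U1" using E.atlas_covers by blast
  obtain V1 K1 \<psi>1 where c1': "(V1, K1, \<psi>1) \<in> atlas E'" "x \<in> V1"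
    using \<open>x \<in> topspace (base E)\<close> E'.atlas_covers[of x] unfolding base by blast
  note b1 = E.atlas_charts[OF c1(1)] and b1' = E'.atlas_charts[OF c1'(1)]
  let ?W = "(U1 \<inter> V1) \<inter> (U \<inter> V)"
  let ?f = "local_rep E E (U, F, \<phi>) (U1, F1, \<phi>1) (bundle_id E)"
  let ?g = "local_rep E E' (U1, F1, \<phi>1) (V1, K1, \<psi>1) a"
  let ?h = "local_rep E' E' (V1, K1, \<psi>1) (V, K, \<psi>) (bundle_id E')"
  have f: "norm_continuous_on (base E) ?W F F1 ?f"
    using chart_compatible(1)[OF c c1(1)] unfolding continuous_in_charts_iff
    by (rule norm_continuous_on_subset) blast
  have g: "norm_continuous_on (base E) ?W F1 K1 ?g"
    using bundle_morphisms_continuous[OF a c1(1) c1'(1)] unfolding continuous_in_charts_iff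
    by (rule norm_continuous_on_subset) blast
  have h: "norm_continuous_on (base E) ?W K1 K ?h"
    using chart_compatible(2)[OF c' c1'(1)] unfolding continuous_in_charts_iff base
    by (rule norm_continuous_on_subset) blast
  have "norm_continuous_on (base E) ?W F K (\<lambda>y. op_comp F (?h y) (op_comp F (?g y) (?f y)))"
    by (intro norm_continuous_on_comp[OF norm_continuous_on_comp[OF f g] h]
        chart_model[OF c] chart_model[OF b1] chart_model[OF b1'] chart_model[OF c'])
  moreover have "op_comp F (?h y) (op_comp F (?g y) (?f y)) = local_rep E E' (U, F, \<phi>) (V, K, \<psi>) a y"
    if y: "y \<in> ?W" for y
  proof (rule extensionalityI[OF op_comp_extensional local_rep_extensional])
    fix v assume v: "v \<in> carrier F"
    have yU: "y \<in> U" "y \<in> U1" "y \<in> V" "y \<in> V1" using y by auto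
    have yt: "y \<in> topspace (base E)" "y \<in> topspace (base E')"
      using chart_domain[OF c yU(1)] base by auto
    let ?w = "op_inv (fibre E y) F (\<phi> y) v"
    have w: "?w \<in> carrier (fibre E y)" by (rule chart_inv_closed[OF c yU(1) v])
    have aw: "a y ?w \<in> carrier (fibre E' y)" by (rule bundle_morphisms_closed[OF a yt(1) w])
    show "op_comp F (?h y) (op_comp F (?g y) (?f y)) v = local_rep E E' (U, F, \<phi>) (V, K, \<psi>) a y v"
      using v w aw yt chart_closed[OF b1 yU(2) w] chart_left[OF b1 yU(2) w]
        chart_closed[OF b1' yU(4) aw] chart_left[OF b1' yU(4) aw]
      by (simp add: op_apply local_rep_apply bundle_id_apply)
  qed
  ultimately have "norm_continuous_on (base E) ?W F K (local_rep E E' (U, F, \<phi>) (V, K, \<psi>) a)"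
    by (rule norm_continuous_on_cong)
  moreover have "openin (base E) (U1 \<inter> V1)"
    using chart_open[OF b1] chart_open[OF b1'] base by (simp add: openin_Int)
  ultimately show "\<exists>W. openin (base E) W \<and> x \<in> W \<and>
      norm_continuous_on (base E) (W \<inter> (U \<inter> V)) F K (local_rep E E' (U, F, \<phi>) (V, K, \<psi>) a)"
    using c1(2) c1'(2) by blast
qed

lemma mor_comp_apply:
  "x \<in> topspace (base E) \<Longrightarrow> v \<in> carrier (fibre E x) \<Longrightarrow> mor_comp E b a x v = b x (a x v)"
  by (simp add: mor_comp_def op_apply)

lemma mor_comp_eq_idI:
  assumes "\<And>x v. x \<in> topspace (base E) \<Longrightarrow> v \<in> carrier (fibre E x) \<Longrightarrow> b x (a x v) = v"
  shows "mor_comp E b a = bundle_id E"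
  using assms
  by (auto simp: mor_comp_def bundle_id_def op_comp_def compose_def op_id_def fun_eq_iff restrict_def)

text \<open>Local representatives of the fibrewise inverse are the inverses of the local
  representatives of \<open>a\<close>, hence norm-continuous by
  \<open>norm_continuous_on_inverse\<close>. This turns ellipticity into a condition on single
  fibres, with constants that may vary over the base.\<close>

lemma bundle_iso_iff_fibrewise:
  assumes E: "hilbert_bundle E" and E': "hilbert_bundle E'" and a: "a \<in> bundle_morphisms E E'"
  shows "bundle_iso E E' a \<longleftrightarrow>
    (\<forall>x\<in>topspace (base E). toplinear_iso (fibre E x) (fibre E' x) (a x))"
proof
  assume "bundle_iso E E' a"
  then obtain b where b: "b \<in> bundle_morphisms E' E" "mor_comp E b a = bundle_id E"
    "mor_comp E' a b = bundle_id E'"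
    by (auto simp: bundle_iso_def)
  show "\<forall>x\<in>topspace (base E). toplinear_iso (fibre E x) (fibre E' x) (a x)"
  proof
    fix x assume x: "x \<in> topspace (base E)"
    then have x': "x \<in> topspace (base E')" using bundle_morphisms_base[OF a] by simp
    show "toplinear_iso (fibre E x) (fibre E' x) (a x)"
    proof (rule toplinear_isoI_inverse(1))
      show "b x (a x v) = v" if "v \<in> carrier (fibre E x)" for v
        using mor_comp_apply[OF x that, of b a] bundle_id_apply[OF x that] b(2) by simp
      show "a x (b x v) = v" if "v \<in> carrier (fibre E' x)" for v
        using mor_comp_apply[OF x' that, of a b] bundle_id_apply[OF x' that] b(3) by simp
    qed (rule bundle_morphisms_bounded[OF a x], rule bundle_morphisms_bounded[OF b(1) x'])
  qed
next
  interpret E: hilbert_bundle E by fact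
  interpret E': hilbert_bundle E' by fact
  note base = bundle_morphisms_base[OF a]
  assume iso: "\<forall>x\<in>topspace (base E). toplinear_iso (fibre E x) (fibre E' x) (a x)"
  define b where "b = (\<lambda>x\<in>topspace (base E). op_inv (fibre E x) (fibre E' x) (a x))"
  have bij: "bij_betw (a x) (carrier (fibre E x)) (carrier (fibre E' x))" if "x \<in> topspace (base E)" for x
    using iso that toplinear_iso_bij by blast
  have bb: "b x \<in> bounded_ops (fibre E' x) (fibre E x)" if "x \<in> topspace (base E)" for x
    using iso that toplinear_iso_inv_bounded unfolding b_def by auto
  have ba: "b x (a x v) = v" if "x \<in> topspace (base E)" "v \<in> carrier (fibre E x)" for x v
    using op_inv_left[OF bij] that by (simp add: b_def)
  have ab: "a x (b x v) = v" if "x \<in> topspace (base E)" "v \<in> carrier (fibre E' x)" for x v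
    using op_inv_right[OF bij] that by (simp add: b_def)
  have cont: "continuous_in_charts E' E (V, K, \<psi>) (U, F, \<phi>) b"
    if c: "(U, F, \<phi>) \<in> atlas E" and c': "(V, K, \<psi>) \<in> atlas E'" for U F \<phi> V K \<psi>
  proof -
    note h = E.atlas_charts[OF c] and h' = E'.atlas_charts[OF c']
    let ?A = "local_rep E E' (U, F, \<phi>) (V, K, \<psi>) a"
    let ?B = "local_rep E' E (V, K, \<psi>) (U, F, \<phi>) b"
    have inv: "toplinear_iso F K (?A x) \<and> op_inv F K (?A x) = ?B x" if x: "x \<in> U \<inter> V" for x
    proof -
      have xU: "x \<in> U" "x \<in> V" using x by auto
      have xt: "x \<in> topspace (base E)" "x \<in> topspace (base E')"
        using chart_domain[OF h xU(1)] base by auto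
      note H = E.fibre_hilbert[OF xt(1)] E'.fibre_hilbert[OF xt(2)]
      have A: "?A x \<in> bounded_ops F K"
        by (rule local_rep_bounded[where a=a, OF h h' xU bundle_morphisms_bounded[OF a xt(1)] H])
      have B: "?B x \<in> bounded_ops K F"
        by (rule local_rep_bounded[where a=b, OF h' h xU(2,1) bb[OF xt(1)] H(2,1)])
      have "?B x (?A x v) = v" if v: "v \<in> carrier F" for v
      proof -
        have w: "op_inv (fibre E x) F (\<phi> x) v \<in> carrier (fibre E x)" by (rule chart_inv_closed[OF h xU(1) v])
        note aw = bundle_morphisms_closed[OF a xt(1) w]
        show ?thesis
          using v aw w chart_closed[OF h' xU(2) aw] chart_left[OF h' xU(2) aw] chart_right[OF h xU(1) v]
          by (simp add: local_rep_apply ba[OF xt(1)])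
      qed
      moreover have "?A x (?B x v) = v" if v: "v \<in> carrier K" for v
      proof -
        have w: "op_inv (fibre E' x) K (\<psi> x) v \<in> carrier (fibre E' x)" by (rule chart_inv_closed[OF h' xU(2) v])
        note bw = bounded_ops_closed[OF bb[OF xt(1)] w]
        show ?thesis
          using v bw w chart_closed[OF h xU(1) bw] chart_left[OF h xU(1) bw] chart_right[OF h' xU(2) v]
          by (simp add: local_rep_apply ab[OF xt(1)])
      qed
      ultimately show ?thesis using toplinear_isoI_inverse[OF A B] by blast
    qed
    have "norm_continuous_on (base E) (U \<inter> V) K F (\<lambda>x. op_inv F K (?A x))"
      using norm_continuous_on_inverse[OF _ _ chart_model[OF h] chart_model[OF h']]
        bundle_morphisms_continuous[OF a c c'] inv unfolding continuous_in_charts_iff by blast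
    then have "norm_continuous_on (base E) (U \<inter> V) K F ?B"
      by (rule norm_continuous_on_cong) (use inv in blast)
    then show ?thesis unfolding continuous_in_charts_iff by (simp add: Int_commute base)
  qed
  have "b \<in> bundle_morphisms E' E"
    using bb cont base by (auto simp: bundle_morphisms_def b_def)
  moreover have "mor_comp E b a = bundle_id E" using ba by (rule mor_comp_eq_idI)
  moreover have "mor_comp E' a b = bundle_id E'" by (rule mor_comp_eq_idI) (use ab base in simp)
  ultimately show "bundle_iso E E' a" using a by (auto simp: bundle_iso_def)
qed

text \<open>The transitions to atlas charts change by composition with \<open>S x\<close> or its
  inverse, and both families are norm-continuous. With a suitable \<open>S\<close> this straightens
  a projection whose range varies within the model space.\<close>

lemma bundle_chart_twist:
  assumes E: "hilbert_bundle E" and c: "bundle_chart E (U, F, \<phi>)"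
    and V: "openin (base E) V" "V \<subseteq> U"
    and S: "norm_continuous_on (base E) V F F S" and iso: "\<And>x. x \<in> V \<Longrightarrow> toplinear_iso F F (S x)"
  shows "bundle_chart E (V, F, \<lambda>x. op_comp (fibre E x) (S x) (\<phi> x))"
proof -
  interpret hilbert_bundle E by fact
  note F = chart_model[OF c]
  let ?\<psi> = "\<lambda>x. op_comp (fibre E x) (S x) (\<phi> x)"
  have VU: "x \<in> U" if "x \<in> V" for x using that V(2) by blast
  have fib: "hilbert_space (fibre E x)" if "x \<in> V" for x
    using fibre_hilbert chart_domain[OF c VU[OF that]] by blast
  note comp = toplinear_iso_comp[OF chart_iso[OF c VU] iso fib F F]
  have "continuous_in_charts E E (V, F, ?\<psi>) d (bundle_id E) \<and>
      continuous_in_charts E E d (V, F, ?\<psi>) (bundle_id E)" if d: "d \<in> atlas E" for d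
  proof -
    obtain U1 F1 \<phi>1 where d': "d = (U1, F1, \<phi>1)" by (cases d)
    note c1 = atlas_charts[OF d[unfolded d']]
    note F1 = chart_model[OF c1]
    let ?f = "local_rep E E (U, F, \<phi>) (U1, F1, \<phi>1) (bundle_id E)"
    let ?g = "local_rep E E (U1, F1, \<phi>1) (U, F, \<phi>) (bundle_id E)"
    have S': "norm_continuous_on (base E) (V \<inter> U1) F F S"
      using S by (rule norm_continuous_on_subset) blast
    have f: "norm_continuous_on (base E) (V \<inter> U1) F F1 ?f"
      using chart_compatible(1)[OF c d] V(2) unfolding d' continuous_in_charts_iff
      by (elim norm_continuous_on_subset) blast
    have g: "norm_continuous_on (base E) (V \<inter> U1) F1 F ?g"
      using chart_compatible(2)[OF c d] V(2) unfolding d' continuous_in_charts_iff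
      by (elim norm_continuous_on_subset) blast
    have "norm_continuous_on (base E) (V \<inter> U1) F F1 (\<lambda>x. op_comp F (?f x) (op_inv F F (S x)))"
      using norm_continuous_on_comp[OF norm_continuous_on_inverse[OF S' iso F F] f F F F1] by blast
    moreover have "op_comp F (?f x) (op_inv F F (S x)) =
        local_rep E E (V, F, ?\<psi>) (U1, F1, \<phi>1) (bundle_id E) x" if x: "x \<in> V \<inter> U1" for x
    proof (rule extensionalityI[OF op_comp_extensional local_rep_extensional])
      fix v assume v: "v \<in> carrier F"
      have xV: "x \<in> V" using x by blast
      show "op_comp F (?f x) (op_inv F F (S x)) v =
          local_rep E E (V, F, ?\<psi>) (U1, F1, \<phi>1) (bundle_id E) x v"
        using v op_inv_closed[OF toplinear_iso_bij[OF iso[OF xV]] v]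
        by (simp add: op_apply local_rep_apply comp(2)[OF xV xV xV])
    qed
    ultimately have 1: "continuous_in_charts E E (V, F, ?\<psi>) d (bundle_id E)"
      unfolding d' continuous_in_charts_iff by (rule norm_continuous_on_cong)
    have "norm_continuous_on (base E) (V \<inter> U1) F1 F (\<lambda>x. op_comp F1 (S x) (?g x))"
      by (rule norm_continuous_on_comp[OF g S' F1 F F])
    moreover have "op_comp F1 (S x) (?g x) =
        local_rep E E (U1, F1, \<phi>1) (V, F, ?\<psi>) (bundle_id E) x" if x: "x \<in> V \<inter> U1" for x
    proof (rule extensionalityI[OF op_comp_extensional local_rep_extensional])
      fix v assume v: "v \<in> carrier F1"
      have xU: "x \<in> U1" "x \<in> topspace (base E)" using x chart_domain[OF c1] by auto
      show "op_comp F1 (S x) (?g x) v = local_rep E E (U1, F1, \<phi>1) (V, F, ?\<psi>) (bundle_id E) x v"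
        using v chart_inv_closed[OF c1 xU(1) v] xU(2)
        by (simp add: op_apply local_rep_apply bundle_id_apply)
    qed
    ultimately have "norm_continuous_on (base E) (V \<inter> U1) F1 F
        (local_rep E E (U1, F1, \<phi>1) (V, F, ?\<psi>) (bundle_id E))"
      by (rule norm_continuous_on_cong)
    then have "continuous_in_charts E E d (V, F, ?\<psi>) (bundle_id E)"
      unfolding d' continuous_in_charts_iff by (simp add: Int_commute)
    with 1 show ?thesis by blast
  qed
  then show ?thesis
    using V F comp(1) unfolding bundle_chart_def by simp
qed

text \<open>The bundle axioms provide continuity of the metric in atlas charts, whereas the charts
  of a range bundle come from the maximal atlas. The metric in the chart \<open>\<phi>\<close> is
  the metric in an atlas chart \<open>\<eta>\<close> pulled back by the transition \<open>T\<close>,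
  which is itself norm-continuous.\<close>

lemma metric_continuous_in_bundle_chart:
  assumes E: "hilbert_bundle E" and c: "bundle_chart E (U, F, \<phi>)" and x: "x \<in> U" and e: "e > 0"
  shows "\<exists>W. openin (base E) W \<and> x \<in> W \<and> (\<forall>y\<in>W \<inter> U. \<forall>u\<in>carrier F. \<forall>v\<in>carrier F.
    cmod (cinner (fibre E y) (op_inv (fibre E y) F (\<phi> y) u) (op_inv (fibre E y) F (\<phi> y) v) -
          cinner (fibre E x) (op_inv (fibre E x) F (\<phi> x) u) (op_inv (fibre E x) F (\<phi> x) v))
      \<le> e * hnorm F u * hnorm F v)"
proof -
  interpret hilbert_bundle E by fact
  have xt: "x \<in> topspace (base E)" by (rule chart_domain[OF c x])
  then obtain U1 K \<eta> where c1: "(U1, K, \<eta>) \<in> atlas E" "x \<in> U1" using atlas_covers by blast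
  note b1 = atlas_charts[OF c1(1)]
  note F = chart_model[OF c] and K = chart_model[OF b1]
  note H = fibre_hilbert[OF xt]
  define T where "T = local_rep E E (U, F, \<phi>) (U1, K, \<eta>) (bundle_id E)"
  have T: "norm_continuous_on (base E) (U \<inter> U1) F K T"
    using chart_compatible(1)[OF c c1(1)] unfolding continuous_in_charts_iff T_def .
  note Tb = norm_continuous_on_bounded[OF T]
  have xx: "x \<in> U \<inter> U1" using x c1(2) by blast
  define i where "i y = op_inv (fibre E y) K (\<eta> y)" for y
  have iT: "op_inv (fibre E y) F (\<phi> y) u = i y (T y u)" if "y \<in> U \<inter> U1" "u \<in> carrier F" for y u
  proof -
    have y: "y \<in> U" "y \<in> U1" "y \<in> topspace (base E)" using that chart_domain[OF c] by auto
    note w = chart_inv_closed[OF c y(1) that(2)]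
    show ?thesis
      using that(2) w y(3) chart_left[OF b1 y(2) w] by (simp add: T_def i_def local_rep_apply bundle_id_apply)
  qed
  have ib: "i x \<in> bounded_ops K (fibre E x)"
    unfolding i_def by (rule toplinear_iso_inv_bounded[OF chart_iso[OF b1 c1(2)]])
  obtain b where b: "b > 0" "\<And>s. s \<in> carrier K \<Longrightarrow> hnorm (fibre E x) (i x s) \<le> b * hnorm K s"
    using bounded_opsE[OF K ib] by blast
  obtain t where t: "t > 0" "\<And>u. u \<in> carrier F \<Longrightarrow> hnorm K (T x u) \<le> t * hnorm F u"
    using bounded_opsE[OF F Tb[OF xx]] by blast
  let ?h = "\<lambda>y s r. cinner (fibre E y) (i y s) (i y r)"
  have hb: "cmod (?h x s r) \<le> b\<^sup>2 * (p * q)"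
    if "s \<in> carrier K" "r \<in> carrier K" "hnorm K s \<le> p" "hnorm K r \<le> q" for s r p q
  proof -
    have "cmod (?h x s r) \<le> hnorm (fibre E x) (i x s) * hnorm (fibre E x) (i x r)"
      using hilbert_space.Cauchy_Schwarz[OF H] bounded_ops_closed[OF ib] that by blast
    also have "\<dots> \<le> (b * p) * (b * q)"
    proof (rule mult_mono)
      have "b * hnorm K s \<le> b * p" "b * hnorm K r \<le> b * q" using that b(1) by simp_all
      then show "hnorm (fibre E x) (i x s) \<le> b * p" "hnorm (fibre E x) (i x r) \<le> b * q"
        using b(2) that by fastforce+
      have "0 \<le> p" using hilbert_space.hnorm_ge_zero[OF K that(1)] that(3) by linarith
      then show "0 \<le> b * p" using b(1) by simp
      show "0 \<le> hnorm (fibre E x) (i x r)"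
        by (rule hilbert_space.hnorm_ge_zero[OF H bounded_ops_closed[OF ib that(2)]])
    qed
    finally show ?thesis by (simp add: power2_eq_square mult_ac)
  qed
  \<comment> \<open>The first summand belongs to the change of the metric from \<open>x\<close> to
    \<open>y\<close>, with both arguments bounded by \<open>t + 1\<close>. The second belongs to the
    changes of \<open>T\<close> in the two arguments, each contributing
    \<open>b\<^sup>2 * (t + 1)\<close>.\<close>
  define Q where "Q = (t + 1)\<^sup>2 + 2 * b\<^sup>2 * (t + 1)"
  have Q: "Q > 0" using t(1) by (simp add: Q_def add_pos_nonneg)
  define d where "d = min 1 (e / Q)"
  have d: "d > 0" "d \<le> 1" using e Q by (auto simp: d_def)
  have "d * Q \<le> e / Q * Q" using Q by (intro mult_right_mono) (auto simp: d_def)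
  then have dQ: "d * Q \<le> e" using Q by simp
  obtain W1 where W1: "openin (base E) W1" "x \<in> W1"
    "\<And>y u. y \<in> W1 \<Longrightarrow> y \<in> U \<inter> U1 \<Longrightarrow> u \<in> carrier F \<Longrightarrow> hnorm K (T y u \<ominus>\<^bsub>K\<^esub> T x u) \<le> d * hnorm F u"
    using norm_continuous_onE[OF T xx d(1)] by blast
  obtain W2 where W2: "openin (base E) W2" "x \<in> W2"
    "\<And>y s r. y \<in> W2 \<inter> U1 \<Longrightarrow> s \<in> carrier K \<Longrightarrow> r \<in> carrier K \<Longrightarrow>
      cmod (?h y s r - ?h x s r) \<le> d * hnorm K s * hnorm K r"
    using metric_continuous[OF c1 d(1)] unfolding i_def by blast
  have main: "cmod (?h y (T y u) (T y v) - ?h x (T x u) (T x v)) \<le> e * hnorm F u * hnorm F v"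
    if y: "y \<in> W1" "y \<in> W2" "y \<in> U \<inter> U1" and u: "u \<in> carrier F" and v: "v \<in> carrier F" for y u v
  proof -
    note nn = hilbert_space.hnorm_ge_zero[OF F u] hilbert_space.hnorm_ge_zero[OF F v]
    have cl: "T y w \<in> carrier K" "T x w \<in> carrier K" "T y w \<ominus>\<^bsub>K\<^esub> T x w \<in> carrier K"
      if "w \<in> carrier F" for w
      using bounded_ops_closed[OF Tb[OF y(3)] that] bounded_ops_closed[OF Tb[OF xx] that] K
      by (simp_all add: hilbert_closed)
    have ty: "hnorm K (T y w) \<le> (t + 1) * hnorm F w" if w: "w \<in> carrier F" for w
    proof -
      have "hnorm K (T y w) \<le> hnorm K (T y w \<ominus>\<^bsub>K\<^esub> T x w) + hnorm K (T x w)"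
        by (rule hilbert_space.hnorm_le_diff[OF K cl(1,2)[OF w]])
      also have "\<dots> \<le> d * hnorm F w + t * hnorm F w"
        using W1(3)[OF y(1,3) w] t(2)[OF w] by linarith
      also have "\<dots> \<le> 1 * hnorm F w + t * hnorm F w"
        using mult_right_mono[OF d(2) hilbert_space.hnorm_ge_zero[OF F w]] by linarith
      finally show ?thesis by (simp add: algebra_simps)
    qed
    have tx: "hnorm K (T x w) \<le> (t + 1) * hnorm F w" if w: "w \<in> carrier F" for w
      using t(2)[OF w] hilbert_space.hnorm_ge_zero[OF F w] by (simp add: algebra_simps)
    have ix: "i x (T y w \<ominus>\<^bsub>K\<^esub> T x w) = i x (T y w) \<ominus>\<^bsub>fibre E x\<^esub> i x (T x w)"
      if "w \<in> carrier F" for w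
      by (rule bounded_ops_diff[OF K H ib cl(1,2)[OF that]])
    \<comment> \<open>The form is varied first with its arguments fixed at \<open>T y\<close>, and
      then one argument at a time in the form at \<open>x\<close>.\<close>
    have "?h y (T y u) (T y v) - ?h x (T x u) (T x v) =
        (?h y (T y u) (T y v) - ?h x (T y u) (T y v)) +
        (?h x (T y u \<ominus>\<^bsub>K\<^esub> T x u) (T y v) + ?h x (T x u) (T y v \<ominus>\<^bsub>K\<^esub> T x v))"
      using bounded_ops_closed[OF ib cl(1)[OF u]] bounded_ops_closed[OF ib cl(1)[OF v]]
        bounded_ops_closed[OF ib cl(2)[OF u]] bounded_ops_closed[OF ib cl(2)[OF v]]
      by (simp add: ix[OF u] ix[OF v] hilbert_space.cinner_diff_left[OF H] hilbert_space.cinner_diff_right[OF H])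
    then have "cmod (?h y (T y u) (T y v) - ?h x (T x u) (T x v)) \<le>
        cmod (?h y (T y u) (T y v) - ?h x (T y u) (T y v)) +
        (cmod (?h x (T y u \<ominus>\<^bsub>K\<^esub> T x u) (T y v)) + cmod (?h x (T x u) (T y v \<ominus>\<^bsub>K\<^esub> T x v)))"
      using norm_triangle_ineq norm_triangle_le add_left_mono by metis
    moreover have "cmod (?h y (T y u) (T y v) - ?h x (T y u) (T y v)) \<le>
        d * ((t + 1) * hnorm F u) * ((t + 1) * hnorm F v)"
    proof -
      have "cmod (?h y (T y u) (T y v) - ?h x (T y u) (T y v)) \<le> d * hnorm K (T y u) * hnorm K (T y v)"
        using W2(3) y(2,3) cl(1)[OF u] cl(1)[OF v] by blast
      also have "\<dots> \<le> d * ((t + 1) * hnorm F u) * ((t + 1) * hnorm F v)"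
        using ty[OF u] ty[OF v] d(1) nn t(1)
          hilbert_space.hnorm_ge_zero[OF K cl(1)[OF u]] hilbert_space.hnorm_ge_zero[OF K cl(1)[OF v]]
        by (intro mult_mono mult_left_mono) auto
      finally show ?thesis .
    qed
    moreover have "cmod (?h x (T y u \<ominus>\<^bsub>K\<^esub> T x u) (T y v)) \<le>
        b\<^sup>2 * ((d * hnorm F u) * ((t + 1) * hnorm F v))"
      by (rule hb[OF cl(3)[OF u] cl(1)[OF v] W1(3)[OF y(1,3) u] ty[OF v]])
    moreover have "cmod (?h x (T x u) (T y v \<ominus>\<^bsub>K\<^esub> T x v)) \<le>
        b\<^sup>2 * (((t + 1) * hnorm F u) * (d * hnorm F v))"
      by (rule hb[OF cl(2)[OF u] cl(3)[OF v] tx[OF u] W1(3)[OF y(1,3) v]])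
    ultimately have "cmod (?h y (T y u) (T y v) - ?h x (T x u) (T x v)) \<le>
        d * ((t + 1) * hnorm F u) * ((t + 1) * hnorm F v) +
        (b\<^sup>2 * ((d * hnorm F u) * ((t + 1) * hnorm F v)) +
         b\<^sup>2 * (((t + 1) * hnorm F u) * (d * hnorm F v)))"
      by linarith
    also have "\<dots> = (d * Q) * (hnorm F u * hnorm F v)"
      by (simp add: Q_def algebra_simps power2_eq_square)
    also have "\<dots> \<le> e * (hnorm F u * hnorm F v)"
      using dQ nn by (intro mult_right_mono) auto
    finally show ?thesis by (simp add: mult.assoc)
  qed
  show ?thesis
  proof (intro exI conjI ballI)
    show "openin (base E) (W1 \<inter> W2 \<inter> U1)"
      using W1(1) W2(1) chart_open[OF b1] by (simp add: openin_Int)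
    show "x \<in> W1 \<inter> W2 \<inter> U1" using W1(2) W2(2) c1(2) by blast
    fix y u v assume y: "y \<in> W1 \<inter> W2 \<inter> U1 \<inter> U" and u: "u \<in> carrier F" and v: "v \<in> carrier F"
    then have y': "y \<in> U \<inter> U1" by blast
    show "cmod (cinner (fibre E y) (op_inv (fibre E y) F (\<phi> y) u) (op_inv (fibre E y) F (\<phi> y) v) -
          cinner (fibre E x) (op_inv (fibre E x) F (\<phi> x) u) (op_inv (fibre E x) F (\<phi> x) v))
        \<le> e * hnorm F u * hnorm F v"
      unfolding iT[OF y' u] iT[OF y' v] iT[OF xx u] iT[OF xx v]
      using main y' y u v by blast
  qed
qed

section \<open>Range bundles of projections\<close>

text \<open>The instance in view is the symbol of a projection in \<open>L 0\<close>: it is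
  idempotent, but in general not self-adjoint.\<close>

locale bundle_projection = hilbert_bundle E for E :: "('x, 'e) hbundle" +
  fixes p :: "'x \<Rightarrow> 'e \<Rightarrow> 'e"
  assumes morphism: "p \<in> bundle_morphisms E E"
    and idem: "x \<in> topspace (base E) \<Longrightarrow> v \<in> carrier (fibre E x) \<Longrightarrow> p x (p x v) = p x v"
begin

lemma p_closed: "x \<in> topspace (base E) \<Longrightarrow> v \<in> carrier (fibre E x) \<Longrightarrow> p x v \<in> carrier (fibre E x)"
  by (rule bundle_morphisms_closed[OF morphism])

lemma base_range [simp]: "base (range_bundle E p) = base E"
  by (simp add: range_bundle_def)

lemma fibre_range: "fibre (range_bundle E p) x = (fibre E x)\<lparr>carrier := p x ` carrier (fibre E x)\<rparr>"
  by (simp add: range_bundle_def range_space_def)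

lemma fibre_range_hilbert:
  "x \<in> topspace (base E) \<Longrightarrow> hilbert_space ((fibre E x)\<lparr>carrier := p x ` carrier (fibre E x)\<rparr>)"
  using hilbert_space_range[OF fibre_hilbert bundle_morphisms_bounded[OF morphism]] idem
  by (simp add: range_space_def)

lemma range_iff:
  "x \<in> topspace (base E) \<Longrightarrow>
    v \<in> p x ` carrier (fibre E x) \<longleftrightarrow> v \<in> carrier (fibre E x) \<and> p x v = v"
  using idem p_closed by (auto simp: image_iff) metis

lemma range_subset: "x \<in> topspace (base E) \<Longrightarrow> p x ` carrier (fibre E x) \<subseteq> carrier (fibre E x)"
  using p_closed by auto

lemma range_atlasE:
  assumes "c \<in> atlas (range_bundle E p)"
  obtains U C F \<phi> where "c = (U, F\<lparr>carrier := C\<rparr>, \<lambda>x. restrict (\<phi> x) (p x ` carrier (fibre E x)))"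
    "bundle_chart E (U, F, \<phi>)" "C \<subseteq> carrier F" "hilbert_space (F\<lparr>carrier := C\<rparr>)"
    "\<forall>x\<in>U. \<phi> x ` (p x ` carrier (fibre E x)) = C"
  using assms unfolding range_bundle_def by auto

lemma range_chart_inverse:
  assumes "bundle_chart E (U, F, \<phi>)" "\<phi> x ` (p x ` carrier (fibre E x)) = C" "x \<in> U"
  shows "op_inv (fibre (range_bundle E p) x) (F\<lparr>carrier := C\<rparr>)
      (restrict (\<phi> x) (p x ` carrier (fibre E x))) = restrict (op_inv (fibre E x) F (\<phi> x)) C"
    and "v \<in> C \<Longrightarrow> op_inv (fibre E x) F (\<phi> x) v \<in> p x ` carrier (fibre E x)"
  using op_inv_restrict(1,2)[OF toplinear_iso_bij[OF chart_iso[OF assms(1,3)]]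
      range_subset[OF chart_domain[OF assms(1,3)]] assms(2)]
  by (auto simp: fibre_range)

end

text \<open>In charts of the range bundles the representative of the restriction is the restriction
  to \<open>C\<close> of the representative of \<open>a\<close>, taken in the underlying bundle
  charts. Norm estimates survive restriction to subspaces.\<close>

lemma range_morphism_continuous:
  assumes p: "bundle_projection E p" and q: "bundle_projection E' q"
    and a: "a \<in> bundle_morphisms E E'"
    and im: "\<And>x. x \<in> topspace (base E) \<Longrightarrow>
      a x ` (p x ` carrier (fibre E x)) \<subseteq> q x ` carrier (fibre E' x)"
    and c: "c \<in> atlas (range_bundle E p)" and c': "c' \<in> atlas (range_bundle E' q)"
  shows "continuous_in_charts (range_bundle E p) (range_bundle E' q) c c'
    (mor_restrict (range_bundle E p) a)"
proof -
  interpret p: bundle_projection E p by fact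
  interpret q: bundle_projection E' q by fact
  note base = bundle_morphisms_base[OF a]
  let ?R = "range_bundle E p" and ?R' = "range_bundle E' q"
  obtain U F \<phi> C where c_eq: "c = (U, F\<lparr>carrier := C\<rparr>, \<lambda>x. restrict (\<phi> x) (p x ` carrier (fibre E x)))"
    and h: "bundle_chart E (U, F, \<phi>)" and C: "C \<subseteq> carrier F" "hilbert_space (F\<lparr>carrier := C\<rparr>)"
    and imC': "\<forall>x\<in>U. \<phi> x ` (p x ` carrier (fibre E x)) = C"
    using c by (rule p.range_atlasE)
  note imC = imC'[rule_format]
  obtain V K \<psi> D where c'_eq: "c' = (V, K\<lparr>carrier := D\<rparr>, \<lambda>x. restrict (\<psi> x) (q x ` carrier (fibre E' x)))"
    and h': "bundle_chart E' (V, K, \<psi>)" and D: "D \<subseteq> carrier K" "hilbert_space (K\<lparr>carrier := D\<rparr>)"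
    and imD': "\<forall>x\<in>V. \<psi> x ` (q x ` carrier (fibre E' x)) = D"
    using c' by (rule q.range_atlasE)
  note imD = imD'[rule_format]
  let ?T = "local_rep E E' (U, F, \<phi>) (V, K, \<psi>) a"
  have inv: "op_inv (fibre E x) F (\<phi> x) v \<in> p x ` carrier (fibre E x)"
    and a_inv: "a x (op_inv (fibre E x) F (\<phi> x) v) \<in> q x ` carrier (fibre E' x)"
    if "x \<in> U" "v \<in> C" for x v
  proof -
    show "op_inv (fibre E x) F (\<phi> x) v \<in> p x ` carrier (fibre E x)"
      by (rule p.range_chart_inverse(2)[OF h imC[OF that(1)] that])
    then show "a x (op_inv (fibre E x) F (\<phi> x) v) \<in> q x ` carrier (fibre E' x)"
      using im[OF chart_domain[OF h that(1)]] by blast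
  qed
  have "norm_continuous_on (base E) (U \<inter> V) F K ?T"
    using morphism_continuous_in_bundle_charts[OF p.hilbert_bundle_axioms q.hilbert_bundle_axioms a h h']
    unfolding continuous_in_charts_iff .
  then have "norm_continuous_on (base E) (U \<inter> V) (F\<lparr>carrier := C\<rparr>) (K\<lparr>carrier := D\<rparr>)
      (\<lambda>x. restrict (?T x) C)"
  proof (rule norm_continuous_on_restrict[OF _ _ chart_model[OF h'] C(1) D(1) C(2) D(2)])
    fix x assume x: "x \<in> U \<inter> V"
    show "?T x ` C \<subseteq> D"
    proof
      fix w assume "w \<in> ?T x ` C"
      then obtain v where v: "v \<in> C" "w = ?T x v" by blast
      have "w = \<psi> x (a x (op_inv (fibre E x) F (\<phi> x) v))"
        using v C(1) by (auto simp: local_rep_apply)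
      then show "w \<in> D" using a_inv[of x v] imD[of x] v(1) x by auto
    qed
  qed
  moreover have "restrict (?T x) C = local_rep ?R ?R' c c' (mor_restrict ?R a) x"
    if x: "x \<in> U \<inter> V" for x
  proof
    fix v
    have xU: "x \<in> U" using x by blast
    show "restrict (?T x) C v = local_rep ?R ?R' c c' (mor_restrict ?R a) x v"
    proof (cases "v \<in> C")
      case True
      then have "v \<in> carrier F" using C(1) by blast
      then show ?thesis
        using True inv[OF xU True] a_inv[OF xU True] chart_domain[OF h xU]
        unfolding c_eq c'_eq
        by (simp add: local_rep_apply p.range_chart_inverse(1)[OF h imC[OF xU] xU, unfolded p.fibre_range]
            mor_restrict_def p.fibre_range)
    qed (simp add: c_eq c'_eq local_rep_def)
  qed
  ultimately have "norm_continuous_on (base E) (U \<inter> V) (F\<lparr>carrier := C\<rparr>) (K\<lparr>carrier := D\<rparr>)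
      (local_rep ?R ?R' c c' (mor_restrict ?R a))"
    by (rule norm_continuous_on_cong)
  then show ?thesis
    unfolding c_eq c'_eq continuous_in_charts_iff by simp
qed

context bundle_projection
begin

text \<open>With the identity written as a restricted morphism, compatibility of the range charts
  becomes a special case of \<open>range_morphism_continuous\<close>.\<close>

lemma bundle_id_range: "bundle_id (range_bundle E p) = mor_restrict (range_bundle E p) (bundle_id E)"
proof -
  have "op_id (fibre (range_bundle E p) x) =
      restrict (bundle_id E x) (carrier (fibre (range_bundle E p) x))" if "x \<in> topspace (base E)" for x
    using range_subset[OF that] that
    by (auto simp: op_id_def fibre_range bundle_id_def restrict_def fun_eq_iff)
  then show ?thesis
    by (auto simp: bundle_id_def[of "range_bundle E p"] mor_restrict_def)
qed

lemma range_charts: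
  assumes "c \<in> atlas (range_bundle E p)"
  shows "bundle_chart (range_bundle E p) c"
proof -
  let ?R = "range_bundle E p"
  obtain U F \<phi> C where c_eq: "c = (U, F\<lparr>carrier := C\<rparr>, \<lambda>x. restrict (\<phi> x) (p x ` carrier (fibre E x)))"
    and h: "bundle_chart E (U, F, \<phi>)" and C: "C \<subseteq> carrier F" "hilbert_space (F\<lparr>carrier := C\<rparr>)"
    and imC': "\<forall>x\<in>U. \<phi> x ` (p x ` carrier (fibre E x)) = C"
    using assms by (rule range_atlasE)
  note imC = imC'[rule_format]
  have id: "bundle_id E x ` (p x ` carrier (fibre E x)) \<subseteq> p x ` carrier (fibre E x)"
    if "x \<in> topspace (base E)" for x
    using that range_subset[OF that] bundle_id_apply[OF that] by fastforce
  have cont: "continuous_in_charts ?R ?R c c' (bundle_id ?R)"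
    if "c \<in> atlas ?R" "c' \<in> atlas ?R" for c c'
    unfolding bundle_id_range
    by (rule range_morphism_continuous[OF bundle_projection_axioms bundle_projection_axioms
      bundle_id_morphism[OF hilbert_bundle_axioms] id that])
  have "toplinear_iso (fibre ?R x) (F\<lparr>carrier := C\<rparr>) (restrict (\<phi> x) (p x ` carrier (fibre E x)))"
    if x: "x \<in> U" for x
    unfolding fibre_range
    by (rule toplinear_iso_restrict[OF chart_iso[OF h x] range_subset imC[OF x] fibre_range_hilbert C(2)])
      (rule chart_domain[OF h x])+
  then show ?thesis
    using cont[OF assms] cont[OF _ assms] chart_open[OF h] C(2)
    unfolding c_eq bundle_chart_def by simp
qed

text \<open>A given chart need not send the ranges of \<open>p\<close> to a fixed subspace. Twisting
  it by \<open>S\<close> near \<open>x0\<close> sends them all to the range \<open>C\<close> of the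
  projection at \<open>x0\<close>. The delicate half is that every vector of \<open>C\<close> is
  reached, since the preimage under \<open>S x\<close> must itself lie in the range of
  \<open>q x\<close>.\<close>

lemma range_charts_cover:
  assumes x0: "x0 \<in> topspace (base E)"
  shows "\<exists>(U, F, \<phi>)\<in>atlas (range_bundle E p). x0 \<in> U"
proof -
  obtain U F \<phi> where c: "(U, F, \<phi>) \<in> atlas E" and x0U: "x0 \<in> U" using atlas_covers[OF x0] by blast
  note h = atlas_charts[OF c]
  note F = chart_model[OF h]
  interpret F: hilbert_space F by fact
  \<comment> \<open>In the chart the projections of varying fibres become a norm-continuous family
    of projections on the one space \<open>F\<close>, where they can be compared.\<close>
  define q where "q = local_rep E E (U, F, \<phi>) (U, F, \<phi>) p"
  have q: "norm_continuous_on (base E) U F F q"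
    using bundle_morphisms_continuous[OF morphism c c] unfolding continuous_in_charts_iff q_def by simp
  note qb = norm_continuous_on_bounded[OF q]
  note qc = bounded_ops_closed[OF qb]
  have q_chart: "q x (\<phi> x v) = \<phi> x (p x v)" if "x \<in> U" "v \<in> carrier (fibre E x)" for x v
    using that chart_left[OF h that] chart_closed[OF h that] by (simp add: q_def local_rep_apply)
  have q_idem: "q x (q x v) = q x v" if "x \<in> U" "v \<in> carrier F" for x v
  proof -
    let ?w = "op_inv (fibre E x) F (\<phi> x) v"
    have w: "?w \<in> carrier (fibre E x)" "\<phi> x ?w = v"
      using chart_inv_closed[OF h that] chart_right[OF h that] by auto
    have xt: "x \<in> topspace (base E)" by (rule chart_domain[OF h that(1)])
    show ?thesis
      using q_chart[OF that(1) w(1)] q_chart[OF that(1) p_closed[OF xt w(1)]] idem[OF xt w(1)] w(2) by simp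
  qed
  define q0 where "q0 = q x0"
  have q0b: "q0 \<in> bounded_ops F F" unfolding q0_def by (rule qb[OF x0U])
  note q0c = bounded_ops_closed[OF q0b]
  have q0_idem: "q0 (q0 v) = q0 v" if "v \<in> carrier F" for v
    unfolding q0_def by (rule q_idem[OF x0U that])
  define C where "C = q0 ` carrier F"
  have C: "C \<subseteq> carrier F" "hilbert_space (F\<lparr>carrier := C\<rparr>)"
    using q0c hilbert_space_range[OF F q0b q0_idem] by (auto simp: C_def range_space_def)
  obtain b where b: "b > 0" "\<And>v. v \<in> carrier F \<Longrightarrow> hnorm F (q0 v) \<le> b * hnorm F v"
    using bounded_opsE[OF F q0b] by blast
  \<comment> \<open>The identity minus \<open>S x\<close> equals \<open>(q x - q0) q x\<close>, and
    \<open>q x\<close> has norm at most \<open>1 + b\<close> near \<open>x0\<close>. So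
    \<open>d * (1 + b) = 1 / 2\<close> makes \<open>S x\<close> invertible; the bound
    \<open>d \<le> 1 / 2\<close> serves again in the proof that all of \<open>C\<close> is
    reached.\<close>
  define d where "d = 1 / (2 * (1 + b))"
  have d: "d > 0" "d \<le> 1 / 2" "d * (1 + b) = 1 / 2" using b(1) by (auto simp: d_def field_simps)
  obtain W where W: "openin (base E) W" "x0 \<in> W"
    "\<And>x v. x \<in> W \<Longrightarrow> x \<in> U \<Longrightarrow> v \<in> carrier F \<Longrightarrow> hnorm F (q x v \<ominus>\<^bsub>F\<^esub> q0 v) \<le> d * hnorm F v"
    using norm_continuous_onE[OF q x0U d(1)] unfolding q0_def by blast
  define V where "V = W \<inter> U"
  have V: "openin (base E) V" "V \<subseteq> U" "x0 \<in> V"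
    using W chart_open[OF h] x0U by (auto simp: V_def openin_Int)
  have near: "hnorm F (q x v \<ominus>\<^bsub>F\<^esub> q0 v) \<le> d * hnorm F v" if "x \<in> V" "v \<in> carrier F" for x v
    using W(3) that by (simp add: V_def)

  \<comment> \<open>\<open>S x\<close> is close to the identity and maps the range of \<open>q x\<close> onto that of \<open>q0\<close>.\<close>
  define S where "S x = op_diff F F (op_id F) (op_diff F F (q x) (op_comp F q0 (q x)))" for x
  have Sx: "S x v = v \<ominus>\<^bsub>F\<^esub> (q x v \<ominus>\<^bsub>F\<^esub> q0 (q x v))" if "v \<in> carrier F" for x v
    using that by (simp add: S_def op_apply)
  have qV: "norm_continuous_on (base E) V F F q" by (rule norm_continuous_on_subset[OF q V(2)])
  have const: "norm_continuous_on (base E) V F F (\<lambda>x. A)" if "A \<in> bounded_ops F F" for A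
    by (rule norm_continuous_on_const[OF that F F openin_subset[OF V(1)]])
  have S: "norm_continuous_on (base E) V F F S"
    unfolding S_def
    by (intro norm_continuous_on_diff norm_continuous_on_comp[OF qV const[OF q0b]]
        const op_id_bounded F qV)
  have iso: "toplinear_iso F F (S x)" if x: "x \<in> V" for x
  proof (rule near_identity_iso[OF F norm_continuous_on_bounded[OF S x], of "1 / 2"])
    have xU: "x \<in> U" using x V(2) by blast
    fix v assume v: "v \<in> carrier F"
    note qv = qc[OF xU v]
    have "v \<ominus>\<^bsub>F\<^esub> S x v = q x (q x v) \<ominus>\<^bsub>F\<^esub> q0 (q x v)"
      unfolding Sx[OF v] q_idem[OF xU v] using v qv q0c[OF qv]
      by (intro F.eq_by_cinner) (simp_all add: F.cinner_diff_left)
    then have "hnorm F (v \<ominus>\<^bsub>F\<^esub> S x v) \<le> d * hnorm F (q x v)" using near[OF x qv] by simp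
    also have "hnorm F (q x v) \<le> hnorm F (q x v \<ominus>\<^bsub>F\<^esub> q0 v) + hnorm F (q0 v)"
      by (rule F.hnorm_le_diff[OF qv q0c[OF v]])
    also have "hnorm F (q x v \<ominus>\<^bsub>F\<^esub> q0 v) + hnorm F (q0 v) \<le> (1 + b) * hnorm F v"
    proof -
      have "d * hnorm F v \<le> 1 * hnorm F v" using d(2) F.hnorm_ge_zero[OF v] by (intro mult_right_mono) auto
      then show ?thesis using near[OF x v] b(2)[OF v] by (simp add: algebra_simps)
    qed
    also have "d * ((1 + b) * hnorm F v) = 1 / 2 * hnorm F v" by (simp only: mult.assoc[symmetric] d(3))
    finally show "hnorm F (v \<ominus>\<^bsub>F\<^esub> S x v) \<le> 1 / 2 * hnorm F v" using d(1) by simp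
  qed simp
  define \<psi> where "\<psi> x = op_comp (fibre E x) (S x) (\<phi> x)" for x
  have h': "bundle_chart E (V, F, \<psi>)"
    unfolding \<psi>_def by (rule bundle_chart_twist[OF hilbert_bundle_axioms h V(1,2) S iso])
  have "\<psi> x ` (p x ` carrier (fibre E x)) = C" if x: "x \<in> V" for x
  proof
    have xU: "x \<in> U" using x V(2) by blast
    have xt: "x \<in> topspace (base E)" by (rule chart_domain[OF h xU])
    show "\<psi> x ` (p x ` carrier (fibre E x)) \<subseteq> C"
    proof
      fix w assume "w \<in> \<psi> x ` (p x ` carrier (fibre E x))"
      then obtain z where z: "z \<in> carrier (fibre E x)" "p x z = z" "w = \<psi> x z"
        using range_iff[OF xt] by blast
      note v = chart_closed[OF h xU z(1)]
      have "q x (\<phi> x z) = \<phi> x z" using q_chart[OF xU z(1)] z(2) by simp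
      \<comment> \<open>On a vector fixed by \<open>q x\<close> the terms \<open>v - q x v\<close>
        cancel and only \<open>q0 v\<close> is left.\<close>
      then have "S x (\<phi> x z) = q0 (\<phi> x z)"
        unfolding Sx[OF v] using v q0c[OF v]
        by (intro F.eq_by_cinner) (simp_all add: F.cinner_diff_left)
      then show "w \<in> C" using z v by (simp add: \<psi>_def op_apply C_def)
    qed
    show "C \<subseteq> \<psi> x ` (p x ` carrier (fibre E x))"
    proof
      fix w assume "w \<in> C"
      then have w: "w \<in> carrier F" "q0 w = w" using q0c q0_idem by (auto simp: C_def)
      define v where "v = op_inv F F (S x) w"
      have v: "v \<in> carrier F" "S x v = w"
        using op_inv_closed[OF toplinear_iso_bij[OF iso[OF x]] w(1)]
          op_inv_right[OF toplinear_iso_bij[OF iso[OF x]] w(1)] by (simp_all add: v_def)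
      note qv = qc[OF xU v(1)]
      note qqv = q0c[OF qv]
      \<comment> \<open>\<open>u\<close> lies in the kernel of \<open>q x\<close> and, by the
        formula for \<open>S x\<close>, in the range of \<open>q0\<close>. Two projections at
        distance at most \<open>1 / 2\<close> have only zero in common there, so
        \<open>q x v = v\<close>.\<close>
      define u where "u = v \<ominus>\<^bsub>F\<^esub> q x v"
      have u: "u \<in> carrier F" using v(1) qv by (simp add: u_def)
      have qu: "q x u = \<zero>\<^bsub>F\<^esub>"
        unfolding u_def bounded_ops_diff[OF F F qb[OF xU] v(1) qv] q_idem[OF xU v(1)]
        by (rule F.diff_self[OF qv])
      have uw: "u = w \<ominus>\<^bsub>F\<^esub> q0 (q x v)"
        unfolding v(2)[symmetric] Sx[OF v(1)] u_def using v(1) qv qqv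
        by (intro F.eq_by_cinner) (simp_all add: F.cinner_diff_left)
      have "q0 u = u"
        using bounded_ops_diff[OF F F q0b w(1) qqv] q0_idem[OF qv] w(2) uw by simp
      then have "hnorm F (\<zero>\<^bsub>F\<^esub> \<ominus>\<^bsub>F\<^esub> u) \<le> d * hnorm F u"
        using near[OF x u] qu by simp
      then have "hnorm F u \<le> d * hnorm F u"
        using F.hnorm_minus_commute[OF F.carrier_closed(1) u] F.diff_zero[OF u] by simp
      also have "\<dots> \<le> 1 / 2 * hnorm F u" by (rule mult_right_mono[OF d(2) F.hnorm_ge_zero[OF u]])
      finally have "hnorm F u = 0" using F.hnorm_ge_zero[OF u] by simp
      then have "q x v = v" using F.hnorm_eq_zero[OF u] F.diff_eq_zero[OF v(1) qv] u_def by simp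
      define z where "z = op_inv (fibre E x) F (\<phi> x) v"
      have z: "z \<in> carrier (fibre E x)" "\<phi> x z = v"
        using chart_inv_closed[OF h xU v(1)] chart_right[OF h xU v(1)] by (simp_all add: z_def)
      have "\<phi> x (p x z) = \<phi> x z" using q_chart[OF xU z(1)] z(2) \<open>q x v = v\<close> by simp
      then have "p x z = z"
        using chart_left[OF h xU p_closed[OF xt z(1)]] chart_left[OF h xU z(1)] by simp
      then have "z \<in> p x ` carrier (fibre E x)" using range_iff[OF xt] z(1) by blast
      moreover have "\<psi> x z = w" using z v by (simp add: \<psi>_def op_apply)
      ultimately show "w \<in> \<psi> x ` (p x ` carrier (fibre E x))" by blast
    qed
  qed
  then have "(V, F\<lparr>carrier := C\<rparr>, \<lambda>x. restrict (\<psi> x) (p x ` carrier (fibre E x)))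
      \<in> atlas (range_bundle E p)"
    using h' C unfolding range_bundle_def
    by (simp, intro exI[of _ F] exI[of _ \<psi>] exI[of _ C]) simp
  then show ?thesis using V(3) by blast
qed

lemma hilbert_bundle_range: "hilbert_bundle (range_bundle E p)"
proof (rule hilbert_bundle.intro)
  show "hilbert_space (fibre (range_bundle E p) x)"
    if "x \<in> topspace (base (range_bundle E p))" for x
    using that fibre_range_hilbert by (simp add: fibre_range)
  show "bundle_chart (range_bundle E p) c" if "c \<in> atlas (range_bundle E p)" for c
    using that by (rule range_charts)
  show "\<exists>(U, F, \<phi>)\<in>atlas (range_bundle E p). x \<in> U"
    if "x \<in> topspace (base (range_bundle E p))" for x
    using that range_charts_cover by simp
next
  let ?R = "range_bundle E p"
  fix U F \<phi> x and e :: real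
  assume c: "(U, F, \<phi>) \<in> atlas ?R" and x: "x \<in> U" and e: "e > 0"
  obtain F' \<phi>' C where F: "F = F'\<lparr>carrier := C\<rparr>"
    and \<phi>: "\<phi> = (\<lambda>x. restrict (\<phi>' x) (p x ` carrier (fibre E x)))"
    and h: "bundle_chart E (U, F', \<phi>')" and C: "C \<subseteq> carrier F'"
    and im': "\<forall>x\<in>U. \<phi>' x ` (p x ` carrier (fibre E x)) = C"
    using c by (rule range_atlasE) auto
  note im = im'[rule_format]
  have inv: "op_inv (fibre ?R y) F (\<phi> y) u = op_inv (fibre E y) F' (\<phi>' y) u"
    if "y \<in> U" "u \<in> C" for y u
    using range_chart_inverse(1)[OF h im[OF that(1)] that(1)] that(2) by (simp add: F \<phi>)
  obtain W where W: "openin (base E) W" "x \<in> W" "\<forall>y\<in>W \<inter> U. \<forall>u\<in>carrier F'. \<forall>v\<in>carrier F'.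
      cmod (cinner (fibre E y) (op_inv (fibre E y) F' (\<phi>' y) u) (op_inv (fibre E y) F' (\<phi>' y) v) -
          cinner (fibre E x) (op_inv (fibre E x) F' (\<phi>' x) u) (op_inv (fibre E x) F' (\<phi>' x) v))
        \<le> e * hnorm F' u * hnorm F' v"
    using metric_continuous_in_bundle_chart[OF hilbert_bundle_axioms h x e] by blast
  have cin: "cinner (fibre ?R y) = cinner (fibre E y)" for y by (simp add: fibre_range)
  have carF: "carrier F = C" and norF: "hnorm F = hnorm F'" by (simp_all add: F)
  show "\<exists>W. openin (base ?R) W \<and> x \<in> W \<and> (\<forall>y\<in>W \<inter> U. \<forall>u\<in>carrier F. \<forall>v\<in>carrier F.
      cmod (cinner (fibre ?R y) (op_inv (fibre ?R y) F (\<phi> y) u) (op_inv (fibre ?R y) F (\<phi> y) v) -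
          cinner (fibre ?R x) (op_inv (fibre ?R x) F (\<phi> x) u) (op_inv (fibre ?R x) F (\<phi> x) v))
        \<le> e * hnorm F u * hnorm F v)"
  proof (intro exI conjI ballI)
    show "openin (base ?R) W" using W(1) by simp
    show "x \<in> W" by fact
    fix y u v assume y: "y \<in> W \<inter> U" and u: "u \<in> carrier F" and v: "v \<in> carrier F"
    have uv: "u \<in> C" "v \<in> C" "u \<in> carrier F'" "v \<in> carrier F'" using u v C by (auto simp: carF)
    have yU: "y \<in> U" using y by blast
    show "cmod (cinner (fibre ?R y) (op_inv (fibre ?R y) F (\<phi> y) u) (op_inv (fibre ?R y) F (\<phi> y) v) -
          cinner (fibre ?R x) (op_inv (fibre ?R x) F (\<phi> x) u) (op_inv (fibre ?R x) F (\<phi> x) v))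
        \<le> e * hnorm F u * hnorm F v"
      unfolding cin norF inv[OF yU uv(1)] inv[OF yU uv(2)] inv[OF x uv(1)] inv[OF x uv(2)]
      using W(3) y uv(3,4) by blast
  qed
qed

end

lemma range_morphism:
  assumes p: "bundle_projection E p" and q: "bundle_projection E' q"
    and a: "a \<in> bundle_morphisms E E'"
    and im: "\<And>x. x \<in> topspace (base E) \<Longrightarrow>
      a x ` (p x ` carrier (fibre E x)) \<subseteq> q x ` carrier (fibre E' x)"
  shows "mor_restrict (range_bundle E p) a \<in> bundle_morphisms (range_bundle E p) (range_bundle E' q)"
proof -
  interpret p: bundle_projection E p by fact
  interpret q: bundle_projection E' q by fact
  have "restrict (a x) (p x ` carrier (fibre E x)) \<in> bounded_ops
      ((fibre E x)\<lparr>carrier := p x ` carrier (fibre E x)\<rparr>)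
      ((fibre E' x)\<lparr>carrier := q x ` carrier (fibre E' x)\<rparr>)" if "x \<in> topspace (base E)" for x
    by (rule bounded_ops_restrict[OF bundle_morphisms_bounded[OF a that] p.range_subset[OF that]
        im[OF that] p.fibre_range_hilbert[OF that]])
  then show ?thesis
    using range_morphism_continuous[OF p q a im] bundle_morphisms_base[OF a]
    by (auto simp: bundle_morphisms_def mor_restrict_def p.fibre_range q.fibre_range)
qed

section \<open>Toeplitz operators and parametrices\<close>

text \<open>Closure of the classes \<open>L\<close> and linearity of the symbol are postulated for
  sums and multiples; remainders of parametrices are differences.\<close>

lemma op_diff_eq_add_scale:
  assumes "hilbert_space K" "\<And>x. x \<in> carrier H \<Longrightarrow> A x \<in> carrier K" "\<And>x. x \<in> carrier H \<Longrightarrow> B x \<in> carrier K"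
  shows "op_diff H K A B = op_add H K A (op_scale H K (- 1) B)"
  using assms by (auto simp: op_diff_def op_add_def op_scale_def hilbert_space.uminus_scale)

section \<open>Adjoints\<close>

lemma is_adjointD:
  assumes "is_adjoint H K A B"
  shows is_adjoint_bounded: "A \<in> bounded_ops H K" "B \<in> bounded_ops K H"
    and is_adjoint_cinner: "x \<in> carrier H \<Longrightarrow> y \<in> carrier K \<Longrightarrow> cinner K (A x) y = cinner H x (B y)"
  using assms by (auto simp: is_adjoint_def)

lemma is_adjoint_cinner':
  assumes "is_adjoint H K A B" "hilbert_space H" "hilbert_space K" "x \<in> carrier H" "y \<in> carrier K"
  shows "cinner H (B y) x = cinner K y (A x)"
  using is_adjoint_cinner[OF assms(1,4,5)]
    hilbert_space.cinner_commute[OF assms(2) bounded_ops_closed[OF is_adjoint_bounded(2)[OF assms(1)] assms(5)] assms(4)]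
    hilbert_space.cinner_commute[OF assms(3) assms(5) bounded_ops_closed[OF is_adjoint_bounded(1)[OF assms(1)] assms(4)]]
  by simp

lemma is_adjoint_sym:
  assumes "is_adjoint H K A B" "hilbert_space H" "hilbert_space K"
  shows "is_adjoint K H B A"
  using is_adjointD[OF assms(1)] is_adjoint_cinner'[OF assms] by (simp add: is_adjoint_def)

text \<open>The identity is its own adjoint. Thus a prescribed adjoint of \<open>P1\<close>
  determines the adjoint of \<open>1 - P1\<close> that the right parametrix uses.\<close>

lemma is_adjoint_id_diff:
  assumes "is_adjoint H H A B" "hilbert_space H"
  shows "is_adjoint H H (op_diff H H (op_id H) A) (op_diff H H (op_id H) B)"
  using assms op_diff_bounded[OF op_id_bounded[OF assms(2)] is_adjoint_bounded(1)[OF assms(1)] assms(2,2)]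
    op_diff_bounded[OF op_id_bounded[OF assms(2)] is_adjoint_bounded(2)[OF assms(1)] assms(2,2)]
    bounded_ops_closed[of A H H] bounded_ops_closed[of B H H]
  by (simp add: is_adjoint_def op_apply hilbert_space.cinner_diff_left hilbert_space.cinner_diff_right)

section \<open>Smoothing remainders and Toeplitz classes\<close>

context operator_algebra
begin

lemma L_sub: "(g0, g1) \<in> G \<Longrightarrow> \<mu> \<le> 0 \<Longrightarrow> A \<in> L \<mu> (g0, g1) \<Longrightarrow> A \<in> L 0 (g0, g1)"
  using L_mono[of g0 g1 \<mu> 0] by auto

lemma L_bounded:
  assumes "(g0, g1) \<in> G" "A \<in> L 0 (g0, g1)"
  shows "A \<in> bounded_ops (H 0 g0) (H 0 g1)"
proof -
  have "restrict A (carrier (H 0 g0)) = A"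
    using linear_ops_extensional[OF L_linear[OF assms(1) _ assms(2)]] by (simp add: extensional_restrict)
  then show ?thesis using L_continuous[OF assms(1) _ assms(2), of 0] by simp
qed

lemma L_closed: "(g0, g1) \<in> G \<Longrightarrow> A \<in> L 0 (g0, g1) \<Longrightarrow> x \<in> carrier (H 0 g0) \<Longrightarrow> A x \<in> carrier (H 0 g1)"
  by (rule bounded_ops_closed[OF L_bounded])

lemma L_apply_diff:
  "(g0, g1) \<in> G \<Longrightarrow> A \<in> L 0 (g0, g1) \<Longrightarrow> x \<in> carrier (H 0 g0) \<Longrightarrow> y \<in> carrier (H 0 g0) \<Longrightarrow>
    A (x \<ominus>\<^bsub>H 0 g0\<^esub> y) = A x \<ominus>\<^bsub>H 0 g1\<^esub> A y"
  by (rule bounded_ops_diff[OF hilbert hilbert L_bounded])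

lemma L_apply_add:
  "(g0, g1) \<in> G \<Longrightarrow> A \<in> L 0 (g0, g1) \<Longrightarrow> x \<in> carrier (H 0 g0) \<Longrightarrow> y \<in> carrier (H 0 g0) \<Longrightarrow>
    A (x \<oplus>\<^bsub>H 0 g0\<^esub> y) = A x \<oplus>\<^bsub>H 0 g1\<^esub> A y"
  by (rule linear_ops_add[OF bounded_ops_linear[OF L_bounded]])

lemma L_eqI:
  "(g0, g1) \<in> G \<Longrightarrow> A \<in> L 0 (g0, g1) \<Longrightarrow> B \<in> L 0 (g0, g1) \<Longrightarrow> (\<And>x. x \<in> carrier (H 0 g0) \<Longrightarrow> A x = B x) \<Longrightarrow> A = B"
  by (rule linear_ops_eqI[OF bounded_ops_linear[OF L_bounded] bounded_ops_linear[OF L_bounded]])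

lemma L_diff:
  assumes "(g0, g1) \<in> G" "\<mu> \<le> 0" "A \<in> L \<mu> (g0, g1)" "B \<in> L \<mu> (g0, g1)"
  shows "op_diff (H 0 g0) (H 0 g1) A B \<in> L \<mu> (g0, g1)"
proof -
  note cl = L_closed[OF assms(1) L_sub[OF assms(1-3)]] L_closed[OF assms(1) L_sub[OF assms(1,2,4)]]
  show ?thesis
    using L_add[OF assms(1-3) L_scale[OF assms(1,2,4), of "- 1"]] op_diff_eq_add_scale[where A=A and B=B, OF hilbert cl]
    by simp
qed

lemma L_comp0:
  "(g0, g1) \<in> G \<Longrightarrow> (g1, g2) \<in> G \<Longrightarrow> B \<in> L 0 (g1, g2) \<Longrightarrow> A \<in> L 0 (g0, g1) \<Longrightarrow>
    op_comp (H 0 g0) B A \<in> L 0 (g0, g2)"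
  using L_comp[of g0 g1 g2 0 0 B A] by simp

lemma smoothing_L: "\<mu> \<le> 0 \<Longrightarrow> R \<in> smoothing L (g0, g1) \<Longrightarrow> R \<in> L \<mu> (g0, g1)"
  by (auto simp: smoothing_def)

lemma smoothing_diff:
  "(g0, g1) \<in> G \<Longrightarrow> R \<in> smoothing L (g0, g1) \<Longrightarrow> S \<in> smoothing L (g0, g1) \<Longrightarrow>
    op_diff (H 0 g0) (H 0 g1) R S \<in> smoothing L (g0, g1)"
  using L_diff by (simp add: smoothing_def)

lemma smoothing_add:
  "(g0, g1) \<in> G \<Longrightarrow> R \<in> smoothing L (g0, g1) \<Longrightarrow> S \<in> smoothing L (g0, g1) \<Longrightarrow>
    op_add (H 0 g0) (H 0 g1) R S \<in> smoothing L (g0, g1)"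
  using L_add by (simp add: smoothing_def)

lemma smoothing_comp_left:
  assumes "(g0, g1) \<in> G" "(g1, g2) \<in> G" "B \<in> L 0 (g1, g2)" "R \<in> smoothing L (g0, g1)"
  shows "op_comp (H 0 g0) B R \<in> smoothing L (g0, g2)"
  using L_comp[OF assms(1,2) _ _ assms(3) smoothing_L[OF _ assms(4)]] by (simp add: smoothing_def)

lemma smoothing_comp_right:
  assumes "(g0, g1) \<in> G" "(g1, g2) \<in> G" "R \<in> smoothing L (g1, g2)" "A \<in> L 0 (g0, g1)"
  shows "op_comp (H 0 g0) R A \<in> smoothing L (g0, g2)"
proof -
  have "op_comp (H 0 g0) R A \<in> L \<mu> (g0, g2)" if "\<mu> \<le> 0" for \<mu>
    using L_comp[OF assms(1,2) that _ smoothing_L[OF that assms(3)] assms(4)] by simp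
  then show ?thesis by (simp add: smoothing_def)
qed

lemma projectionsD:
  assumes "(g, g) \<in> G" "P \<in> projections H L g"
  shows projections_L: "P \<in> L 0 (g, g)"
    and projections_idem: "x \<in> carrier (H 0 g) \<Longrightarrow> P (P x) = P x"
proof -
  show "P \<in> L 0 (g, g)" using assms by (simp add: projections_def)
  have "op_comp (H 0 g) P P = P" using assms by (simp add: projections_def)
  then show "P (P x) = P x" if "x \<in> carrier (H 0 g)" using op_comp_apply[OF that, of P P] by simp
qed

text \<open>The vanishing of \<open>(1 - P1) A\<close> and \<open>A (1 - P0)\<close> is read as
  invariance on vectors. All later computations with Toeplitz operators use this form.\<close>

lemma toeplitz_iff:
  assumes G: "(g0, g1) \<in> G" and P0: "P0 \<in> projections H L g0" and P1: "P1 \<in> projections H L g1"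
    and \<mu>: "\<mu> \<le> 0"
  shows "A \<in> toeplitz H L \<mu> (g0, g1) P0 P1 \<longleftrightarrow>
    A \<in> L \<mu> (g0, g1) \<and> (\<forall>x\<in>carrier (H 0 g0). P1 (A x) = A x \<and> A (P0 x) = A x)"
proof (cases "A \<in> L \<mu> (g0, g1)")
  case True
  note A = L_sub[OF G \<mu> True]
  note Ac = L_closed[OF G A]
  note P0c = L_closed[OF admissible_left[OF G] projections_L[OF admissible_left[OF G] P0]]
  note P1c = L_closed[OF admissible_right[OF G] projections_L[OF admissible_right[OF G] P1]]
  have zero: "op_comp (H 0 g0) B C = op_zero (H 0 g0) (H 0 g1) \<longleftrightarrow> (\<forall>x\<in>carrier (H 0 g0). B (C x) = \<zero>\<^bsub>H 0 g1\<^esub>)"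
    for B C :: "'v \<Rightarrow> 'v"
    by (auto simp: op_comp_def compose_def op_zero_def fun_eq_iff restrict_def)
  have 1: "op_diff (H 0 g1) (H 0 g1) (op_id (H 0 g1)) P1 (A x) = \<zero>\<^bsub>H 0 g1\<^esub> \<longleftrightarrow> P1 (A x) = A x"
    if "x \<in> carrier (H 0 g0)" for x
    using hilbert_space.diff_eq_zero[OF hilbert Ac[OF that] P1c[OF Ac[OF that]]] Ac[OF that]
    by (auto simp: op_apply)
  have 2: "A (op_diff (H 0 g0) (H 0 g0) (op_id (H 0 g0)) P0 x) = \<zero>\<^bsub>H 0 g1\<^esub> \<longleftrightarrow> A (P0 x) = A x"
    if "x \<in> carrier (H 0 g0)" for x
    using hilbert_space.diff_eq_zero[OF hilbert Ac[OF that] Ac[OF P0c[OF that]]]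
      L_apply_diff[OF G A that P0c[OF that]] that
    by (auto simp: op_apply)
  show ?thesis using True 1 2 unfolding toeplitz_def by (simp add: zero) blast
qed (simp add: toeplitz_def)

lemma toeplitzD:
  assumes "(g0, g1) \<in> G" "P0 \<in> projections H L g0" "P1 \<in> projections H L g1"
    and "A \<in> toeplitz H L 0 (g0, g1) P0 P1"
  shows toeplitz_L: "A \<in> L 0 (g0, g1)"
    and toeplitz_left: "x \<in> carrier (H 0 g0) \<Longrightarrow> P1 (A x) = A x"
    and toeplitz_right: "x \<in> carrier (H 0 g0) \<Longrightarrow> A (P0 x) = A x"
  using assms toeplitz_iff[OF assms(1-3)] by auto

text \<open>The invariance conditions do not involve the order, so the intersection over all orders
  affects only membership in \<open>L\<close>.\<close>

lemma toeplitz_smoothing_iff: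
  assumes "(g0, g1) \<in> G" "P0 \<in> projections H L g0" "P1 \<in> projections H L g1"
  shows "R \<in> toeplitz_smoothing H L (g0, g1) P0 P1 \<longleftrightarrow>
    R \<in> smoothing L (g0, g1) \<and> (\<forall>x\<in>carrier (H 0 g0). P1 (R x) = R x \<and> R (P0 x) = R x)"
proof -
  have "R \<in> toeplitz_smoothing H L (g0, g1) P0 P1 \<longleftrightarrow>
      (\<forall>\<mu>\<le>0. R \<in> L \<mu> (g0, g1) \<and> (\<forall>x\<in>carrier (H 0 g0). P1 (R x) = R x \<and> R (P0 x) = R x))"
    using toeplitz_iff[OF assms] by (auto simp: toeplitz_smoothing_def)
  then show ?thesis by (auto simp: smoothing_def)
qed

text \<open>Both \<open>B A\<close> and \<open>P0\<close> are unchanged by composition with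
  \<open>P0\<close> on either side, and so is their difference. Hence for a parametrix only
  smoothing in \<open>L\<close> has to be verified.\<close>

lemma toeplitz_smoothing_diffI:
  assumes G: "(g0, g1) \<in> G" and P0: "P0 \<in> projections H L g0" and P1: "P1 \<in> projections H L g1"
    and A: "A \<in> toeplitz H L 0 (g0, g1) P0 P1" and B: "B \<in> toeplitz H L 0 (g1, g0) P1 P0"
    and R: "op_diff (H 0 g0) (H 0 g0) (op_comp (H 0 g0) B A) P0 \<in> smoothing L (g0, g0)"
  shows "op_diff (H 0 g0) (H 0 g0) (op_comp (H 0 g0) B A) P0 \<in> toeplitz_smoothing H L (g0, g0) P0 P0"
proof -
  note G' = admissible_inverse[OF G] and G0 = admissible_left[OF G]
  note a = toeplitzD[OF G P0 P1 A] and b = toeplitzD[OF G' P1 P0 B]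
  note p = projectionsD[OF G0 P0]
  note cl = L_closed[OF G a(1)] L_closed[OF G' b(1)] L_closed[OF G0 p(1)]
  show ?thesis
    unfolding toeplitz_smoothing_iff[OF G0 P0 P0]
    using R by (simp add: op_apply cl L_apply_diff[OF G0 p(1)] p(2) a(3) b(2))
qed

text \<open>A left and a right parametrix differ by a smoothing operator.\<close>

lemma toeplitz_ellipticI:
  assumes G: "(g0, g1) \<in> G" and P0: "P0 \<in> projections H L g0" and P1: "P1 \<in> projections H L g1"
    and A: "A \<in> toeplitz H L 0 (g0, g1) P0 P1"
    and B: "B \<in> toeplitz H L 0 (g1, g0) P1 P0"
    and C: "C \<in> toeplitz H L 0 (g1, g0) P1 P0"
    and R: "op_diff (H 0 g0) (H 0 g0) (op_comp (H 0 g0) B A) P0 \<in> smoothing L (g0, g0)"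
    and S: "op_diff (H 0 g1) (H 0 g1) (op_comp (H 0 g1) A C) P1 \<in> smoothing L (g1, g1)"
  shows "toeplitz_elliptic H L (g0, g1) P0 P1 A"
proof -
  note G' = admissible_inverse[OF G] and G0 = admissible_left[OF G] and G1 = admissible_right[OF G]
  note a = toeplitzD[OF G P0 P1 A] and b = toeplitzD[OF G' P1 P0 B] and c = toeplitzD[OF G' P1 P0 C]
  note p0 = projectionsD[OF G0 P0] and p1 = projectionsD[OF G1 P1]
  define R' where "R' = op_diff (H 0 g0) (H 0 g0) (op_comp (H 0 g0) B A) P0"
  define S' where "S' = op_diff (H 0 g1) (H 0 g1) (op_comp (H 0 g1) A C) P1"
  have R': "R' \<in> smoothing L (g0, g0)" and S': "S' \<in> smoothing L (g1, g1)"
    using R S by (simp_all add: R'_def S'_def)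
  note R0 = smoothing_L[OF order_refl R'] and S0 = smoothing_L[OF order_refl S']
  note cl = L_closed[OF G a(1)] L_closed[OF G' b(1)] L_closed[OF G' c(1)] L_closed[OF G0 p0(1)]
    L_closed[OF G1 p1(1)] L_closed[OF G0 R0] L_closed[OF G1 S0]
  note eq = hilbert_space.eq_by_cinner[OF hilbert, of _ 0 g1]
  note lin = cinner_linear hilbert_closed hilbert
  \<comment> \<open>From \<open>P0 C = C\<close> and \<open>B P1 = B\<close> one gets
    \<open>R' C = B A C - C\<close> and \<open>B S' = B A C - B\<close>, hence
    \<open>B - C = R' C - B S'\<close>. Applying \<open>A\<close> and adding
    \<open>S' = A C - P1\<close> expresses the remainder of \<open>A B\<close> through smoothing
    operators.\<close>
  let ?ARC = "op_comp (H 0 g1) A (op_comp (H 0 g1) R' C)"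
  let ?ABS = "op_comp (H 0 g1) A (op_comp (H 0 g1) B S')"
  have "op_diff (H 0 g1) (H 0 g1) (op_comp (H 0 g1) A B) P1 =
      op_add (H 0 g1) (H 0 g1) S' (op_diff (H 0 g1) (H 0 g1) ?ARC ?ABS)" (is "?lhs = ?rhs")
  proof (rule extensionalityI[of _ "carrier (H 0 g1)"])
    fix y assume y: "y \<in> carrier (H 0 g1)"
    have Sy: "S' y = A (C y) \<ominus>\<^bsub>H 0 g1\<^esub> P1 y" using y by (simp add: S'_def op_apply)
    have RCy: "R' (C y) = B (A (C y)) \<ominus>\<^bsub>H 0 g0\<^esub> C y"
      using y cl c(2) by (simp add: R'_def op_apply)
    have BS: "B (S' y) = B (A (C y)) \<ominus>\<^bsub>H 0 g0\<^esub> B y"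
      using y cl b(3) unfolding Sy by (simp add: L_apply_diff[OF G' b(1)])
    have "A (R' (C y)) = A (B (A (C y))) \<ominus>\<^bsub>H 0 g1\<^esub> A (C y)"
      using y cl unfolding RCy by (simp add: L_apply_diff[OF G a(1)])
    moreover have "A (B (S' y)) = A (B (A (C y))) \<ominus>\<^bsub>H 0 g1\<^esub> A (B y)"
      using y cl unfolding BS by (simp add: L_apply_diff[OF G a(1)])
    ultimately have "?rhs y = (A (C y) \<ominus>\<^bsub>H 0 g1\<^esub> P1 y) \<oplus>\<^bsub>H 0 g1\<^esub>
        ((A (B (A (C y))) \<ominus>\<^bsub>H 0 g1\<^esub> A (C y)) \<ominus>\<^bsub>H 0 g1\<^esub> (A (B (A (C y))) \<ominus>\<^bsub>H 0 g1\<^esub> A (B y)))"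
      using y Sy by (simp add: op_apply)
    also have "\<dots> = A (B y) \<ominus>\<^bsub>H 0 g1\<^esub> P1 y"
      using y by (intro eq) (simp_all add: cl lin)
    finally show "?lhs y = ?rhs y" using y by (simp add: op_apply)
  qed (simp_all add: op_diff_def op_add_def)
  moreover have "?rhs \<in> smoothing L (g1, g1)"
    by (intro smoothing_add[OF G1 S'] smoothing_diff[OF G1]
        smoothing_comp_left[OF G' G a(1)] smoothing_comp_right[OF G' G0 R' c(1)]
        smoothing_comp_left[OF G1 G' b(1) S'])
  ultimately have "op_diff (H 0 g1) (H 0 g1) (op_comp (H 0 g1) A B) P1 \<in> smoothing L (g1, g1)"
    by simp
  then show ?thesis
    using A B toeplitz_smoothing_diffI[OF G P0 P1 A B R] toeplitz_smoothing_diffI[OF G' P1 P0 B A]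
    by (auto simp: toeplitz_elliptic_def)
qed

text \<open>Idempotence of \<open>P0\<close> and \<open>P1\<close> gives the invariance. This is how
  an operator built from a parametrix in \<open>L\<close> is brought into the Toeplitz
  class.\<close>

lemma toeplitz_sandwich:
  assumes G: "(g0, g1) \<in> G" and P0: "P0 \<in> projections H L g0" and P1: "P1 \<in> projections H L g1"
    and A: "A \<in> L 0 (g0, g1)"
  shows "op_comp (H 0 g0) P1 (op_comp (H 0 g0) A P0) \<in> toeplitz H L 0 (g0, g1) P0 P1"
proof -
  note G0 = admissible_left[OF G] and G1 = admissible_right[OF G]
  note p0 = projectionsD[OF G0 P0] and p1 = projectionsD[OF G1 P1]
  show ?thesis
    unfolding toeplitz_iff[OF G P0 P1 order_refl]
    using L_comp0[OF G G1 p1(1) L_comp0[OF G0 G A p0(1)]]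
    by (simp add: op_apply L_closed[OF G0 p0(1)] L_closed[OF G A] p0(2) p1(2))
qed

end

section \<open>Symbols on fibres, normal operators and parametrices\<close>

context star_closed_sigma_algebra
begin

lemma adjoint_exists:
  assumes "(g0, g1) \<in> G" "A \<in> L 0 (g0, g1)"
  obtains B where "B \<in> L 0 (g1, g0)" "is_adjoint (H 0 g0) (H 0 g1) A B"
  using star_closed assms unfolding star_closed_def by blast

lemma symbol_closed:
  "(g0, g1) \<in> G \<Longrightarrow> l \<in> {1..n} \<Longrightarrow> A \<in> L 0 (g0, g1) \<Longrightarrow> x \<in> topspace (base (E l g0)) \<Longrightarrow>
    v \<in> carrier (fibre (E l g0) x) \<Longrightarrow> \<sigma> l (g0, g1) A x v \<in> carrier (fibre (E l g1) x)"
  by (rule bundle_morphisms_closed[OF symbol_morphism])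

text \<open>Morphisms exist only between bundles over a common base, and the symbol of the zero
  operator is such a morphism.\<close>

lemma symbol_base:
  assumes "(g0, g1) \<in> G" "l \<in> {1..n}"
  shows "base (E l g0) = base (E l g1)"
  using bundle_morphisms_base[OF symbol_morphism[OF assms L_zero[OF assms(1)]]] by simp

lemma fibre_hilbert:
  "(g, g) \<in> G \<Longrightarrow> l \<in> {1..n} \<Longrightarrow> x \<in> topspace (base (E l g)) \<Longrightarrow> hilbert_space (fibre (E l g) x)"
  by (rule hilbert_bundle.fibre_hilbert[OF symbol_bundle])

lemma symbol_comp_apply:
  assumes "(g0, g1) \<in> G" "(g1, g2) \<in> G" "l \<in> {1..n}" "A \<in> L 0 (g0, g1)" "B \<in> L 0 (g1, g2)"
    and "x \<in> topspace (base (E l g0))" "v \<in> carrier (fibre (E l g0) x)"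
  shows "\<sigma> l (g0, g2) (op_comp (H 0 g0) B A) x v = \<sigma> l (g1, g2) B x (\<sigma> l (g0, g1) A x v)"
  using symbol_comp[OF assms(1-5)] assms(6,7) by (simp add: mor_comp_apply)

lemma symbol_add_apply:
  assumes "(g0, g1) \<in> G" "l \<in> {1..n}" "A \<in> L 0 (g0, g1)" "B \<in> L 0 (g0, g1)"
    and "x \<in> topspace (base (E l g0))" "v \<in> carrier (fibre (E l g0) x)"
  shows "\<sigma> l (g0, g1) (op_add (H 0 g0) (H 0 g1) A B) x v =
    \<sigma> l (g0, g1) A x v \<oplus>\<^bsub>fibre (E l g1) x\<^esub> \<sigma> l (g0, g1) B x v"
  using symbol_add[OF assms(1-4)] assms(5,6) by (simp add: mor_add_def op_apply)

lemma symbol_diff_apply: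
  assumes G: "(g0, g1) \<in> G" and l: "l \<in> {1..n}" and A: "A \<in> L 0 (g0, g1)" and B: "B \<in> L 0 (g0, g1)"
    and x: "x \<in> topspace (base (E l g0))" and v: "v \<in> carrier (fibre (E l g0) x)"
  shows "\<sigma> l (g0, g1) (op_diff (H 0 g0) (H 0 g1) A B) x v =
    \<sigma> l (g0, g1) A x v \<ominus>\<^bsub>fibre (E l g1) x\<^esub> \<sigma> l (g0, g1) B x v"
proof -
  have x': "x \<in> topspace (base (E l g1))" using x symbol_base[OF G l] by simp
  have "\<sigma> l (g0, g1) (op_scale (H 0 g0) (H 0 g1) (- 1) B) x v =
      (- 1) \<odot>\<^bsub>fibre (E l g1) x\<^esub> \<sigma> l (g0, g1) B x v"
    using symbol_scale[OF G l B, of "- 1"] x v by (simp add: mor_scale_def op_apply)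
  then show ?thesis
    using symbol_add_apply[OF G l A L_scale[OF G order_refl B, of "- 1"] x v]
      hilbert_space.uminus_scale[OF fibre_hilbert[OF admissible_right[OF G] l x']
        symbol_closed[OF G l A x v] symbol_closed[OF G l B x v]]
    by (simp add: op_diff_eq_add_scale[OF hilbert L_closed[OF G A] L_closed[OF G B]])
qed

text \<open>The identity is elliptic, so its symbol is an invertible idempotent.\<close>

lemma symbol_id_apply:
  assumes G: "(g, g) \<in> G" and l: "l \<in> {1..n}"
    and x: "x \<in> topspace (base (E l g))" and v: "v \<in> carrier (fibre (E l g) x)"
  shows "\<sigma> l (g, g) (op_id (H 0 g)) x v = v"
proof -
  let ?I = "op_id (H 0 g)"
  note I = L_id[OF G]
  have II: "op_comp (H 0 g) ?I ?I = ?I"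
    by (auto simp: op_comp_def compose_def op_id_def)
  have "op_diff (H 0 g) (H 0 g) ?I ?I = op_zero (H 0 g) (H 0 g)"
    by (auto simp: op_diff_def op_zero_def op_id_def hilbert_space.diff_self[OF hilbert])
  then have "elliptic H L (g, g) ?I"
    using I II L_zero[OF G] by (auto simp: elliptic_def smoothing_def intro!: bexI[of _ ?I])
  then have "bundle_iso (E l g) (E l g) (\<sigma> l (g, g) ?I)" using symbol_elliptic[OF G I] l by simp
  then obtain b where "mor_comp (E l g) b (\<sigma> l (g, g) ?I) = bundle_id (E l g)"
    by (auto simp: bundle_iso_def)
  then have b: "b x (\<sigma> l (g, g) ?I x w) = w" if "w \<in> carrier (fibre (E l g) x)" for w
    using mor_comp_apply[OF x that, of b "\<sigma> l (g, g) ?I"] bundle_id_apply[OF x that] by simp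
  \<comment> \<open>An idempotent with a left inverse is the identity: apply \<open>b\<close> to
    both sides.\<close>
  have "\<sigma> l (g, g) ?I x (\<sigma> l (g, g) ?I x v) = \<sigma> l (g, g) ?I x v"
    using symbol_comp_apply[OF G G l I I x v] II by simp
  then show ?thesis using b[OF v] b[OF symbol_closed[OF G l I x v]] by simp
qed

lemma symbol_adjoint_fibre:
  assumes "(g0, g1) \<in> G" "l \<in> {1..n}" "A \<in> L 0 (g0, g1)" "B \<in> L 0 (g1, g0)"
    and "is_adjoint (H 0 g0) (H 0 g1) A B" "x \<in> topspace (base (E l g0))"
  shows "is_adjoint (fibre (E l g0) x) (fibre (E l g1) x) (\<sigma> l (g0, g1) A x) (\<sigma> l (g1, g0) B x)"
  using symbol_adjoint[OF assms(1-5)] assms(6) by (simp add: fibrewise_adjoint_def)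

lemma projection_symbol:
  assumes G: "(g, g) \<in> G" and l: "l \<in> {1..n}" and P: "P \<in> projections H L g"
  shows "bundle_projection (E l g) (\<sigma> l (g, g) P)"
proof (intro bundle_projection.intro bundle_projection_axioms.intro)
  note p = projections_L[OF G P]
  show "hilbert_bundle (E l g)" by (rule symbol_bundle[OF G l])
  show "\<sigma> l (g, g) P \<in> bundle_morphisms (E l g) (E l g)" by (rule symbol_morphism[OF G l p])
  show "\<sigma> l (g, g) P x (\<sigma> l (g, g) P x v) = \<sigma> l (g, g) P x v"
    if "x \<in> topspace (base (E l g))" "v \<in> carrier (fibre (E l g) x)" for x v
    using symbol_comp_apply[OF G G l p p that] P by (simp add: projections_def)
qed

lemma toeplitz_symbolD:
  assumes G: "(g0, g1) \<in> G" and P0: "P0 \<in> projections H L g0" and P1: "P1 \<in> projections H L g1"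
    and A: "A \<in> toeplitz H L 0 (g0, g1) P0 P1" and l: "l \<in> {1..n}"
    and x: "x \<in> topspace (base (E l g0))" and v: "v \<in> carrier (fibre (E l g0) x)"
  shows toeplitz_symbol_left: "\<sigma> l (g1, g1) P1 x (\<sigma> l (g0, g1) A x v) = \<sigma> l (g0, g1) A x v"
    and toeplitz_symbol_right: "\<sigma> l (g0, g1) A x (\<sigma> l (g0, g0) P0 x v) = \<sigma> l (g0, g1) A x v"
proof -
  note G0 = admissible_left[OF G] and G1 = admissible_right[OF G]
  note p0 = projections_L[OF G0 P0] and p1 = projections_L[OF G1 P1]
  note a = toeplitzD[OF G P0 P1 A]
  have "op_comp (H 0 g0) P1 A = A" "op_comp (H 0 g0) A P0 = A"
    by (rule L_eqI[OF G L_comp0[OF G G1 p1 a(1)] a(1)], simp add: op_apply a(2),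
        rule L_eqI[OF G L_comp0[OF G0 G a(1) p0] a(1)], simp add: op_apply a(3))
  then show "\<sigma> l (g1, g1) P1 x (\<sigma> l (g0, g1) A x v) = \<sigma> l (g0, g1) A x v"
    and "\<sigma> l (g0, g1) A x (\<sigma> l (g0, g0) P0 x v) = \<sigma> l (g0, g1) A x v"
    using symbol_comp_apply[OF G G1 l a(1) p1 x v] symbol_comp_apply[OF G0 G l p0 a(1) x v] by simp_all
qed

lemma toeplitz_bundle_simps [simp]:
  "base (toeplitz_bundle E \<sigma> l g P) = base (E l g)"
  "carrier (fibre (toeplitz_bundle E \<sigma> l g P) x) = \<sigma> l (g, g) P x ` carrier (fibre (E l g) x)"
  "add (fibre (toeplitz_bundle E \<sigma> l g P) x) = add (fibre (E l g) x)"
  "smult (fibre (toeplitz_bundle E \<sigma> l g P) x) = smult (fibre (E l g) x)"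
  "zero (fibre (toeplitz_bundle E \<sigma> l g P) x) = zero (fibre (E l g) x)"
  "hnorm (fibre (toeplitz_bundle E \<sigma> l g P) x) = hnorm (fibre (E l g) x)"
  by (simp_all add: toeplitz_bundle_def range_bundle_def range_space_def)

lemma toeplitz_bundle_carrier_iff:
  assumes "(g, g) \<in> G" "l \<in> {1..n}" "P \<in> projections H L g" "x \<in> topspace (base (E l g))"
  shows "v \<in> \<sigma> l (g, g) P x ` carrier (fibre (E l g) x) \<longleftrightarrow>
    v \<in> carrier (fibre (E l g) x) \<and> \<sigma> l (g, g) P x v = v"
  by (rule bundle_projection.range_iff[OF projection_symbol[OF assms(1-3)] assms(4)])

lemma toeplitz_symbol_apply:
  "x \<in> topspace (base (E l g0)) \<Longrightarrow> v \<in> \<sigma> l (g0, g0) P0 x ` carrier (fibre (E l g0) x) \<Longrightarrow>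
    toeplitz_symbol E \<sigma> l (g0, g1) P0 A x v = \<sigma> l (g0, g1) A x v"
  by (simp add: toeplitz_symbol_def mor_restrict_def)

lemma toeplitz_symbol_maps:
  assumes G: "(g0, g1) \<in> G" and P0: "P0 \<in> projections H L g0" and P1: "P1 \<in> projections H L g1"
    and A: "A \<in> toeplitz H L 0 (g0, g1) P0 P1" and l: "l \<in> {1..n}"
    and x: "x \<in> topspace (base (E l g0))" and v: "v \<in> carrier (fibre (E l g0) x)"
  shows "\<sigma> l (g0, g1) A x v \<in> \<sigma> l (g1, g1) P1 x ` carrier (fibre (E l g1) x)"
  using toeplitz_bundle_carrier_iff[OF admissible_right[OF G] l P1] symbol_base[OF G l] x
    symbol_closed[OF G l toeplitz_L[OF G P0 P1 A] x v] toeplitz_symbol_left[OF G P0 P1 A l x v] by simp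

lemma toeplitz_symbol_morphism:
  assumes G: "(g0, g1) \<in> G" and P0: "P0 \<in> projections H L g0" and P1: "P1 \<in> projections H L g1"
    and A: "A \<in> toeplitz H L 0 (g0, g1) P0 P1" and l: "l \<in> {1..n}"
  shows "toeplitz_symbol E \<sigma> l (g0, g1) P0 A \<in>
    bundle_morphisms (toeplitz_bundle E \<sigma> l g0 P0) (toeplitz_bundle E \<sigma> l g1 P1)"
proof -
  note G0 = admissible_left[OF G] and G1 = admissible_right[OF G]
  have "\<sigma> l (g0, g1) A x ` (\<sigma> l (g0, g0) P0 x ` carrier (fibre (E l g0) x)) \<subseteq>
      \<sigma> l (g1, g1) P1 x ` carrier (fibre (E l g1) x)" if x: "x \<in> topspace (base (E l g0))" for x
    using toeplitz_symbol_maps[OF G P0 P1 A l x] toeplitz_bundle_carrier_iff[OF G0 l P0 x] by blast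
  then show ?thesis
    using range_morphism[OF projection_symbol[OF G0 l P0] projection_symbol[OF G1 l P1]
        symbol_morphism[OF G l toeplitz_L[OF G P0 P1 A]]]
    by (simp add: toeplitz_bundle_def toeplitz_symbol_def)
qed

text \<open>Pairing the symbol of the operator applied to \<open>v\<close> with \<open>v\<close>
  gives the sum of the squared norms of the symbols of \<open>A\<close> and \<open>Q\<close> on
  \<open>v\<close>. The assumed bound makes this coercive, and \<open>coercive_iso\<close> applies
  in each fibre. The constant may depend on \<open>l\<close> and \<open>x\<close>, since
  \<open>bundle_iso_iff_fibrewise\<close> needs no uniform bound.\<close>

lemma normal_operator_elliptic:
  assumes G: "(g0, g1) \<in> G" and A: "A \<in> L 0 (g0, g1)" and As: "As \<in> L 0 (g1, g0)"
    and adjA: "is_adjoint (H 0 g0) (H 0 g1) A As"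
    and Q: "Q \<in> L 0 (g0, g0)" and Qs: "Qs \<in> L 0 (g0, g0)"
    and adjQ: "is_adjoint (H 0 g0) (H 0 g0) Q Qs"
    and bound: "\<And>l x. l \<in> {1..n} \<Longrightarrow> x \<in> topspace (base (E l g0)) \<Longrightarrow>
      \<exists>c. \<forall>v\<in>carrier (fibre (E l g0) x). hnorm (fibre (E l g0) x) v \<le>
        c * (hnorm (fibre (E l g1) x) (\<sigma> l (g0, g1) A x v) +
             hnorm (fibre (E l g0) x) (\<sigma> l (g0, g0) Q x v))"
  shows "elliptic H L (g0, g0)
    (op_add (H 0 g0) (H 0 g0) (op_comp (H 0 g0) As A) (op_comp (H 0 g0) Qs Q))"
    (is "elliptic H L (g0, g0) ?D")
proof -
  note G' = admissible_inverse[OF G] and G0 = admissible_left[OF G] and G1 = admissible_right[OF G]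
  note AA = L_comp0[OF G G' As A] and QQ = L_comp0[OF G0 G0 Qs Q]
  have D: "?D \<in> L 0 (g0, g0)" by (rule L_add[OF G0 order_refl AA QQ])
  have "bundle_iso (E l g0) (E l g0) (\<sigma> l (g0, g0) ?D)" if l: "l \<in> {1..n}" for l
    unfolding bundle_iso_iff_fibrewise[OF symbol_bundle[OF G0 l] symbol_bundle[OF G0 l] symbol_morphism[OF G0 l D]]
  proof
    fix x assume x: "x \<in> topspace (base (E l g0))"
    then have x1: "x \<in> topspace (base (E l g1))" using symbol_base[OF G l] by simp
    let ?F = "fibre (E l g0) x" and ?K = "fibre (E l g1) x"
    note F = fibre_hilbert[OF G0 l x] and K = fibre_hilbert[OF G1 l x1]
    let ?a = "\<sigma> l (g0, g1) A x" and ?q = "\<sigma> l (g0, g0) Q x"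
    note adj = symbol_adjoint_fibre[OF G l A As adjA x] symbol_adjoint_fibre[OF G0 l Q Qs adjQ x]
    obtain c0 where c0: "\<And>v. v \<in> carrier ?F \<Longrightarrow> hnorm ?F v \<le> c0 * (hnorm ?K (?a v) + hnorm ?F (?q v))"
      using bound[OF l x] by blast
    define c where "c = max c0 1"
    have c: "c > 0" by (simp add: c_def)
    \<comment> \<open>The coercivity constant \<open>1 / (2 * c\<^sup>2)\<close> comes from squaring
      the bound and using \<open>(?\<alpha> + ?\<beta>)\<^sup>2 \<le> 2 * (?\<alpha>\<^sup>2 +
      ?\<beta>\<^sup>2)\<close>.\<close>
    show "toplinear_iso ?F ?F (\<sigma> l (g0, g0) ?D x)"
    proof (rule coercive_iso[OF F bundle_morphisms_bounded[OF symbol_morphism[OF G0 l D] x], of "1 / (2 * c\<^sup>2)"])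
      show "1 / (2 * c\<^sup>2) > 0" using c by simp
      fix v assume v: "v \<in> carrier ?F"
      note av = symbol_closed[OF G l A x v] and qv = symbol_closed[OF G0 l Q x v]
      let ?\<alpha> = "hnorm ?K (?a v)" and ?\<beta> = "hnorm ?F (?q v)"
      have nn: "0 \<le> ?\<alpha>" "0 \<le> ?\<beta>"
        using hilbert_space.hnorm_ge_zero[OF K av] hilbert_space.hnorm_ge_zero[OF F qv] by auto
      have "\<sigma> l (g0, g0) ?D x v = \<sigma> l (g1, g0) As x (?a v) \<oplus>\<^bsub>?F\<^esub> \<sigma> l (g0, g0) Qs x (?q v)"
        using symbol_add_apply[OF G0 l AA QQ x v] symbol_comp_apply[OF G G' l A As x v]
          symbol_comp_apply[OF G0 G0 l Q Qs x v] by simp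
      then have "cinner ?F (\<sigma> l (g0, g0) ?D x v) v = cinner ?K (?a v) (?a v) + cinner ?F (?q v) (?q v)"
        using hilbert_space.cinner_add_left[OF F symbol_closed[OF G' l As x1 av] symbol_closed[OF G0 l Qs x qv] v]
          is_adjoint_cinner'[OF adj(1) F K v av] is_adjoint_cinner'[OF adj(2) F F v qv] by simp
      also have "\<dots> = complex_of_real (?\<alpha>\<^sup>2 + ?\<beta>\<^sup>2)"
        using hilbert_space.cinner_self[OF K av] hilbert_space.cinner_self[OF F qv] by simp
      finally have Re: "Re (cinner ?F (\<sigma> l (g0, g0) ?D x v) v) = ?\<alpha>\<^sup>2 + ?\<beta>\<^sup>2"
        by (metis Re_complex_of_real)
      have "hnorm ?F v \<le> c0 * (?\<alpha> + ?\<beta>)" by (rule c0[OF v])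
      also have "\<dots> \<le> c * (?\<alpha> + ?\<beta>)" using nn by (intro mult_right_mono) (auto simp: c_def)
      finally have "(hnorm ?F v)\<^sup>2 \<le> (c * (?\<alpha> + ?\<beta>))\<^sup>2"
        using hilbert_space.hnorm_ge_zero[OF F v] by (rule power_mono)
      also have "\<dots> = c\<^sup>2 * (?\<alpha> + ?\<beta>)\<^sup>2" by (simp add: power_mult_distrib)
      also have "\<dots> \<le> c\<^sup>2 * (2 * (?\<alpha>\<^sup>2 + ?\<beta>\<^sup>2))"
      proof (rule mult_left_mono)
        show "(?\<alpha> + ?\<beta>)\<^sup>2 \<le> 2 * (?\<alpha>\<^sup>2 + ?\<beta>\<^sup>2)"
          using sum_squares_ge_zero[of "?\<alpha> - ?\<beta>" 0] by (simp add: power2_eq_square algebra_simps)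
      qed simp
      finally show "1 / (2 * c\<^sup>2) * (hnorm ?F v)\<^sup>2 \<le> Re (cinner ?F (\<sigma> l (g0, g0) ?D x v) v)"
        using c Re by (simp add: field_simps)
    qed
  qed
  then show ?thesis using symbol_elliptic[OF G0 D] by blast
qed

text \<open>Splitting \<open>v\<close> into its \<open>P0\<close> part and its \<open>1 - P0\<close>
  part, the first is controlled by the symbol of \<open>A\<close> and the second by the symbol of
  \<open>Q\<close>. So \<open>D\<close> is elliptic, and a left parametrix of \<open>D\<close> in
  \<open>L\<close> is all that is taken from this.\<close>

lemma left_parametrix:
  assumes G: "(g0, g1) \<in> G" and P0: "P0 \<in> projections H L g0" and P1: "P1 \<in> projections H L g1"
    and A: "A \<in> toeplitz H L 0 (g0, g1) P0 P1"
    and bound: "\<And>l x. l \<in> {1..n} \<Longrightarrow> x \<in> topspace (base (E l g0)) \<Longrightarrow>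
      \<exists>c. \<forall>v\<in>carrier (fibre (E l g0) x). hnorm (fibre (E l g0) x) (\<sigma> l (g0, g0) P0 x v) \<le>
        c * hnorm (fibre (E l g1) x) (\<sigma> l (g0, g1) A x v)"
  shows "\<exists>B\<in>toeplitz H L 0 (g1, g0) P1 P0.
    op_diff (H 0 g0) (H 0 g0) (op_comp (H 0 g0) B A) P0 \<in> smoothing L (g0, g0)"
proof -
  note G' = admissible_inverse[OF G] and G0 = admissible_left[OF G] and G1 = admissible_right[OF G]
  note a = toeplitzD[OF G P0 P1 A]
  note p0 = projectionsD[OF G0 P0] and p1 = projectionsD[OF G1 P1]
  note I = L_id[OF G0]
  define Q where "Q = op_diff (H 0 g0) (H 0 g0) (op_id (H 0 g0)) P0"
  have Q: "Q \<in> L 0 (g0, g0)" unfolding Q_def by (rule L_diff[OF G0 order_refl I p0(1)])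
  obtain As where As: "As \<in> L 0 (g1, g0)" "is_adjoint (H 0 g0) (H 0 g1) A As"
    using adjoint_exists[OF G a(1)] .
  obtain Qs where Qs: "Qs \<in> L 0 (g0, g0)" "is_adjoint (H 0 g0) (H 0 g0) Q Qs"
    using adjoint_exists[OF G0 Q] .
  define D where "D = op_add (H 0 g0) (H 0 g0) (op_comp (H 0 g0) As A) (op_comp (H 0 g0) Qs Q)"
  have "elliptic H L (g0, g0) D"
    unfolding D_def
  proof (rule normal_operator_elliptic[OF G a(1) As Q Qs])
    fix l x assume l: "l \<in> {1..n}" and x: "x \<in> topspace (base (E l g0))"
    let ?F = "fibre (E l g0) x" and ?K = "fibre (E l g1) x"
    have x1: "x \<in> topspace (base (E l g1))" using x symbol_base[OF G l] by simp
    note F = fibre_hilbert[OF G0 l x] and K = fibre_hilbert[OF G1 l x1]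
    let ?a = "\<sigma> l (g0, g1) A x" and ?p = "\<sigma> l (g0, g0) P0 x"
    obtain c where c: "\<And>v. v \<in> carrier ?F \<Longrightarrow> hnorm ?F (?p v) \<le> c * hnorm ?K (?a v)"
      using bound[OF l x] by blast
    have "hnorm ?F v \<le> max c 1 * (hnorm ?K (?a v) + hnorm ?F (\<sigma> l (g0, g0) Q x v))"
      if v: "v \<in> carrier ?F" for v
    proof -
      have q: "\<sigma> l (g0, g0) Q x v = v \<ominus>\<^bsub>?F\<^esub> ?p v"
        unfolding Q_def using symbol_diff_apply[OF G0 l I p0(1) x v] symbol_id_apply[OF G0 l x v] by simp
      note pv = symbol_closed[OF G0 l p0(1) x v]
      have "hnorm ?F v \<le> hnorm ?F (v \<ominus>\<^bsub>?F\<^esub> ?p v) + hnorm ?F (?p v)"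
        by (rule hilbert_space.hnorm_le_diff[OF F v pv])
      also have "\<dots> \<le> 1 * hnorm ?F (v \<ominus>\<^bsub>?F\<^esub> ?p v) + c * hnorm ?K (?a v)" using c[OF v] by simp
      also have "\<dots> \<le> max c 1 * hnorm ?F (v \<ominus>\<^bsub>?F\<^esub> ?p v) + max c 1 * hnorm ?K (?a v)"
        using hilbert_space.hnorm_ge_zero[OF K symbol_closed[OF G l a(1) x v]]
          hilbert_space.hnorm_ge_zero[OF F, of "v \<ominus>\<^bsub>?F\<^esub> ?p v"] v pv F
        by (intro add_mono mult_right_mono) (auto simp: hilbert_closed)
      finally show ?thesis unfolding q by (simp add: algebra_simps)
    qed
    then show "\<exists>c. \<forall>v\<in>carrier ?F. hnorm ?F v \<le> c * (hnorm ?K (?a v) + hnorm ?F (\<sigma> l (g0, g0) Q x v))"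
      by blast
  qed
  then obtain D' where D: "D \<in> L 0 (g0, g0)" and D': "D' \<in> L 0 (g0, g0)"
    and R: "op_diff (H 0 g0) (H 0 g0) (op_comp (H 0 g0) D' D) (op_id (H 0 g0)) \<in> smoothing L (g0, g0)"
    by (auto simp: elliptic_def)
  define R' where "R' = op_diff (H 0 g0) (H 0 g0) (op_comp (H 0 g0) D' D) (op_id (H 0 g0))"
  note R' = R[folded R'_def]
  define B where "B = op_comp (H 0 g1) P0 (op_comp (H 0 g1) (op_comp (H 0 g1) D' As) P1)"
  have B: "B \<in> toeplitz H L 0 (g1, g0) P1 P0"
    unfolding B_def by (rule toeplitz_sandwich[OF G' P1 P0 L_comp0[OF G' G0 D' As(1)]])
  note cl = L_closed[OF G a(1)] L_closed[OF G' As(1)] L_closed[OF G0 p0(1)] L_closed[OF G1 p1(1)]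
    L_closed[OF G0 D] L_closed[OF G0 D']
  have DP: "D (P0 x) = As (A x)" if x: "x \<in> carrier (H 0 g0)" for x
  proof -
    have "Q (P0 x) = \<zero>\<^bsub>H 0 g0\<^esub>"
      using cl x p0(2) by (simp add: Q_def op_apply hilbert_space.diff_self[OF hilbert])
    then have "Qs (Q (P0 x)) = \<zero>\<^bsub>H 0 g0\<^esub>"
      using linear_ops_zero[OF hilbert hilbert bounded_ops_linear[OF L_bounded[OF G0 Qs(1)]]] by simp
    then have "D (P0 x) = As (A x) \<oplus>\<^bsub>H 0 g0\<^esub> \<zero>\<^bsub>H 0 g0\<^esub>"
      using x cl a(3) by (simp add: D_def op_apply)
    also have "\<dots> = As (A x)"
      using x cl by (intro hilbert_space.eq_by_cinner[OF hilbert, of _ 0 g0])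
        (simp_all add: cinner_linear hilbert_closed hilbert)
    finally show ?thesis .
  qed
  \<comment> \<open>\<open>R'\<close> is the remainder of \<open>D' D\<close>. Between two factors
    \<open>P0\<close> it becomes \<open>P0 D' As A - P0\<close> by \<open>DP\<close>, and this is
    \<open>B A - P0\<close> because \<open>P1 A = A\<close>.\<close>
  have "op_diff (H 0 g0) (H 0 g0) (op_comp (H 0 g0) B A) P0 =
      op_comp (H 0 g0) P0 (op_comp (H 0 g0) R' P0)" (is "?lhs = ?rhs")
  proof (rule extensionalityI[of _ "carrier (H 0 g0)"])
    fix x assume x: "x \<in> carrier (H 0 g0)"
    have "R' (P0 x) = D' (As (A x)) \<ominus>\<^bsub>H 0 g0\<^esub> P0 x"
      using x cl DP by (simp add: R'_def op_apply)
    then have "?rhs x = P0 (D' (As (A x))) \<ominus>\<^bsub>H 0 g0\<^esub> P0 x"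
      using x cl p0(2) by (simp add: op_apply L_apply_diff[OF G0 p0(1)])
    then show "?lhs x = ?rhs x" using x cl a(2) by (simp add: B_def op_apply)
  qed (simp_all add: op_diff_def op_comp_def compose_def)
  moreover have "?rhs \<in> smoothing L (g0, g0)"
    by (rule smoothing_comp_left[OF G0 G0 p0(1) smoothing_comp_right[OF G0 G0 R' p0(1)]])
  ultimately have "?lhs \<in> smoothing L (g0, g0)" by (simp only:)
  then show ?thesis using B by blast
qed

text \<open>The mirror image of \<open>left_parametrix\<close>: the normal operator is formed for
  \<open>As\<close>, so that \<open>A\<close> stands on the left and \<open>P1 D = A As\<close>. The
  adjoints are parameters because the bound refers to their symbols.\<close>

lemma right_parametrix:
  assumes G: "(g0, g1) \<in> G" and P0: "P0 \<in> projections H L g0" and P1: "P1 \<in> projections H L g1"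
    and A: "A \<in> toeplitz H L 0 (g0, g1) P0 P1"
    and As: "As \<in> L 0 (g1, g0)" "is_adjoint (H 0 g0) (H 0 g1) A As"
    and Ps: "Ps \<in> L 0 (g1, g1)" "is_adjoint (H 0 g1) (H 0 g1) P1 Ps"
    and bound: "\<And>l x. l \<in> {1..n} \<Longrightarrow> x \<in> topspace (base (E l g1)) \<Longrightarrow>
      \<exists>c. \<forall>v\<in>carrier (fibre (E l g1) x). hnorm (fibre (E l g1) x) (\<sigma> l (g1, g1) Ps x v) \<le>
        c * hnorm (fibre (E l g0) x) (\<sigma> l (g1, g0) As x v)"
  shows "\<exists>C\<in>toeplitz H L 0 (g1, g0) P1 P0.
    op_diff (H 0 g1) (H 0 g1) (op_comp (H 0 g1) A C) P1 \<in> smoothing L (g1, g1)"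
proof -
  note G' = admissible_inverse[OF G] and G0 = admissible_left[OF G] and G1 = admissible_right[OF G]
  note a = toeplitzD[OF G P0 P1 A]
  note p0 = projectionsD[OF G0 P0] and p1 = projectionsD[OF G1 P1]
  note I = L_id[OF G1]
  define Q where "Q = op_diff (H 0 g1) (H 0 g1) (op_id (H 0 g1)) P1"
  define Qs where "Qs = op_diff (H 0 g1) (H 0 g1) (op_id (H 0 g1)) Ps"
  have Q: "Q \<in> L 0 (g1, g1)" unfolding Q_def by (rule L_diff[OF G1 order_refl I p1(1)])
  have Qs: "Qs \<in> L 0 (g1, g1)" unfolding Qs_def by (rule L_diff[OF G1 order_refl I Ps(1)])
  have adj: "is_adjoint (H 0 g1) (H 0 g1) Qs Q"
    unfolding Q_def Qs_def by (rule is_adjoint_id_diff[OF is_adjoint_sym[OF Ps(2) hilbert hilbert] hilbert])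
  define D where "D = op_add (H 0 g1) (H 0 g1) (op_comp (H 0 g1) A As) (op_comp (H 0 g1) Q Qs)"
  have "elliptic H L (g1, g1) D"
    unfolding D_def
  proof (rule normal_operator_elliptic[OF G' As(1) a(1) is_adjoint_sym[OF As(2) hilbert hilbert] Qs Q adj])
    fix l x assume l: "l \<in> {1..n}" and x: "x \<in> topspace (base (E l g1))"
    let ?F = "fibre (E l g1) x" and ?K = "fibre (E l g0) x"
    have x0: "x \<in> topspace (base (E l g0))" using x symbol_base[OF G l] by simp
    note F = fibre_hilbert[OF G1 l x] and K = fibre_hilbert[OF G0 l x0]
    let ?a = "\<sigma> l (g1, g0) As x" and ?p = "\<sigma> l (g1, g1) Ps x"
    obtain c where c: "\<And>v. v \<in> carrier ?F \<Longrightarrow> hnorm ?F (?p v) \<le> c * hnorm ?K (?a v)"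
      using bound[OF l x] by blast
    have "hnorm ?F v \<le> max c 1 * (hnorm ?K (?a v) + hnorm ?F (\<sigma> l (g1, g1) Qs x v))"
      if v: "v \<in> carrier ?F" for v
    proof -
      have q: "\<sigma> l (g1, g1) Qs x v = v \<ominus>\<^bsub>?F\<^esub> ?p v"
        unfolding Qs_def using symbol_diff_apply[OF G1 l I Ps(1) x v] symbol_id_apply[OF G1 l x v] by simp
      note pv = symbol_closed[OF G1 l Ps(1) x v]
      have "hnorm ?F v \<le> hnorm ?F (v \<ominus>\<^bsub>?F\<^esub> ?p v) + hnorm ?F (?p v)"
        by (rule hilbert_space.hnorm_le_diff[OF F v pv])
      also have "\<dots> \<le> 1 * hnorm ?F (v \<ominus>\<^bsub>?F\<^esub> ?p v) + c * hnorm ?K (?a v)" using c[OF v] by simp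
      also have "\<dots> \<le> max c 1 * hnorm ?F (v \<ominus>\<^bsub>?F\<^esub> ?p v) + max c 1 * hnorm ?K (?a v)"
        using hilbert_space.hnorm_ge_zero[OF K symbol_closed[OF G' l As(1) x v]]
          hilbert_space.hnorm_ge_zero[OF F, of "v \<ominus>\<^bsub>?F\<^esub> ?p v"] v pv F
        by (intro add_mono mult_right_mono) (auto simp: hilbert_closed)
      finally show ?thesis unfolding q by (simp add: algebra_simps)
    qed
    then show "\<exists>c. \<forall>v\<in>carrier ?F. hnorm ?F v \<le> c * (hnorm ?K (?a v) + hnorm ?F (\<sigma> l (g1, g1) Qs x v))"
      by blast
  qed
  then obtain D' where D: "D \<in> L 0 (g1, g1)" and D': "D' \<in> L 0 (g1, g1)"
    and R: "op_diff (H 0 g1) (H 0 g1) (op_comp (H 0 g1) D D') (op_id (H 0 g1)) \<in> smoothing L (g1, g1)"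
    by (auto simp: elliptic_def)
  define R' where "R' = op_diff (H 0 g1) (H 0 g1) (op_comp (H 0 g1) D D') (op_id (H 0 g1))"
  note R' = R[folded R'_def]
  define C where "C = op_comp (H 0 g1) P0 (op_comp (H 0 g1) (op_comp (H 0 g1) As D') P1)"
  have C: "C \<in> toeplitz H L 0 (g1, g0) P1 P0"
    unfolding C_def by (rule toeplitz_sandwich[OF G' P1 P0 L_comp0[OF G1 G' As(1) D']])
  note cl = L_closed[OF G a(1)] L_closed[OF G' As(1)] L_closed[OF G0 p0(1)] L_closed[OF G1 p1(1)]
    L_closed[OF G1 D] L_closed[OF G1 D'] L_closed[OF G1 Qs]
  \<comment> \<open>\<open>P1\<close> fixes the range of \<open>A\<close> and annihilates the range
    of \<open>Q = 1 - P1\<close>, so only the first summand of \<open>D\<close> survives.\<close>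
  have PD: "P1 (D y) = A (As y)" if y: "y \<in> carrier (H 0 g1)" for y
  proof -
    have Qc: "Q z \<in> carrier (H 0 g1)" "P1 (Q z) = \<zero>\<^bsub>H 0 g1\<^esub>" if "z \<in> carrier (H 0 g1)" for z
      using that cl p1(2) L_closed[OF G1 Q that]
      by (simp_all add: Q_def op_apply L_apply_diff[OF G1 p1(1)] hilbert_space.diff_self[OF hilbert])
    have "P1 (D y) = A (As y) \<oplus>\<^bsub>H 0 g1\<^esub> \<zero>\<^bsub>H 0 g1\<^esub>"
      using y cl a(2) Qc by (simp add: D_def op_apply L_apply_add[OF G1 p1(1)])
    also have "\<dots> = A (As y)"
      using y cl by (intro hilbert_space.eq_by_cinner[OF hilbert, of _ 0 g1])
        (simp_all add: cinner_linear hilbert_closed hilbert)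
    finally show ?thesis .
  qed
  \<comment> \<open>Now \<open>R'\<close> is the remainder of \<open>D D'\<close>. Between two
    factors \<open>P1\<close> it becomes \<open>A As D' P1 - P1\<close> by \<open>PD\<close>, and
    this is \<open>A C - P1\<close> because \<open>A P0 = A\<close>.\<close>
  have "op_diff (H 0 g1) (H 0 g1) (op_comp (H 0 g1) A C) P1 =
      op_comp (H 0 g1) P1 (op_comp (H 0 g1) R' P1)" (is "?lhs = ?rhs")
  proof (rule extensionalityI[of _ "carrier (H 0 g1)"])
    fix y assume y: "y \<in> carrier (H 0 g1)"
    have "R' (P1 y) = D (D' (P1 y)) \<ominus>\<^bsub>H 0 g1\<^esub> P1 y"
      using y cl by (simp add: R'_def op_apply)
    then have "?rhs y = A (As (D' (P1 y))) \<ominus>\<^bsub>H 0 g1\<^esub> P1 y"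
      using y cl p1(2) PD by (simp add: op_apply L_apply_diff[OF G1 p1(1)])
    then show "?lhs y = ?rhs y" using y cl a(3) by (simp add: C_def op_apply)
  qed (simp_all add: op_diff_def op_comp_def compose_def)
  moreover have "?rhs \<in> smoothing L (g1, g1)"
    by (rule smoothing_comp_left[OF G1 G1 p1(1) smoothing_comp_right[OF G1 G1 R' p1(1)]])
  ultimately have "?lhs \<in> smoothing L (g1, g1)" by (simp only:)
  then show ?thesis using C by blast
qed

end

section \<open>Ellipticity and the symbol axioms for Toeplitz operators\<close>

context star_closed_sigma_algebra
begin

lemma toeplitz_symbol_comp:
  assumes G01: "(g0, g1) \<in> G" and G12: "(g1, g2) \<in> G" and l: "l \<in> {1..n}"
    and P0: "P0 \<in> projections H L g0" and P1: "P1 \<in> projections H L g1" and P2: "P2 \<in> projections H L g2"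
    and A: "A \<in> toeplitz H L 0 (g0, g1) P0 P1" and B: "B \<in> toeplitz H L 0 (g1, g2) P1 P2"
  shows "toeplitz_symbol E \<sigma> l (g0, g2) P0 (op_comp (H 0 g0) B A) =
    mor_comp (toeplitz_bundle E \<sigma> l g0 P0) (toeplitz_symbol E \<sigma> l (g1, g2) P1 B)
      (toeplitz_symbol E \<sigma> l (g0, g1) P0 A)" (is "?lhs = ?rhs")
proof (rule extensionalityI[of _ "topspace (base (E l g0))"])
  note a = toeplitz_L[OF G01 P0 P1 A] and b = toeplitz_L[OF G12 P1 P2 B]
  fix x assume x: "x \<in> topspace (base (E l g0))"
  then have x1: "x \<in> topspace (base (E l g1))" using symbol_base[OF G01 l] by simp
  let ?C = "\<sigma> l (g0, g0) P0 x ` carrier (fibre (E l g0) x)"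
  show "?lhs x = ?rhs x"
  proof (rule extensionalityI[of _ ?C])
    fix v assume v: "v \<in> ?C"
    then have v': "v \<in> carrier (fibre (E l g0) x)"
      using toeplitz_bundle_carrier_iff[OF admissible_left[OF G01] l P0 x] by blast
    show "?lhs x v = ?rhs x v"
      using v v' x x1 toeplitz_symbol_maps[OF G01 P0 P1 A l x v'] symbol_comp_apply[OF G01 G12 l a b x v']
      by (simp add: mor_comp_apply toeplitz_symbol_apply)
  qed (use x in \<open>simp_all add: toeplitz_symbol_def mor_restrict_def mor_comp_def op_comp_def compose_def\<close>)
qed (simp_all add: toeplitz_symbol_def mor_restrict_def mor_comp_def)

text \<open>Smoothing remainders have zero symbol, so the symbols of \<open>B A\<close> and
  \<open>A B\<close> are those of \<open>P0\<close> and \<open>P1\<close>, which act as the identity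
  on their own ranges. The restricted symbol of \<open>B\<close> is therefore the inverse.\<close>

lemma toeplitz_elliptic_imp_bundle_iso:
  assumes G: "(g0, g1) \<in> G" and P0: "P0 \<in> projections H L g0" and P1: "P1 \<in> projections H L g1"
    and A: "A \<in> toeplitz H L 0 (g0, g1) P0 P1" and l: "l \<in> {1..n}"
    and ell: "toeplitz_elliptic H L (g0, g1) P0 P1 A"
  shows "bundle_iso (toeplitz_bundle E \<sigma> l g0 P0) (toeplitz_bundle E \<sigma> l g1 P1)
    (toeplitz_symbol E \<sigma> l (g0, g1) P0 A)"
proof -
  note G' = admissible_inverse[OF G] and G0 = admissible_left[OF G] and G1 = admissible_right[OF G]
  obtain B where B: "B \<in> toeplitz H L 0 (g1, g0) P1 P0"
    and R: "op_diff (H 0 g0) (H 0 g0) (op_comp (H 0 g0) B A) P0 \<in> toeplitz_smoothing H L (g0, g0) P0 P0"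
    and S: "op_diff (H 0 g1) (H 0 g1) (op_comp (H 0 g1) A B) P1 \<in> toeplitz_smoothing H L (g1, g1) P1 P1"
    using ell by (auto simp: toeplitz_elliptic_def)
  \<comment> \<open>Stated for general data so that it applies to \<open>A\<close>, \<open>B\<close>
    and, with the roles exchanged, to \<open>B\<close>, \<open>A\<close>.\<close>
  have inverse: "mor_comp (toeplitz_bundle E \<sigma> l h0 Q0) (toeplitz_symbol E \<sigma> l (h1, h0) Q1 C)
      (toeplitz_symbol E \<sigma> l (h0, h1) Q0 D) = bundle_id (toeplitz_bundle E \<sigma> l h0 Q0)"
    if h: "(h0, h1) \<in> G" and Q0: "Q0 \<in> projections H L h0" and Q1: "Q1 \<in> projections H L h1"
      and D: "D \<in> toeplitz H L 0 (h0, h1) Q0 Q1" and C: "C \<in> toeplitz H L 0 (h1, h0) Q1 Q0"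
      and T: "op_diff (H 0 h0) (H 0 h0) (op_comp (H 0 h0) C D) Q0 \<in> toeplitz_smoothing H L (h0, h0) Q0 Q0"
    for h0 h1 Q0 Q1 C D
  proof (rule mor_comp_eq_idI)
    note h' = admissible_inverse[OF h] and h0 = admissible_left[OF h]
    note c = toeplitz_L[OF h' Q1 Q0 C] and d = toeplitz_L[OF h Q0 Q1 D] and q = projections_L[OF h0 Q0]
    note cd = L_comp0[OF h h' c d]
    fix x v assume "x \<in> topspace (base (toeplitz_bundle E \<sigma> l h0 Q0))"
      and "v \<in> carrier (fibre (toeplitz_bundle E \<sigma> l h0 Q0) x)"
    then have x: "x \<in> topspace (base (E l h0))" and v: "v \<in> \<sigma> l (h0, h0) Q0 x ` carrier (fibre (E l h0) x)"
      by simp_all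
    then have v': "v \<in> carrier (fibre (E l h0) x)" "\<sigma> l (h0, h0) Q0 x v = v"
      using toeplitz_bundle_carrier_iff[OF h0 l Q0 x] by auto
    have x1: "x \<in> topspace (base (E l h1))" using x symbol_base[OF h l] by simp
    note F = fibre_hilbert[OF h0 l x]
    have "\<sigma> l (h0, h0) (op_diff (H 0 h0) (H 0 h0) (op_comp (H 0 h0) C D) Q0) x v = \<zero>\<^bsub>fibre (E l h0) x\<^esub>"
      using symbol_smoothing[OF h0 l] T toeplitz_smoothing_iff[OF h0 Q0 Q0] x v'
      by (simp add: mor_zero_def op_apply)
    then have "\<sigma> l (h0, h0) (op_comp (H 0 h0) C D) x v = \<sigma> l (h0, h0) Q0 x v"
      using symbol_diff_apply[OF h0 l cd q x v'(1)]
        hilbert_space.diff_eq_zero[OF F symbol_closed[OF h0 l cd x v'(1)] symbol_closed[OF h0 l q x v'(1)]]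
      by simp
    then show "toeplitz_symbol E \<sigma> l (h1, h0) Q1 C x (toeplitz_symbol E \<sigma> l (h0, h1) Q0 D x v) = v"
      using v v' x x1 toeplitz_symbol_maps[OF h Q0 Q1 D l x v'(1)] symbol_comp_apply[OF h h' l d c x v'(1)]
      by (simp add: toeplitz_symbol_apply)
  qed
  show ?thesis
    unfolding bundle_iso_def
    using toeplitz_symbol_morphism[OF G P0 P1 A l] toeplitz_symbol_morphism[OF G' P1 P0 B l]
      inverse[OF G P0 P1 A B R] inverse[OF G' P1 P0 B A S] by blast
qed

text \<open>A bounded fibrewise inverse \<open>b\<close> of the restricted symbol yields both
  estimates. \<open>b a = p0\<close> bounds the symbol of \<open>P0\<close> by that of
  \<open>A\<close>. \<open>a b = 1\<close> on the range of \<open>p1\<close> bounds, by duality, the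
  symbol of \<open>Ps\<close> by that of \<open>As\<close>. The two one-sided parametrices are then
  combined by \<open>toeplitz_ellipticI\<close>.\<close>

lemma bundle_iso_imp_toeplitz_elliptic:
  assumes G: "(g0, g1) \<in> G" and P0: "P0 \<in> projections H L g0" and P1: "P1 \<in> projections H L g1"
    and A: "A \<in> toeplitz H L 0 (g0, g1) P0 P1"
    and iso: "\<And>l. l \<in> {1..n} \<Longrightarrow> bundle_iso (toeplitz_bundle E \<sigma> l g0 P0) (toeplitz_bundle E \<sigma> l g1 P1)
      (toeplitz_symbol E \<sigma> l (g0, g1) P0 A)"
  shows "toeplitz_elliptic H L (g0, g1) P0 P1 A"
proof -
  note G' = admissible_inverse[OF G] and G0 = admissible_left[OF G] and G1 = admissible_right[OF G]
  note a = toeplitz_L[OF G P0 P1 A] and p0 = projections_L[OF G0 P0] and p1 = projections_L[OF G1 P1]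
  \<comment> \<open>The inverse is expressed in the fibres of \<open>E\<close> itself, where
    adjoints are available. For arbitrary \<open>v\<close>, \<open>b\<close> applied to the symbol
    of \<open>A\<close> on \<open>v\<close> gives the projection of \<open>v\<close>, because the
    symbol of \<open>A\<close> factors through that of \<open>P0\<close>.\<close>
  have inverse: "\<exists>b c. c > 0 \<and> (\<forall>w\<in>\<sigma> l (g1, g1) P1 x ` carrier (fibre (E l g1) x).
      b w \<in> carrier (fibre (E l g0) x) \<and> \<sigma> l (g0, g1) A x (b w) = w \<and>
      hnorm (fibre (E l g0) x) (b w) \<le> c * hnorm (fibre (E l g1) x) w) \<and>
      (\<forall>v\<in>carrier (fibre (E l g0) x). b (\<sigma> l (g0, g1) A x v) = \<sigma> l (g0, g0) P0 x v)"
    if l: "l \<in> {1..n}" and x: "x \<in> topspace (base (E l g0))" for l x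
  proof -
    let ?R0 = "toeplitz_bundle E \<sigma> l g0 P0" and ?R1 = "toeplitz_bundle E \<sigma> l g1 P1"
    have x1: "x \<in> topspace (base (E l g1))" using x symbol_base[OF G l] by simp
    note r0 = bundle_projection.hilbert_bundle_range[OF projection_symbol[OF G0 l P0]]
      and r1 = bundle_projection.hilbert_bundle_range[OF projection_symbol[OF G1 l P1]]
    note c0 = toeplitz_bundle_carrier_iff[OF G0 l P0 x] and c1 = toeplitz_bundle_carrier_iff[OF G1 l P1 x1]
    have R1: "hilbert_space (fibre ?R1 x)"
      using hilbert_bundle.fibre_hilbert[OF r1] x1
      by (simp add: toeplitz_bundle_def range_bundle_def)
    have ti: "toplinear_iso (fibre ?R0 x) (fibre ?R1 x) (toeplitz_symbol E \<sigma> l (g0, g1) P0 A x)"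
      using iso[OF l] x bundle_iso_iff_fibrewise[of ?R0 ?R1, OF _ _ toeplitz_symbol_morphism[OF G P0 P1 A l]] r0 r1
      by (simp add: toeplitz_bundle_def range_bundle_def)
    define b where "b = op_inv (fibre ?R0 x) (fibre ?R1 x) (toeplitz_symbol E \<sigma> l (g0, g1) P0 A x)"
    note bij = toplinear_iso_bij[OF ti]
    obtain c where c: "c > 0" "\<And>w. w \<in> carrier (fibre ?R1 x) \<Longrightarrow> hnorm (fibre ?R0 x) (b w) \<le> c * hnorm (fibre ?R1 x) w"
      using bounded_opsE[OF R1 toplinear_iso_inv_bounded[OF ti]] unfolding b_def by blast
    have bw: "b w \<in> \<sigma> l (g0, g0) P0 x ` carrier (fibre (E l g0) x)" "\<sigma> l (g0, g1) A x (b w) = w"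
      if "w \<in> \<sigma> l (g1, g1) P1 x ` carrier (fibre (E l g1) x)" for w
    proof -
      show bc: "b w \<in> \<sigma> l (g0, g0) P0 x ` carrier (fibre (E l g0) x)"
        using op_inv_closed[OF bij, of w] that by (simp add: b_def)
      show "\<sigma> l (g0, g1) A x (b w) = w"
        using op_inv_right[OF bij, of w] that toeplitz_symbol_apply[OF x bc, of g1 A]
        by (simp add: b_def)
    qed
    have ba: "b (\<sigma> l (g0, g1) A x v) = \<sigma> l (g0, g0) P0 x v" if v: "v \<in> carrier (fibre (E l g0) x)" for v
    proof -
      have pv: "\<sigma> l (g0, g0) P0 x v \<in> \<sigma> l (g0, g0) P0 x ` carrier (fibre (E l g0) x)" using v by blast
      show ?thesis
        using op_inv_left[OF bij, of "\<sigma> l (g0, g0) P0 x v"] pv toeplitz_symbol_apply[OF x pv, of g1 A]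
          toeplitz_symbol_right[OF G P0 P1 A l x v] by (simp add: b_def)
    qed
    show ?thesis
    proof (intro exI conjI ballI)
      show "c > 0" by (rule c(1))
      fix w assume w: "w \<in> \<sigma> l (g1, g1) P1 x ` carrier (fibre (E l g1) x)"
      show "b w \<in> carrier (fibre (E l g0) x)" using bw(1)[OF w] c0 by blast
      show "\<sigma> l (g0, g1) A x (b w) = w" by (rule bw(2)[OF w])
      show "hnorm (fibre (E l g0) x) (b w) \<le> c * hnorm (fibre (E l g1) x) w" using c(2)[of w] w by simp
    qed (rule ba)
  qed
  \<comment> \<open>The symbol of \<open>A\<close> on \<open>v\<close> lies in the range of the
    symbol of \<open>P1\<close>, so the bound for \<open>b\<close> may be applied to it;
    \<open>b\<close> returns the projected vector.\<close>
  have left: "\<exists>B\<in>toeplitz H L 0 (g1, g0) P1 P0.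
      op_diff (H 0 g0) (H 0 g0) (op_comp (H 0 g0) B A) P0 \<in> smoothing L (g0, g0)"
  proof (rule left_parametrix[OF G P0 P1 A])
    fix l x assume l: "l \<in> {1..n}" and x: "x \<in> topspace (base (E l g0))"
    obtain b c where "\<forall>w\<in>\<sigma> l (g1, g1) P1 x ` carrier (fibre (E l g1) x).
        hnorm (fibre (E l g0) x) (b w) \<le> c * hnorm (fibre (E l g1) x) w"
      and "\<forall>v\<in>carrier (fibre (E l g0) x). b (\<sigma> l (g0, g1) A x v) = \<sigma> l (g0, g0) P0 x v"
      using inverse[OF l x] by blast
    then have "\<forall>v\<in>carrier (fibre (E l g0) x). hnorm (fibre (E l g0) x) (\<sigma> l (g0, g0) P0 x v) \<le>
        c * hnorm (fibre (E l g1) x) (\<sigma> l (g0, g1) A x v)"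
      using toeplitz_symbol_maps[OF G P0 P1 A l x] by metis
    then show "\<exists>c. \<forall>v\<in>carrier (fibre (E l g0) x). hnorm (fibre (E l g0) x) (\<sigma> l (g0, g0) P0 x v) \<le>
        c * hnorm (fibre (E l g1) x) (\<sigma> l (g0, g1) A x v)" by blast
  qed
  \<comment> \<open>Both adjoints are fixed here, before the estimate, because it compares their
    symbols.\<close>
  obtain As where As: "As \<in> L 0 (g1, g0)" "is_adjoint (H 0 g0) (H 0 g1) A As"
    using adjoint_exists[OF G a] .
  obtain Ps where Ps: "Ps \<in> L 0 (g1, g1)" "is_adjoint (H 0 g1) (H 0 g1) P1 Ps"
    using adjoint_exists[OF G1 p1] .
  have right: "\<exists>C\<in>toeplitz H L 0 (g1, g0) P1 P0.
      op_diff (H 0 g1) (H 0 g1) (op_comp (H 0 g1) A C) P1 \<in> smoothing L (g1, g1)"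
  proof (rule right_parametrix[OF G P0 P1 A As Ps])
    fix l x assume l: "l \<in> {1..n}" and x1: "x \<in> topspace (base (E l g1))"
    have x: "x \<in> topspace (base (E l g0))" using x1 symbol_base[OF G l] by simp
    let ?F = "fibre (E l g1) x" and ?K = "fibre (E l g0) x"
    note F = fibre_hilbert[OF G1 l x1] and K = fibre_hilbert[OF G0 l x]
    obtain b c where c: "c > 0" and b: "\<forall>w\<in>\<sigma> l (g1, g1) P1 x ` carrier ?F.
        b w \<in> carrier ?K \<and> \<sigma> l (g0, g1) A x (b w) = w \<and> hnorm ?K (b w) \<le> c * hnorm ?F w"
      using inverse[OF l x] by blast
    \<comment> \<open>\<open>m\<close> bounds the symbol of \<open>P1\<close> in this fibre; an
      oblique projection may have norm above \<open>1\<close>. The norm of \<open>z\<close> below is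
      then at most \<open>c * m\<close> times that of \<open>w\<close>, which explains the final
      constant.\<close>
    obtain m where m: "m > 0" "\<And>w. w \<in> carrier ?F \<Longrightarrow> hnorm ?F (\<sigma> l (g1, g1) P1 x w) \<le> m * hnorm ?F w"
      using bounded_opsE[OF F bundle_morphisms_bounded[OF symbol_morphism[OF G1 l p1] x1]] by blast
    have "hnorm ?F (\<sigma> l (g1, g1) Ps x v) \<le> c * m * hnorm ?K (\<sigma> l (g1, g0) As x v)"
      if v: "v \<in> carrier ?F" for v
    proof -
      \<comment> \<open>With \<open>w = p\<^sup>* v\<close> and \<open>z = b (p w)\<close> one has \<open>\<parallel>w\<parallel>\<^sup>2 = \<langle>p w, v\<rangle> = \<langle>a z, v\<rangle> = \<langle>z, a\<^sup>* v\<rangle>\<close>.\<close>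
      define w where "w = \<sigma> l (g1, g1) Ps x v"
      have w: "w \<in> carrier ?F" unfolding w_def by (rule symbol_closed[OF G1 l Ps(1) x1 v])
      have pw: "\<sigma> l (g1, g1) P1 x w \<in> \<sigma> l (g1, g1) P1 x ` carrier ?F" using w by blast
      define z where "z = b (\<sigma> l (g1, g1) P1 x w)"
      have z: "z \<in> carrier ?K" "\<sigma> l (g0, g1) A x z = \<sigma> l (g1, g1) P1 x w"
        "hnorm ?K z \<le> c * hnorm ?F (\<sigma> l (g1, g1) P1 x w)"
        using bspec[OF b pw] by (simp_all add: z_def)
      note av = symbol_closed[OF G' l As(1) x1 v]
      have "complex_of_real ((hnorm ?F w)\<^sup>2) = cinner ?F w (\<sigma> l (g1, g1) Ps x v)"
        using hilbert_space.cinner_self[OF F w] by (simp add: w_def)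
      also have "\<dots> = cinner ?F (\<sigma> l (g1, g1) P1 x w) v"
        by (rule is_adjoint_cinner[OF symbol_adjoint_fibre[OF G1 l p1 Ps x1] w v, symmetric])
      also have "\<dots> = cinner ?K z (\<sigma> l (g1, g0) As x v)"
        unfolding z(2)[symmetric] by (rule is_adjoint_cinner[OF symbol_adjoint_fibre[OF G l a As x] z(1) v])
      finally have "(hnorm ?F w)\<^sup>2 = cmod (cinner ?K z (\<sigma> l (g1, g0) As x v))"
        by (metis abs_power2 norm_of_real)
      also have "\<dots> \<le> hnorm ?K z * hnorm ?K (\<sigma> l (g1, g0) As x v)"
        by (rule hilbert_space.Cauchy_Schwarz[OF K z(1) av])
      also have "\<dots> \<le> (c * (m * hnorm ?F w)) * hnorm ?K (\<sigma> l (g1, g0) As x v)"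
      proof (rule mult_right_mono)
        have "c * hnorm ?F (\<sigma> l (g1, g1) P1 x w) \<le> c * (m * hnorm ?F w)" using m(2)[OF w] c by simp
        then show "hnorm ?K z \<le> c * (m * hnorm ?F w)" using z(3) by linarith
        show "0 \<le> hnorm ?K (\<sigma> l (g1, g0) As x v)" by (rule hilbert_space.hnorm_ge_zero[OF K av])
      qed
      finally have "hnorm ?F w * hnorm ?F w \<le> (c * m * hnorm ?K (\<sigma> l (g1, g0) As x v)) * hnorm ?F w"
        by (simp add: power2_eq_square mult_ac)
      then show ?thesis
        using c m(1) hilbert_space.hnorm_ge_zero[OF F w] hilbert_space.hnorm_ge_zero[OF K av]
        unfolding w_def by (cases "hnorm ?F (\<sigma> l (g1, g1) Ps x v) = 0") (auto simp: mult_le_cancel_right)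
    qed
    then show "\<exists>c. \<forall>v\<in>carrier ?F. hnorm ?F (\<sigma> l (g1, g1) Ps x v) \<le> c * hnorm ?K (\<sigma> l (g1, g0) As x v)"
      by blast
  qed
  show ?thesis using toeplitz_ellipticI[OF G P0 P1 A] left right by blast
qed

lemma toeplitz_elliptic_iff:
  assumes "(g0, g1) \<in> G" "P0 \<in> projections H L g0" "P1 \<in> projections H L g1"
    and "A \<in> toeplitz H L 0 (g0, g1) P0 P1"
  shows "toeplitz_elliptic H L (g0, g1) P0 P1 A \<longleftrightarrow>
    (\<forall>l\<in>{1..n}. bundle_iso (toeplitz_bundle E \<sigma> l g0 P0) (toeplitz_bundle E \<sigma> l g1 P1)
      (toeplitz_symbol E \<sigma> l (g0, g1) P0 A))"
  using toeplitz_elliptic_imp_bundle_iso[OF assms] bundle_iso_imp_toeplitz_elliptic[OF assms] by blast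

lemma toeplitz_symbol_add:
  assumes G: "(g0, g1) \<in> G" and P0: "P0 \<in> projections H L g0" and P1: "P1 \<in> projections H L g1"
    and l: "l \<in> {1..n}" and A: "A \<in> toeplitz H L 0 (g0, g1) P0 P1" and B: "B \<in> toeplitz H L 0 (g0, g1) P0 P1"
  shows "toeplitz_symbol E \<sigma> l (g0, g1) P0 (op_add (H 0 g0) (H 0 g1) A B) =
    mor_add (toeplitz_bundle E \<sigma> l g0 P0) (toeplitz_bundle E \<sigma> l g1 P1)
      (toeplitz_symbol E \<sigma> l (g0, g1) P0 A) (toeplitz_symbol E \<sigma> l (g0, g1) P0 B)" (is "?lhs = ?rhs")
proof (rule extensionalityI[of _ "topspace (base (E l g0))"])
  fix x assume x: "x \<in> topspace (base (E l g0))"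
  show "?lhs x = ?rhs x"
  proof (rule extensionalityI[of _ "\<sigma> l (g0, g0) P0 x ` carrier (fibre (E l g0) x)"])
    fix v assume v: "v \<in> \<sigma> l (g0, g0) P0 x ` carrier (fibre (E l g0) x)"
    then have v': "v \<in> carrier (fibre (E l g0) x)"
      using toeplitz_bundle_carrier_iff[OF admissible_left[OF G] l P0 x] by blast
    show "?lhs x v = ?rhs x v"
      using v x symbol_add_apply[OF G l toeplitz_L[OF G P0 P1 A] toeplitz_L[OF G P0 P1 B] x v']
      by (simp add: toeplitz_symbol_apply mor_add_def op_apply)
  qed (use x in \<open>simp_all add: toeplitz_symbol_def mor_restrict_def mor_add_def op_add_def\<close>)
qed (simp_all add: toeplitz_symbol_def mor_restrict_def mor_add_def)

lemma toeplitz_symbol_scale: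
  assumes G: "(g0, g1) \<in> G" and P0: "P0 \<in> projections H L g0" and P1: "P1 \<in> projections H L g1"
    and l: "l \<in> {1..n}" and A: "A \<in> toeplitz H L 0 (g0, g1) P0 P1"
  shows "toeplitz_symbol E \<sigma> l (g0, g1) P0 (op_scale (H 0 g0) (H 0 g1) c A) =
    mor_scale (toeplitz_bundle E \<sigma> l g0 P0) (toeplitz_bundle E \<sigma> l g1 P1) c
      (toeplitz_symbol E \<sigma> l (g0, g1) P0 A)" (is "?lhs = ?rhs")
proof (rule extensionalityI[of _ "topspace (base (E l g0))"])
  fix x assume x: "x \<in> topspace (base (E l g0))"
  show "?lhs x = ?rhs x"
  proof (rule extensionalityI[of _ "\<sigma> l (g0, g0) P0 x ` carrier (fibre (E l g0) x)"])
    fix v assume v: "v \<in> \<sigma> l (g0, g0) P0 x ` carrier (fibre (E l g0) x)"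
    then have v': "v \<in> carrier (fibre (E l g0) x)"
      using toeplitz_bundle_carrier_iff[OF admissible_left[OF G] l P0 x] by blast
    show "?lhs x v = ?rhs x v"
      using v v' x symbol_scale[OF G l toeplitz_L[OF G P0 P1 A], of c]
      by (simp add: toeplitz_symbol_apply mor_scale_def op_apply)
  qed (use x in \<open>simp_all add: toeplitz_symbol_def mor_restrict_def mor_scale_def op_scale_def\<close>)
qed (simp_all add: toeplitz_symbol_def mor_restrict_def mor_scale_def)

lemma toeplitz_symbol_smoothing:
  assumes G: "(g0, g1) \<in> G" and P0: "P0 \<in> projections H L g0" and P1: "P1 \<in> projections H L g1"
    and l: "l \<in> {1..n}" and R: "R \<in> toeplitz_smoothing H L (g0, g1) P0 P1"
  shows "toeplitz_symbol E \<sigma> l (g0, g1) P0 R =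
    mor_zero (toeplitz_bundle E \<sigma> l g0 P0) (toeplitz_bundle E \<sigma> l g1 P1)" (is "?lhs = ?rhs")
proof (rule extensionalityI[of _ "topspace (base (E l g0))"])
  have "R \<in> smoothing L (g0, g1)" using R toeplitz_smoothing_iff[OF G P0 P1] by blast
  note R' = symbol_smoothing[OF G l this]
  fix x assume x: "x \<in> topspace (base (E l g0))"
  show "?lhs x = ?rhs x"
  proof (rule extensionalityI[of _ "\<sigma> l (g0, g0) P0 x ` carrier (fibre (E l g0) x)"])
    fix v assume v: "v \<in> \<sigma> l (g0, g0) P0 x ` carrier (fibre (E l g0) x)"
    then have v': "v \<in> carrier (fibre (E l g0) x)"
      using toeplitz_bundle_carrier_iff[OF admissible_left[OF G] l P0 x] by blast
    show "?lhs x v = ?rhs x v"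
      using v v' x R' by (simp add: toeplitz_symbol_apply mor_zero_def op_apply)
  qed (use x in \<open>simp_all add: toeplitz_symbol_def mor_restrict_def mor_zero_def op_zero_def\<close>)
qed (simp_all add: toeplitz_symbol_def mor_restrict_def mor_zero_def)

text \<open>A datum is now a pair of an original datum and a projection. Each axiom reduces, after
  the pairs are split, to the corresponding statement about \<open>toeplitz_symbol\<close>.\<close>

lemma toeplitz_sigma_algebra: "toeplitz_sigma_algebra H G L n E \<sigma>"
proof -
  let ?D = "toeplitz_pairs H G L"
  have D: "(d0, d1) \<in> ?D \<longleftrightarrow> (fst d0, fst d1) \<in> G \<and>
      snd d0 \<in> projections H L (fst d0) \<and> snd d1 \<in> projections H L (fst d1)" for d0 d1
    by (cases d0; cases d1) (auto simp: toeplitz_pairs_def)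
  have hb: "hilbert_bundle (toeplitz_bundle E \<sigma> l g P)"
    if "(g, g) \<in> G" "P \<in> projections H L g" "l \<in> {1..n}" for l g P
    using bundle_projection.hilbert_bundle_range[OF projection_symbol[OF that(1,3,2)]]
    by (simp add: toeplitz_bundle_def)
  \<comment> \<open>The general notion of smoothing, instantiated with the pair-indexed classes, is
    \<open>toeplitz_smoothing\<close>; the vanishing axiom is stated with the former.\<close>
  have smoothing: "smoothing (\<lambda>\<mu> ((g0, P0), (g1, P1)). toeplitz H L \<mu> (g0, g1) P0 P1) (d0, d1) =
      toeplitz_smoothing H L (fst d0, fst d1) (snd d0) (snd d1)" for d0 d1
    by (cases d0; cases d1) (simp add: smoothing_def toeplitz_smoothing_def)
  show ?thesis
    unfolding toeplitz_sigma_algebra_def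
    by (intro sigma_algebra_symbol.intro)
      (auto simp: D smoothing[unfolded case_prod_unfold] case_prod_unfold toeplitz_symbol_morphism toeplitz_symbol_add
        toeplitz_symbol_scale toeplitz_symbol_comp toeplitz_symbol_smoothing toeplitz_elliptic_iff
        hb)
qed

end

theorem theorem3p12:
  fixes H :: "nat \<Rightarrow> 'g \<Rightarrow> 'v hilbert"
    and G :: "('g \<times> 'g) set"
    and L :: "int \<Rightarrow> 'g \<times> 'g \<Rightarrow> ('v \<Rightarrow> 'v) set"
    and n :: nat
    and E :: "nat \<Rightarrow> 'g \<Rightarrow> ('x, 'e) hbundle"
    and \<sigma> :: "nat \<Rightarrow> 'g \<times> 'g \<Rightarrow> ('v \<Rightarrow> 'v) \<Rightarrow> 'x \<Rightarrow> 'e \<Rightarrow> 'e"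
  assumes "star_closed_sigma_algebra H G L n E \<sigma>"
  shows "toeplitz_sigma_algebra H G L n E \<sigma> \<and>
    (\<forall>g0 g1 P0 P1 A.
       (g0, g1) \<in> G \<longrightarrow> P0 \<in> projections H L g0 \<longrightarrow> P1 \<in> projections H L g1 \<longrightarrow>
       A \<in> toeplitz H L 0 (g0, g1) P0 P1 \<longrightarrow>
       (toeplitz_elliptic H L (g0, g1) P0 P1 A \<longleftrightarrow>
        (\<forall>l\<in>{1..n}. bundle_iso (toeplitz_bundle E \<sigma> l g0 P0) (toeplitz_bundle E \<sigma> l g1 P1)
                      (toeplitz_symbol E \<sigma> l (g0, g1) P0 A))))"
proof -
  interpret star_closed_sigma_algebra H G L n E \<sigma> by fact
  show ?thesis using toeplitz_sigma_algebra toeplitz_elliptic_iff by blast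
qed

end
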